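(* Let $\ell\geq 2$ and let $\Delta$ be a $(d-1)$-dimensional flag homology sphere (over a field $\mathbb{K}$) with $2d+\ell$ vertices. Then $\gamma_{\ell-1}\in\{0,1,2,\ell\}$. Furthermore, if $\gamma_\ell=0$, then $0\leq\gamma_{\ell-1}\leq 2$, and $\gamma_{\ell-1}=2$ holds if and only if either $\Delta\cong\Sigma^m*^{\ell-2}C_5*C_6$ for some $m\geq 0$ ("first type"), or $\Delta$ is isomorphic to a complex obtained from $\Sigma^m*^{\ell-1}C_5$ (for some $m$) by the stellar subdivision of an edge containing a suspension vertex ("second type").
   Context: A simplicial complex is a finite family of subsets (faces) of a finite vertex set, closed under subsets, with every vertex a face; pure of dimension $d-1$ if all maximal faces have $d$ elements. Link: $\mathrm{lk}_\Delta(f)=\{g\in\Delta:g\cap f=\emptyset,\ g\cup f\in\Delta\}$. A $(d-1)$-dimensional homology sphere over $\mathbb{K}$ is a pure $(d-1)$-dimensional complex such that for every face $f$ (including $\emptyset$), $\tilde H_i(\mathrm{lk}_\Delta(f);\mathbb{K})$ is $0$ for $i<d-1-|f|$ and $\mathbb{K}$ for $i=d-1-|f|$. Flag: every minimal non-face has two elements. With $f_i$ the number of faces of cardinality $i$ ($f_0=1$) and $h(z)=\sum_{i=0}^d f_i(z-1)^{d-i}$, write uniquely $h(z)=\sum_{i=0}^{\lfloor d/2\rfloor}\gamma_iz^i(1+z)^{d-2i}$, with $\gamma_j:=0$ for $j>\lfloor d/2\rfloor$. Join: $\Delta_1*\Delta_2=\{f_1\sqcup f_2:f_i\in\Delta_i\}$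 (disjoint vertex sets); $*^{j}X$ is the $j$-fold join of copies of $X$, with $*^0X=\{\emptyset\}$. Suspension $\Sigma\Delta=S^0*\Delta$ ($S^0$ two isolated new vertices, the suspension vertices), $\Sigma^m$ its $m$-fold iterate; a suspension vertex of $\Sigma^m X$ is any of the $2m$ vertices added by the suspensions. $C_k$ is the $k$-cycle graph as a $1$-dimensional complex. The stellar subdivision of an edge $e=\{u,v\}$ of $\Delta$ with a new vertex $w$ is the complex $\{g\in\Delta: e\not\subseteq g\}\cup\{\{w\}\cup h\cup g: h\subsetneq e,\ g\in\mathrm{lk}_\Delta(e)\}$. *)

theory Defs
  imports Complex_Main "HOL-Computational_Algebra.Polynomial"
begin

section \<open>Simplicial complexes\<close>

text \<open>A complex is given by its set of faces (including the empty face). Since every vertex is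
  a face, the vertex set of \<open>\<Delta>\<close> is \<open>\<Union>\<Delta>\<close>.\<close>

definition simplicial_complex :: "'a set set \<Rightarrow> bool" where
  "simplicial_complex \<Delta> \<longleftrightarrow>
     finite (\<Union>\<Delta>) \<and> {} \<in> \<Delta> \<and> (\<forall>f\<in>\<Delta>. \<forall>g. g \<subseteq> f \<longrightarrow> g \<in> \<Delta>)"

definition link :: "'a set set \<Rightarrow> 'a set \<Rightarrow> 'a set set" where
  "link \<Delta> f = {g \<in> \<Delta>. g \<inter> f = {} \<and> g \<union> f \<in> \<Delta>}"

text \<open>The parameter \<open>d\<close> is the dimension plus one.\<close>

definition pure_complex :: "nat \<Rightarrow> 'a set set \<Rightarrow> bool" where
  "pure_complex d \<Delta> \<longleftrightarrow> (\<forall>f\<in>\<Delta>. (\<forall>g\<in>\<Delta>. f \<subseteq> g \<longrightarrow> g = f) \<longrightarrow> card f = d)"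

definition flag_complex :: "'a set set \<Rightarrow> bool" where
  "flag_complex \<Delta> \<longleftrightarrow>
     (\<forall>f. f \<subseteq> \<Union>\<Delta> \<and> f \<notin> \<Delta> \<and> (\<forall>g. g \<subset> f \<longrightarrow> g \<in> \<Delta>) \<longrightarrow> card f = 2)"

definition complex_iso :: "'a set set \<Rightarrow> 'b set set \<Rightarrow> bool" where
  "complex_iso \<Delta> \<Gamma> \<longleftrightarrow> (\<exists>\<phi>. bij_betw \<phi> (\<Union>\<Delta>) (\<Union>\<Gamma>) \<and> (\<lambda>f. \<phi> ` f) ` \<Delta> = \<Gamma>)"


section \<open>Reduced simplicial homology with field coefficients\<close>

text \<open>Oriented chains: an \<open>i\<close>-chain is an alternating function on the ordered \<open>i\<close>-simplices
  (repetition-free enumerations of the faces with \<open>i + 1\<close> elements), extended by 0 to all other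
  lists. The basis chain of an oriented simplex \<open>[v\<^sub>0,\<dots>,v\<^sub>i]\<close> takes the value \<open>sgn \<pi>\<close> on the
  list rearranged by \<open>\<pi>\<close>. No ordering of the vertices is needed. The index \<open>i\<close> is an integer,
  and the empty face contributes the (-1)-chains, so that the homology is reduced.\<close>

definition chains :: "'a set set \<Rightarrow> int \<Rightarrow> ('a list \<Rightarrow> 'k::field) set" where
  "chains \<Delta> i = {c.
     (\<forall>s. c s \<noteq> 0 \<longrightarrow> distinct s \<and> set s \<in> \<Delta> \<and> int (length s) = i + 1) \<and>
     (\<forall>xs u v ys. c (xs @ u # v # ys) = - c (xs @ v # u # ys))}"

text \<open>Applied to the basis chain of \<open>[v\<^sub>0,\<dots>,v\<^sub>i]\<close>, this is the usual alternating sum of the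
  basis chains of \<open>[v\<^sub>0,\<dots>,v\<^sub>j\<^sub>-\<^sub>1,v\<^sub>j\<^sub>+\<^sub>1,\<dots>,v\<^sub>i]\<close>: moving \<open>v\<^sub>j\<close> to the front costs the sign \<open>(-1)^j\<close>.\<close>

definition boundary :: "'a set set \<Rightarrow> ('a list \<Rightarrow> 'k::field) \<Rightarrow> 'a list \<Rightarrow> 'k" where
  "boundary \<Delta> c = (\<lambda>s. \<Sum>v\<in>\<Union>\<Delta>. c (v # s))"

definition cycles :: "'a set set \<Rightarrow> int \<Rightarrow> ('a list \<Rightarrow> 'k::field) set" where
  "cycles \<Delta> i = {c \<in> chains \<Delta> i. boundary \<Delta> c = (\<lambda>_. 0)}"

definition boundaries :: "'a set set \<Rightarrow> int \<Rightarrow> ('a list \<Rightarrow> 'k::field) set" where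
  "boundaries \<Delta> i = boundary \<Delta> ` chains \<Delta> (i + 1)"

definition homology_class ::
    "'a set set \<Rightarrow> int \<Rightarrow> ('a list \<Rightarrow> 'k::field) \<Rightarrow> ('a list \<Rightarrow> 'k) set" where
  "homology_class \<Delta> i z = {z' \<in> cycles \<Delta> i. (\<lambda>s. z' s - z s) \<in> boundaries \<Delta> i}"

definition reduced_homology :: "'a set set \<Rightarrow> int \<Rightarrow> ('a list \<Rightarrow> 'k::field) set set" where
  "reduced_homology \<Delta> i = homology_class \<Delta> i ` cycles \<Delta> i"

definition homology_zero :: "'k::field itself \<Rightarrow> 'a set set \<Rightarrow> int \<Rightarrow> bool" where
  "homology_zero K \<Delta> i \<longleftrightarrow>
     (reduced_homology \<Delta> i :: ('a list \<Rightarrow> 'k) set set) = {homology_class \<Delta> i (\<lambda>_. 0)}"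

text \<open>\<open>\<phi>\<close> is an isomorphism of vector spaces from the homology onto the field.\<close>

definition homology_iso_field :: "'k::field itself \<Rightarrow> 'a set set \<Rightarrow> int \<Rightarrow> bool" where
  "homology_iso_field K \<Delta> i \<longleftrightarrow>
     (\<exists>\<phi> :: ('a list \<Rightarrow> 'k) set \<Rightarrow> 'k.
        bij_betw \<phi> (reduced_homology \<Delta> i) UNIV \<and>
        (\<forall>x\<in>cycles \<Delta> i. \<forall>y\<in>cycles \<Delta> i.
           \<phi> (homology_class \<Delta> i (\<lambda>s. x s + y s)) =
             \<phi> (homology_class \<Delta> i x) + \<phi> (homology_class \<Delta> i y)) \<and>
        (\<forall>a. \<forall>x\<in>cycles \<Delta> i.
           \<phi> (homology_class \<Delta> i (\<lambda>s. a * x s)) = a * \<phi> (homology_class \<Delta> i x)))"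

text \<open>Homology sphere of dimension \<open>d - 1\<close> over the field \<open>'k\<close>.\<close>

definition homology_sphere :: "'k::field itself \<Rightarrow> nat \<Rightarrow> 'a set set \<Rightarrow> bool" where
  "homology_sphere K d \<Delta> \<longleftrightarrow>
     simplicial_complex \<Delta> \<and> pure_complex d \<Delta> \<and>
     (\<forall>f\<in>\<Delta>.
        (\<forall>i::int. i < int d - 1 - int (card f) \<longrightarrow> homology_zero K (link \<Delta> f) i) \<and>
        homology_iso_field K (link \<Delta> f) (int d - 1 - int (card f)))"


section \<open>The \<open>\<gamma>\<close>-vector\<close>

definition h_poly :: "nat \<Rightarrow> 'a set set \<Rightarrow> int poly" where
  "h_poly d \<Delta> =
     (\<Sum>i\<le>d. smult (int (card {f \<in> \<Delta>. card f = i})) ([:-1, 1:] ^ (d - i)))"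

text \<open>The expansion is unique, and it exists whenever the \<open>h\<close>-polynomial is palindromic of
  degree at most \<open>d\<close>, in particular for homology spheres (Dehn--Sommerville).\<close>

definition gamma_vec :: "nat \<Rightarrow> 'a set set \<Rightarrow> nat \<Rightarrow> int" where
  "gamma_vec d \<Delta> = (THE \<gamma>.
     h_poly d \<Delta> = (\<Sum>i\<le>d div 2. smult (\<gamma> i) (monom 1 i * [:1, 1:] ^ (d - 2 * i))) \<and>
     (\<forall>j>d div 2. \<gamma> j = 0))"


section \<open>Joins, suspensions, cycles, and stellar subdivision\<close>

definition relabel :: "('a \<Rightarrow> 'b) \<Rightarrow> 'a set set \<Rightarrow> 'b set set" where
  "relabel \<phi> \<Delta> = (\<lambda>f. \<phi> ` f) ` \<Delta>"

text \<open>Only to be used for complexes with disjoint vertex sets.\<close>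

definition join :: "'a set set \<Rightarrow> 'a set set \<Rightarrow> 'a set set" where
  "join \<Delta> \<Gamma> = {f \<union> g | f g. f \<in> \<Delta> \<and> g \<in> \<Gamma>}"

text \<open>The copies of \<open>X\<close> are made disjoint by tagging their vertices with the copy number.\<close>

fun join_power :: "nat \<Rightarrow> 'a set set \<Rightarrow> (nat \<times> 'a) set set" where
  "join_power 0 X = {{}}"
| "join_power (Suc j) X = join (join_power j X) (relabel (Pair j) X)"

text \<open>The two vertices added by the suspension number \<open>i\<close> (counted from 0) are
  \<open>Inl (i, False)\<close> and \<open>Inl (i, True)\<close>.\<close>

fun suspension_power :: "nat \<Rightarrow> 'a set set \<Rightarrow> (nat \<times> bool + 'a) set set" where
  "suspension_power 0 X = relabel Inr X"
| "suspension_power (Suc m) X =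
     join {{}, {Inl (m, False)}, {Inl (m, True)}} (suspension_power m X)"

definition suspension_vertices :: "nat \<Rightarrow> (nat \<times> bool + 'a) set" where
  "suspension_vertices m = {Inl (i, b) | i b. i < m}"

definition cycle_complex :: "nat \<Rightarrow> nat set set" where
  "cycle_complex k = {{}} \<union> {{i} | i. i < k} \<union> {{i, (i + 1) mod k} | i. i < k}"

definition stellar_subdivision :: "'a set \<Rightarrow> 'a \<Rightarrow> 'a set set \<Rightarrow> 'a set set" where
  "stellar_subdivision e w \<Delta> =
     {g \<in> \<Delta>. \<not> e \<subseteq> g} \<union> {{w} \<union> h \<union> g | h g. h \<subset> e \<and> g \<in> link \<Delta> e}"

definition first_type :: "nat \<Rightarrow> 'a set set \<Rightarrow> bool" where
  "first_type l \<Delta> \<longleftrightarrow>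
     (\<exists>m. complex_iso \<Delta>
        (suspension_power m
          (join (relabel Inl (join_power (l - 2) (cycle_complex 5)))
                (relabel Inr (cycle_complex 6)))))"

definition second_type :: "nat \<Rightarrow> 'a set set \<Rightarrow> bool" where
  "second_type l \<Delta> \<longleftrightarrow>
     (\<exists>m u v w. let X = suspension_power m (join_power (l - 1) (cycle_complex 5)) in
        {u, v} \<in> X \<and> u \<noteq> v \<and> u \<in> suspension_vertices m \<and> w \<notin> \<Union>X \<and>
        complex_iso \<Delta> (stellar_subdivision {u, v} w X))"

end

theory Submission
  imports Defs "HOL-Library.Function_Algebras"
begin

text \<open>Let the number of vertices be \<open>2d + \<ell>\<close>. A vertex with a single non-neighbour splits off a
  suspension, which does not change \<open>\<gamma>\<close>, so assume that there is none. Fix a facet \<open>K\<close>. Every vertex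
  of \<open>K\<close> has one opposite vertex, and \<open>\<ell>\<close> far vertices remain, each non-adjacent to at least two
  vertices of \<open>K\<close>, those it misses. A far vertex that misses more than two contributes at most one
  missed vertex that no smaller missed set contains; as all of \<open>K\<close> is missed, \<open>d \<le> 2\<ell>\<close>, and equality
  forces a join of pentagons. The same count shows that for \<open>d \<ge> 2\<ell> - 2\<close> the complex is a hexagon or
  some vertex \<open>v\<close> has exactly two non-neighbours \<open>a\<close>, \<open>b\<close>. They span an edge, and
  \<open>\<gamma>(\<Delta>) = \<gamma>(lk v) + t \<gamma>(lk ab)\<close>. If \<open>\<gamma>\<^sub>1(lk ab) = \<ell> - 1\<close>, the complex is the join of a pentagon with
  \<open>lk ab\<close>, and induction applies; otherwise both summands contribute at most 1 to \<open>\<gamma>\<close> in degree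
  \<open>\<ell> - 1\<close>, and two contributions give a subdivided edge. For \<open>d < 2\<ell> - 2\<close> the entry vanishes because
  its degree exceeds \<open>d / 2\<close>.\<close>

section \<open>Clique complexes of graphs\<close>

text \<open>Two facts replace topology. A vertex adjacent to all others would make a sphere a cone
  with Euler value 0, so in every link every vertex has a non-neighbour. And a sphere contains no
  proper closed complex of its own dimension (\<open>closed_eq\<close>): inclusions between links
  become equalities, and a suspension assembled from known vertices fills the sphere and leaves no
  place for a further vertex.

  The bound 1 on each summand arises as follows. Without suspensions, \<gamma>_l vanishes by degree
  if d < 2l, and otherwise the sphere is a join of l pentagons with \<gamma>-polynomial (1 + t)^l.
  In vertices beyond twice its d, the link of \<open>v\<close> has l - 1, and the link of the edge
  at most l - 2 unless a pentagon splits off. The values l and 2 are the coefficients at t^(l - 1)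
  of (1 + t)^l and of (1 + t)^(l - 2) (1 + 2t); the latter belongs to the hexagon type and to
  subdivisions at an edge with one suspension vertex. If both ends are suspension vertices, a square
  becomes a pentagon and \<gamma>_l = 1, hence the condition \<gamma>_l = 0.\<close>

locale ugraph =
  fixes E :: "'a \<Rightarrow> 'a \<Rightarrow> bool"
  assumes sym: "E x y \<Longrightarrow> E y x"
    and irrefl: "\<not> E x x"
begin

definition nb :: "'a set \<Rightarrow> 'a \<Rightarrow> 'a set" where
  "nb U v = {x \<in> U. E v x}"

definition nn :: "'a set \<Rightarrow> 'a \<Rightarrow> 'a set" where
  "nn U v = {x \<in> U. x \<noteq> v \<and> \<not> E v x}"

definition cliques :: "'a set \<Rightarrow> 'a set set" where
  "cliques U = {f. f \<subseteq> U \<and> finite f \<and> (\<forall>x\<in>f. \<forall>y\<in>f. x \<noteq> y \<longrightarrow> E x y)}"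

definition lk :: "'a set \<Rightarrow> 'a set \<Rightarrow> 'a set" where
  "lk U f = {x \<in> U. \<forall>y\<in>f. E y x}"

definition connected_on :: "'a set \<Rightarrow> bool" where
  "connected_on U \<longleftrightarrow> (\<forall>A\<subseteq>U. A \<noteq> {} \<longrightarrow> (\<forall>a\<in>A. nb U a \<subseteq> A) \<longrightarrow> A = U)"

definition fpoly :: "'a set \<Rightarrow> int poly" where
  "fpoly U = (\<Sum>f\<in>cliques U. monom 1 (card f))"

text \<open>In a flag complex, viewed as the cliques of its graph, the link of a vertex consists of the
  cliques of its neighbourhood, so spheres and all their iterated links are sets of vertices of one
  graph. Of the homology of the links, only the Euler characteristic and the connectedness are
  remembered.\<close>

primrec sph :: "nat \<Rightarrow> 'a set \<Rightarrow> bool" where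
  "sph 0 U \<longleftrightarrow> U = {}"
| "sph (Suc d) U \<longleftrightarrow> finite U \<and> U \<noteq> {} \<and> (\<forall>v\<in>U. sph d (nb U v)) \<and>
     poly (fpoly U) (-1) = (-1) ^ Suc d \<and> (d \<ge> 1 \<longrightarrow> connected_on U)"

text \<open>Just enough structure for a sphere to have no proper subcomplex of this kind of its own
  dimension.\<close>

fun closed_pm :: "nat \<Rightarrow> 'a set \<Rightarrow> bool" where
  "closed_pm 0 U \<longleftrightarrow> True"
| "closed_pm (Suc 0) U \<longleftrightarrow> finite U \<and> card U \<ge> 2"
| "closed_pm (Suc (Suc d)) U \<longleftrightarrow> U \<noteq> {} \<and> (\<forall>v\<in>U. closed_pm (Suc d) (nb U v))"

section \<open>Cliques and their generating polynomial\<close>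

lemma in_nb: "x \<in> nb U v \<longleftrightarrow> x \<in> U \<and> E v x" by (auto simp: nb_def)

lemma nb_nb_commute: "nb (nb U a) b = nb (nb U b) a" by (auto simp: nb_def)

lemma nb_partition: "v \<in> U \<Longrightarrow> U = insert v (nb U v \<union> nn U v)"
  by (auto simp: nb_def nn_def irrefl)

lemma card_nb:
  assumes "finite U" "v \<in> U"
  shows "card U = 1 + card (nb U v) + card (nn U v)"
proof -
  have 1: "v \<notin> nb U v \<union> nn U v" "nb U v \<inter> nn U v = {}"
    by (auto simp: nb_def nn_def irrefl)
  have 2: "finite (nb U v)" "finite (nn U v)" using assms(1) by (auto simp: nb_def nn_def)
  have "card U = card (insert v (nb U v \<union> nn U v))" using nb_partition[OF assms(2)] by simp
  also have "\<dots> = 1 + card (nb U v) + card (nn U v)"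
    using 1 2 by (simp add: card_Un_disjoint)
  finally show ?thesis .
qed

lemma finite_cliques: "finite U \<Longrightarrow> finite (cliques U)"
  by (rule finite_subset[of _ "Pow U"]) (auto simp: cliques_def)

lemma empty_clique: "{} \<in> cliques U" by (auto simp: cliques_def)

lemma cliques_mono: "U \<subseteq> W \<Longrightarrow> cliques U \<subseteq> cliques W" by (auto simp: cliques_def)

lemma clique_subset: "f \<in> cliques U \<Longrightarrow> g \<subseteq> f \<Longrightarrow> g \<in> cliques U"
  by (auto simp: cliques_def intro: finite_subset)

lemma Union_cliques: "\<Union>(cliques U) = U"
proof -
  have "x \<in> U \<Longrightarrow> {x} \<in> cliques U" for x by (auto simp: cliques_def)
  then show ?thesis by (auto simp: cliques_def)
qed

lemma cliques_insert:
  assumes "v \<in> U"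
  shows "cliques U = cliques (U - {v}) \<union> insert v ` cliques (nb U v)"
proof
  show "cliques U \<subseteq> cliques (U - {v}) \<union> insert v ` cliques (nb U v)"
  proof
    fix f assume f: "f \<in> cliques U"
    show "f \<in> cliques (U - {v}) \<union> insert v ` cliques (nb U v)"
    proof (cases "v \<in> f")
      case True
      then have "f = insert v (f - {v})" "f - {v} \<in> cliques (nb U v)"
        using f by (auto simp: cliques_def nb_def)
      then show ?thesis by blast
    next
      case False
      then show ?thesis using f by (auto simp: cliques_def)
    qed
  qed
  show "cliques (U - {v}) \<union> insert v ` cliques (nb U v) \<subseteq> cliques U"
    using assms by (auto simp: cliques_def nb_def intro: sym)
qed

lemma fpoly_delete:
  assumes "finite U" "v \<in> U"
  shows "fpoly U = fpoly (U - {v}) + [:0,1:] * fpoly (nb U v)"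
proof -
  have fin: "finite (cliques (U - {v}))" "finite (cliques (nb U v))"
    using assms by (auto intro!: finite_cliques simp: nb_def)
  have v: "v \<notin> f" "finite f" if "f \<in> cliques (nb U v)" for f
    using that by (auto simp: cliques_def nb_def irrefl)
  have inj: "inj_on (insert v) (cliques (nb U v))"
    by (intro inj_onI) (metis insert_ident v(1))
  have disj: "cliques (U - {v}) \<inter> insert v ` cliques (nb U v) = {}"
    by (auto simp: cliques_def)
  have "(\<Sum>f\<in>insert v ` cliques (nb U v). monom (1::int) (card f)) =
      (\<Sum>f\<in>cliques (nb U v). monom 1 (Suc (card f)))"
    using v by (subst sum.reindex[OF inj]) (auto intro!: sum.cong)
  also have "\<dots> = [:0,1:] * fpoly (nb U v)"
    unfolding fpoly_def sum_distrib_left by (intro sum.cong refl) (simp add: monom_Suc)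
  finally show ?thesis
    unfolding fpoly_def[of U] cliques_insert[OF assms(2)] fpoly_def[of "U - {v}"]
    using fin disj by (subst sum.union_disjoint) auto
qed

lemma fpoly_empty: "fpoly {} = 1"
proof -
  have "cliques {} = {{}}" by (auto simp: cliques_def)
  then show ?thesis by (simp add: fpoly_def one_poly_eq_simps)
qed

lemma poly_fpoly_0:
  assumes "finite U"
  shows "poly (fpoly U) 0 = 1"
proof -
  have "poly (fpoly U) 0 = (\<Sum>f\<in>cliques U. if f = {} then 1 else 0)"
    unfolding fpoly_def poly_sum
    by (intro sum.cong refl) (auto simp: poly_monom cliques_def)
  also have "\<dots> = 1" using finite_cliques[OF assms] empty_clique by simp
  finally show ?thesis .
qed

lemma fpoly_cone:
  assumes "finite U" "v \<in> U" "nn U v = {}"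
  shows "fpoly U = [:1,1:] * fpoly (U - {v})"
proof -
  have "nb U v = U - {v}" using assms(2,3) by (auto simp: nb_def nn_def irrefl)
  then show ?thesis using fpoly_delete[OF assms(1,2)]
    by (simp add: algebra_simps)
qed

section \<open>Spheres as sets of vertices, and their rigidity\<close>

lemma sph_finite: "sph d U \<Longrightarrow> finite U"
  by (cases d) auto

lemma sph_nonempty: "sph d U \<Longrightarrow> d > 0 \<Longrightarrow> U \<noteq> {}"
  by (cases d) auto

lemma sph_nb: "sph d U \<Longrightarrow> v \<in> U \<Longrightarrow> sph (d - 1) (nb U v)"
  by (cases d) auto

lemma sph_pos: "sph d U \<Longrightarrow> v \<in> U \<Longrightarrow> d > 0"
  by (cases d) auto

lemma sph_euler: "sph d U \<Longrightarrow> poly (fpoly U) (-1) = (-1) ^ d"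
  by (cases d) (auto simp: fpoly_empty)

text \<open>A vertex without non-neighbours is the apex of a cone, whose polynomial has the factor 1
  + t and vanishes at -1, where a sphere has the value 1 or -1.\<close>

lemma nn_nonempty:
  assumes "sph d U" "v \<in> U"
  shows "nn U v \<noteq> {}"
proof
  assume "nn U v = {}"
  then have "poly (fpoly U) (-1) = 0"
    using fpoly_cone[OF sph_finite[OF assms(1)] assms(2)] by simp
  then show False using sph_euler[OF assms(1)] by simp
qed

text \<open>All neighbourhoods are empty, so the faces are the empty set and the vertices, and the
  Euler value 1 - \<open>card U\<close> has to be -1.\<close>

lemma sph_1_card:
  assumes "sph (Suc 0) U"
  shows "card U = 2"
proof -
  have fin: "finite U" using assms by simp
  have ind: "nb U v = {}" if "v \<in> U" for v using assms that by simp
  have "poly (fpoly W) (-1) = 1 - int (card W)" if "W \<subseteq> U" for W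
  proof -
    have "finite W" using that fin finite_subset by blast
    then show ?thesis using that
    proof (induction W)
      case empty
      show ?case by (simp add: fpoly_empty)
    next
      case (insert v W)
      have "nb (insert v W) v = {}" using ind[of v] insert.prems by (auto simp: nb_def)
      then have "fpoly (insert v W) = fpoly W + [:0,1:]"
        using fpoly_delete[of "insert v W" v] insert by (simp add: fpoly_empty)
      then show ?case using insert by simp
    qed
  qed
  from this[of U] have "1 - int (card U) = -1" using assms by simp
  then show ?thesis by simp
qed

lemma sph_closed: "sph d U \<Longrightarrow> closed_pm d U"
proof (induction d U rule: closed_pm.induct)
  case (2 U)
  then show ?case using sph_1_card[OF 2] by (simp del: One_nat_def)
next
  case (3 d U)
  then show ?case by auto
qed auto

text \<open>Rigidity. By induction the neighbourhood in \<open>W\<close> of a vertex of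
  \<open>W\<close> is its whole neighbourhood in \<open>U\<close>; thus \<open>W\<close> is closed
  under adjacency, and connectedness of \<open>U\<close> makes it everything. In dimension 0, at
  least two points inside two points leave no choice.\<close>

lemma closed_eq:
  assumes "sph d U" "closed_pm d W" "W \<subseteq> U"
  shows "W = U"
  using assms
proof (induction d W arbitrary: U rule: closed_pm.induct)
  case (1 W)
  then show ?case by auto
next
  case (2 W)
  then show ?case using sph_1_card[OF 2(1)] card_seteq[of U W] by auto
next
  case (3 d W)
  have "nb U a \<subseteq> W" if "a \<in> W" for a
  proof -
    have "nb W a = nb U a"
      using 3 that by (intro 3(1)) (auto simp: nb_def)
    then show ?thesis by (auto simp: nb_def)
  qed
  moreover have "connected_on U" using 3 by simp
  ultimately show ?case using 3 unfolding connected_on_def by auto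
qed

text \<open>Count a vertex, one of its non-neighbours, and inductively 2(d - 1) vertices in its
  link; cross-polytopes attain the bound.\<close>

lemma card_sph_ge: "sph d U \<Longrightarrow> card U \<ge> 2 * d"
proof (induction d arbitrary: U)
  case (Suc d)
  then obtain v where v: "v \<in> U" by auto
  have fin: "finite U" using Suc by simp
  have "card (nn U v) > 0"
    using nn_nonempty[OF Suc.prems v] fin by (simp add: card_gt_0_iff nn_def)
  moreover have "card (nb U v) \<ge> 2 * d" using Suc v by auto
  ultimately show ?case using card_nb[OF fin v] by simp
qed simp

text \<open>A neighbour of \<open>w\<close> is neither \<open>v\<close> nor \<open>w\<close>, so it
  is adjacent to \<open>v\<close>; rigidity turns this inclusion of links into an equality. Thus
  \<open>v\<close> and \<open>w\<close> are the apices of a suspension.\<close>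

lemma nb_eq_if_nn_single:
  assumes "sph d U" "v \<in> U" "nn U v = {w}"
  shows "nb U w = nb U v"
proof -
  have w: "w \<in> U" "\<not> E v w" "w \<noteq> v" using assms(3) by (auto simp: nn_def)
  have "nb U w \<subseteq> nb U v"
  proof
    fix x assume x: "x \<in> nb U w"
    then have "x \<noteq> v" "x \<noteq> w" using w irrefl sym by (auto simp: nb_def)
    then have "x \<notin> nn U v" using assms(3) by auto
    then show "x \<in> nb U v" using x \<open>x \<noteq> v\<close> by (auto simp: nb_def nn_def)
  qed
  moreover have "sph (d - 1) (nb U v)" "sph (d - 1) (nb U w)"
    using sph_nb assms w by auto
  ultimately show ?thesis using closed_eq sph_closed by blast
qed

text \<open>Supplies the closed complexes to which rigidity is applied. The links of
  \<open>a\<close> and \<open>b\<close> are \<open>Q\<close>, and the link of a vertex of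
  \<open>Q\<close> is again a suspension with the same apices, one dimension lower.\<close>

lemma closed_pm_susp:
  assumes "closed_pm d Q" "a \<noteq> b" "\<not> E a b" "finite Q" "d = 0 \<Longrightarrow> Q = {}"
    and "\<And>x. x \<in> Q \<Longrightarrow> E a x" "\<And>x. x \<in> Q \<Longrightarrow> E b x"
  shows "closed_pm (Suc d) (insert a (insert b Q))"
  using assms
proof (induction d arbitrary: Q)
  case 0
  then show ?case by simp
next
  case (Suc d)
  let ?U = "insert a (insert b Q)"
  have a: "nb ?U a = Q" "nb ?U b = Q" using Suc.prems irrefl sym by (auto simp: nb_def)
  have x: "nb ?U x = insert a (insert b (nb Q x))" if "x \<in> Q" for x
    using Suc.prems that sym by (auto simp: nb_def)
  have "closed_pm (Suc d) (nb ?U x)" if "x \<in> Q" for x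
  proof (cases d)
    case 0
    have "card {a, b} \<le> card (nb ?U x)"
      using x[OF that] Suc.prems(4) by (intro card_mono) (auto simp: nb_def)
    then show ?thesis using 0 Suc.prems(2,4) by (auto simp: nb_def)
  next
    case (Suc d')
    then have "closed_pm d (nb Q x)" using Suc.prems that by auto
    then show ?thesis unfolding x[OF that] using Suc.prems Suc
      by (intro Suc.IH) (auto simp: nb_def)
  qed
  then show ?case using a Suc.prems(1) by auto
qed

text \<open>If \<open>a\<close> and \<open>b\<close> were not adjacent, the link of \<open>a\<close>
  would lie in the link of \<open>v\<close>, hence equal it, and the suspension of that link with
  apices \<open>v\<close> and \<open>a\<close> would fill \<open>U\<close>, with no place for
  \<open>b\<close>.\<close>

lemma nn_pair_adj:
  assumes "sph d U" "v \<in> U" "nn U v = {a, b}" "a \<noteq> b"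
  shows "E a b"
proof (rule ccontr)
  assume nab: "\<not> E a b"
  have ab: "a \<in> U" "b \<in> U" "a \<noteq> v" "b \<noteq> v" "\<not> E v a" "\<not> E v b"
    using assms(3) by (auto simp: nn_def)
  have sub: "nb U a \<subseteq> nb U v"
  proof
    fix x assume x: "x \<in> nb U a"
    then have "x \<noteq> v" "x \<noteq> a" "x \<noteq> b" using ab nab irrefl sym by (auto simp: nb_def)
    then have "x \<notin> nn U v" using assms(3) by auto
    then show "x \<in> nb U v" using x \<open>x \<noteq> v\<close> by (auto simp: nb_def nn_def)
  qed
  obtain d' where d: "d = Suc d'" using sph_pos[OF assms(1,2)] gr0_implies_Suc by blast
  have s: "sph d' (nb U v)" "sph d' (nb U a)" using assms(1) ab assms(2) d by auto
  have eq: "nb U a = nb U v" using closed_eq[OF s(1) sph_closed[OF s(2)] sub] .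
  have "closed_pm (Suc d') (insert v (insert a (nb U v)))"
    using sph_closed[OF s(1)] ab s(1) eq sph_finite[OF s(1)]
    by (intro closed_pm_susp) (auto simp: in_nb set_eq_iff)
  then have "insert v (insert a (nb U v)) = U"
    using closed_eq[of "Suc d'" U] assms(1,2) ab d by (auto simp: nb_def)
  then show False using ab assms(4) by (auto simp: nb_def)
qed

section \<open>Iterated links, and vertices with one or two non-neighbours\<close>

lemma lk_insert: "lk U (insert v f) = lk (nb U v) f" by (auto simp: lk_def nb_def)

lemma lk_empty: "lk U {} = U" by (auto simp: lk_def)

lemma sph_lk:
  assumes "finite f" "f \<in> cliques U" "sph d U"
  shows "sph (d - card f) (lk U f) \<and> card f \<le> d"
  using assms
proof (induction f arbitrary: U d)
  case empty
  then show ?case by (simp add: lk_empty)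
next
  case (insert v f)
  have v: "v \<in> U" and f: "f \<in> cliques (nb U v)"
    using insert.prems insert.hyps by (auto simp: cliques_def nb_def)
  have "sph (d - 1 - card f) (lk (nb U v) f) \<and> card f \<le> d - 1"
    using insert.IH[OF f sph_nb[OF insert.prems(2) v]] .
  moreover have "d > 0" using sph_pos[OF insert.prems(2) v] .
  ultimately show ?case using insert.hyps by (auto simp: lk_insert)
qed

lemma fpoly_cover:
  assumes "finite N" "A \<subseteq> N" "B \<subseteq> N" "\<And>g. g \<in> cliques N \<Longrightarrow> g \<subseteq> A \<or> g \<subseteq> B"
  shows "fpoly A + fpoly B = fpoly N + fpoly (A \<inter> B)"
proof -
  have "cliques N = cliques A \<union> cliques B"
    using assms(2-4) by (auto simp: cliques_def)
  moreover have "cliques (A \<inter> B) = cliques A \<inter> cliques B" by (auto simp: cliques_def)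
  moreover have "finite (cliques A)" "finite (cliques B)"
    using assms finite_subset finite_cliques by metis+
  ultimately show ?thesis unfolding fpoly_def by (simp add: sum.union_inter)
qed

text \<open>The link of \<open>g\<close> is a sphere through \<open>v\<close>, so \<open>v\<close>
  has a non-neighbour in it. This can only be \<open>a\<close> or \<open>b\<close>, and being in the
  link it is adjacent to all of \<open>g\<close>.\<close>

lemma clique_side:
  assumes "sph d U" "v \<in> U" "nn U v = {a, b}" "g \<in> cliques (nb U v)"
  shows "g \<subseteq> nb U a \<or> g \<subseteq> nb U b"
proof -
  have g: "finite g" "g \<in> cliques U" "v \<in> lk U g"
    using assms(2,4) sym by (auto simp: cliques_def nb_def lk_def)
  then have "nn (lk U g) v \<noteq> {}" using nn_nonempty sph_lk[OF g(1,2) assms(1)] by blast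
  then obtain x where x: "x \<in> nn (lk U g) v" by blast
  then have "x \<in> nn U v" by (auto simp: nn_def lk_def)
  then have "x = a \<or> x = b" using assms(3) by auto
  moreover have "g \<subseteq> nb U x" using x g(2) sym by (auto simp: nn_def lk_def nb_def cliques_def)
  ultimately show ?thesis by auto
qed

text \<open>Contracting the edge \<open>{a, b}\<close> yields the suspension of the link of \<open>v\<close>.\<close>

lemma fpoly_nn_pair:
  assumes "sph d U" "v \<in> U" "nn U v = {a, b}" "a \<noteq> b"
  shows "fpoly U = [:1,2:] * fpoly (nb U v) + [:0,1,1:] * fpoly (nb (nb U a) b)"
proof -
  define N where "N = nb U v"
  define L where "L = nb (nb U a) b"
  have E: "E a b" using nn_pair_adj[OF assms] .
  have ab: "a \<in> U" "b \<in> U" "a \<noteq> v" "b \<noteq> v" "\<not> E v a" "\<not> E v b" "\<not> E a v" "\<not> E b v"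
    using assms(3) sym by (auto simp: nn_def)
  have U: "U = insert v (insert a (insert b N))" "v \<notin> N" "a \<notin> N" "b \<notin> N"
    using nb_partition[OF assms(2)] assms(3) ab irrefl by (auto simp: N_def nb_def)
  have fin: "finite U" "finite N" using sph_finite[OF assms(1)] by (auto simp: N_def nb_def)
  define A where "A = nb N a"
  define B where "B = nb N b"
  have L: "L = A \<inter> B" using U ab irrefl E by (simp add: L_def A_def B_def nb_def) blast
  have cover: "g \<subseteq> A \<or> g \<subseteq> B" if "g \<in> cliques N" for g
    using clique_side[OF assms(1-3), of g] that
    by (auto simp: N_def A_def B_def nb_def cliques_def)
  have Ud: "U - {v} = insert a (insert b N)" using U ab by blast
  have 1: "fpoly U = fpoly (insert a (insert b N)) + [:0,1:] * fpoly N"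
    using fpoly_delete[OF fin(1) assms(2)] unfolding N_def[symmetric] Ud .
  have e1: "insert a (insert b N) - {a} = insert b N" "nb (insert a (insert b N)) a = insert b A"
    using U E irrefl assms(4) by (auto simp: A_def nb_def)
  have e2: "insert b N - {b} = N" "nb (insert b N) b = B"
    using U E irrefl by (auto simp: B_def nb_def)
  have e3: "insert b A - {b} = A" "nb (insert b A) b = L"
    using U E irrefl L by (auto simp: A_def B_def nb_def)
  have finA: "finite A" using fin by (auto simp: A_def nb_def)
  have 2: "fpoly (insert a (insert b N)) = fpoly (insert b N) + [:0,1:] * fpoly (insert b A)"
    using fpoly_delete[of "insert a (insert b N)" a] fin e1 by simp
  have 3: "fpoly (insert b N) = fpoly N + [:0,1:] * fpoly B"
    using fpoly_delete[of "insert b N" b] fin e2 by simp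
  have 4: "fpoly (insert b A) = fpoly A + [:0,1:] * fpoly L"
    using fpoly_delete[of "insert b A" b] finA e3 by simp
  \<comment> \<open>The faces of the link of \<open>v\<close> are covered by those inside
    \<open>A\<close> and those inside \<open>B\<close>, with overlap \<open>L\<close>. So the
    polynomials of \<open>A\<close> and \<open>B\<close>, unknown separately, enter only through
    their sum.\<close>
  have 5: "fpoly A + fpoly B = fpoly N + fpoly L"
    unfolding L by (rule fpoly_cover) (use fin cover in \<open>auto simp: A_def B_def nb_def\<close>)
  have p: "[:1,2:] = (1::int poly) + [:0,1:] + [:0,1:]" "[:0,1,1:] = [:0,1:] + [:0,1:] * [:0,1::int:]"
    by (auto simp: one_pCons)
  have "fpoly U = fpoly N + [:0,1:] * (fpoly A + fpoly B) + [:0,1:] * [:0,1:] * fpoly L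
      + [:0,1:] * fpoly N"
    unfolding 1 2 3 4 by (simp only: algebra_simps)
  also have "\<dots> = [:1,2:] * fpoly N + [:0,1,1:] * fpoly L"
    unfolding 5 p by (simp only: algebra_simps mult_1_left)
  finally show ?thesis by (simp add: N_def L_def)
qed

lemma fpoly_susp:
  assumes "sph d U" "v \<in> U" "nn U v = {w}"
  shows "fpoly U = [:1,2:] * fpoly (nb U v)"
proof -
  define N where "N = nb U v"
  have w: "w \<in> U" "w \<noteq> v" "\<not> E v w" using assms(3) by (auto simp: nn_def)
  have U: "U = insert v (insert w N)" "v \<notin> N" "w \<notin> N"
    using nb_partition[OF assms(2)] assms(3) w irrefl by (auto simp: N_def nb_def)
  have eq: "nb U w = N" using nb_eq_if_nn_single[OF assms] by (simp add: N_def)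
  have fin: "finite U" "finite N" using sph_finite[OF assms(1)] by (auto simp: N_def nb_def)
  have w2: "nb (insert w N) w = N" using eq w sym by (auto simp: nb_def N_def irrefl)
  have Ud: "U - {v} = insert w N" using U w by blast
  have "fpoly U = fpoly (insert w N) + [:0,1:] * fpoly N"
    using fpoly_delete[OF fin(1) assms(2)] unfolding N_def[symmetric] Ud .
  also have "fpoly (insert w N) = fpoly N + [:0,1:] * fpoly N"
    using fpoly_delete[of "insert w N" w] U(3) fin(2) w2 by simp
  finally have "fpoly U = fpoly N + [:0,1:] * fpoly N + [:0,1:] * fpoly N" .
  moreover have "[:1,2:] = (1::int poly) + [:0,1:] + [:0,1:]" by (auto simp: one_pCons)
  ultimately show ?thesis unfolding N_def[symmetric] by (simp only: algebra_simps mult_1_left)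
qed

end

section \<open>Expansions of face polynomials\<close>

text \<open>Abstract in \<open>A\<close> and \<open>B\<close> because two instances are compared: t
  + t^2 with 1 + 2t for face polynomials, and z with 1 + z for h-polynomials. One uniqueness
  argument serves both.\<close>

definition gexp :: "int poly \<Rightarrow> int poly \<Rightarrow> nat \<Rightarrow> (nat \<Rightarrow> int) \<Rightarrow> int poly" where
  "gexp A B d g = (\<Sum>i\<le>d div 2. smult (g i) (A ^ i * B ^ (d - 2 * i)))"

text \<open>Substituting \<open>z = (1 + t) / t\<close> turns the \<open>\<gamma>\<close>-expansion of the \<open>h\<close>-polynomial into this expansion
  of the face polynomial in \<open>t\<close>.\<close>

definition has_gamma :: "nat \<Rightarrow> int poly \<Rightarrow> (nat \<Rightarrow> int) \<Rightarrow> bool" where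
  "has_gamma d p g \<longleftrightarrow> p = gexp [:0,1,1:] [:1,2:] d g \<and> (\<forall>j>d div 2. g j = 0)"

lemma gexp_Suc_Suc:
  "gexp A B (Suc (Suc d)) g = smult (g 0) (B ^ Suc (Suc d)) + A * gexp A B d (\<lambda>i. g (Suc i))"
proof -
  have "gexp A B (Suc (Suc d)) g = (\<Sum>i\<le>Suc (d div 2). smult (g i) (A ^ i * B ^ (Suc (Suc d) - 2 * i)))"
    by (simp add: gexp_def)
  also have "\<dots> = smult (g 0) (B ^ Suc (Suc d)) +
      (\<Sum>i\<le>d div 2. smult (g (Suc i)) (A ^ Suc i * B ^ (Suc (Suc d) - 2 * Suc i)))"
    by (subst sum.atMost_Suc_shift) simp
  also have "(\<Sum>i\<le>d div 2. smult (g (Suc i)) (A ^ Suc i * B ^ (Suc (Suc d) - 2 * Suc i))) =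
      A * gexp A B d (\<lambda>i. g (Suc i))"
    unfolding gexp_def sum_distrib_left by (intro sum.cong refl) (simp add: mult.assoc)
  finally show ?thesis .
qed

lemma gexp_small: "d < 2 \<Longrightarrow> gexp A B d g = smult (g 0) (B ^ d)"
  by (simp add: gexp_def)

text \<open>Evaluation at 0 isolates \<open>g 0\<close>; after subtracting that term the factor
  \<open>A\<close> cancels and an expansion for d - 2 remains.\<close>

lemma gexp_unique:
  assumes "poly A 0 = 0" "poly B 0 = 1" "A \<noteq> 0"
    and "gexp A B d g = gexp A B d g'"
    and "\<forall>j>d div 2. g j = 0" "\<forall>j>d div 2. g' j = 0"
  shows "g = g'"
  using assms(4-6)
proof (induction d arbitrary: g g' rule: less_induct)
  case (less d)
  have 0: "g 0 = g' 0"
  proof (cases "d < 2")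
    case True
    then have "poly (smult (g 0) (B ^ d)) 0 = poly (smult (g' 0) (B ^ d)) 0"
      using less.prems by (simp add: gexp_small)
    then show ?thesis using assms(2) by simp
  next
    case False
    then obtain d' where d: "d = Suc (Suc d')"
      by (metis add_2_eq_Suc le_Suc_ex not_less)
    have "poly (gexp A B d g) 0 = poly (gexp A B d g') 0" using less.prems by simp
    then show ?thesis using assms(1,2) unfolding d gexp_Suc_Suc by simp
  qed
  show ?case
  proof (cases "d < 2")
    case True
    then have "g j = g' j" for j using 0 less.prems(2,3) by (cases j) auto
    then show ?thesis by blast
  next
    case False
    then obtain d' where d: "d = Suc (Suc d')"
      by (metis add_2_eq_Suc le_Suc_ex not_less)
    have "A * gexp A B d' (\<lambda>i. g (Suc i)) = A * gexp A B d' (\<lambda>i. g' (Suc i))"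
      using less.prems(1) 0 unfolding d gexp_Suc_Suc by simp
    then have "gexp A B d' (\<lambda>i. g (Suc i)) = gexp A B d' (\<lambda>i. g' (Suc i))" using assms(3) by simp
    then have "(\<lambda>i. g (Suc i)) = (\<lambda>i. g' (Suc i))"
      using less.prems(2,3) d by (intro less.IH[of d']) auto
    then have "g (Suc i) = g' (Suc i)" for i by metis
    then have "g i = g' i" for i using 0 by (cases i) auto
    then show ?thesis by blast
  qed
qed

lemma has_gamma_unique: "has_gamma d p g \<Longrightarrow> has_gamma d p g' \<Longrightarrow> g = g'"
  unfolding has_gamma_def by (intro gexp_unique[of "[:0,1,1:]" "[:1,2:]" d]) auto

lemma has_gamma_zero: "has_gamma d p g \<Longrightarrow> d < 2 * j \<Longrightarrow> g j = 0"
  unfolding has_gamma_def by auto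

lemma has_gamma_1: "has_gamma 0 1 (\<lambda>i. if i = 0 then 1 else 0)"
  by (simp add: has_gamma_def gexp_def)

text \<open>Passing from d to d + 1 can admit one more index, where the coefficient is 0 by
  hypothesis; at all other indices the exponent of \<open>B\<close> grows by one.\<close>

lemma gexp_mult_B:
  assumes "\<forall>j>d div 2. g j = 0"
  shows "gexp A B (Suc d) g = B * gexp A B d g"
proof -
  have "gexp A B (Suc d) g = (\<Sum>i\<le>d div 2. smult (g i) (A ^ i * B ^ (Suc d - 2 * i)))"
    unfolding gexp_def using assms by (intro sum.mono_neutral_right) auto
  also have "\<dots> = B * gexp A B d g"
    unfolding gexp_def sum_distrib_left
  proof (intro sum.cong refl)
    fix i assume "i \<in> {..d div 2}"
    then have "Suc d - 2 * i = Suc (d - 2 * i)" by auto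
    then show "smult (g i) (A ^ i * B ^ (Suc d - 2 * i)) = B * smult (g i) (A ^ i * B ^ (d - 2 * i))"
      by (simp add: mult_ac)
  qed
  finally show ?thesis .
qed

lemma has_gamma_susp: "has_gamma d p g \<Longrightarrow> has_gamma (Suc d) ([:1,2:] * p) g"
  unfolding has_gamma_def by (subst gexp_mult_B) auto

lemma has_gamma_add:
  "has_gamma d p g \<Longrightarrow> has_gamma d q g' \<Longrightarrow> has_gamma d (p + q) (\<lambda>i. g i + g' i)"
  unfolding has_gamma_def gexp_def by (auto simp: smult_add_left sum.distrib)

lemma has_gamma_shift:
  "has_gamma d p g \<Longrightarrow> has_gamma (Suc (Suc d)) ([:0,1,1:] * p) (case_nat 0 g)"
  unfolding has_gamma_def gexp_Suc_Suc by (auto split: nat.splits)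

lemma poly_gexp_0:
  assumes "poly A 0 = 0" "poly B 0 = 1"
  shows "poly (gexp A B d g) 0 = g 0"
proof (cases "d < 2")
  case False
  then obtain d' where d: "d = Suc (Suc d')"
    by (metis add_2_eq_Suc le_Suc_ex not_less)
  show ?thesis unfolding d gexp_Suc_Suc using assms by simp
qed (use assms in \<open>simp add: gexp_small\<close>)

lemma has_gamma_ext: "has_gamma d p g \<Longrightarrow> g = g' \<Longrightarrow> has_gamma d p g'" by simp

section \<open>Existence and linear coefficient of the expansion\<close>

lemma dvd_quadratic:
  fixes q :: "int poly"
  assumes "poly q 0 = 0" "poly q (-1) = 0"
  shows "[:0,1,1:] dvd q"
proof -
  obtain r where r: "q = [:0,1:] * r" using assms(1) by (auto simp: poly_eq_0_iff_dvd)
  then have "poly r (-1) = 0" using assms(2) by simp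
  then obtain s where "r = [:1,1:] * s" by (auto simp: poly_eq_0_iff_dvd)
  then have "q = [:0,1,1:] * s" using r by simp
  then show ?thesis by (rule dvdI)
qed

text \<open>The involution sending t to -1 - t fixes t + t^2 and changes the sign of 1 + 2t.
  Removing the multiple of (1 + 2t)^d with the right value at 0 leaves a zero at 0, hence by
  symmetry one at -1; the quotient by t + t^2 has the symmetry and the degree bound for d -
  2.\<close>

lemma has_gamma_exists:
  fixes p :: "int poly"
  assumes "degree p \<le> d" "\<And>t. poly p (-1-t) = (-1) ^ d * poly p t"
  shows "\<exists>g. has_gamma d p g"
  using assms
proof (induction d arbitrary: p rule: less_induct)
  case (less d)
  define q where "q = p - smult (poly p 0) ([:1,2:] ^ d)"
  have "poly q 0 = 0" by (simp add: q_def poly_power)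
  moreover have "poly q (-1) = 0" using less.prems(2)[of 0]
    by (simp add: q_def poly_power)
  ultimately obtain r where r: "q = [:0,1,1:] * r" using dvd_quadratic by blast
  have degq: "degree q \<le> d"
    unfolding q_def using less.prems(1)
    by (intro degree_diff_le order.trans[OF degree_smult_le] order.trans[OF degree_power_le]) auto
  show ?case
  proof (cases "d < 2")
    case True
    have "r = 0"
    proof (rule ccontr)
      assume "r \<noteq> 0"
      then have "degree q = 2 + degree r" unfolding r by (subst degree_mult_eq) auto
      then show False using degq True by simp
    qed
    then have "p = smult (poly p 0) ([:1,2:] ^ d)" using r by (simp add: q_def)
    then have "has_gamma d p (\<lambda>i. if i = 0 then poly p 0 else 0)"
      using True by (simp add: has_gamma_def gexp_small)
    then show ?thesis by blast
  next
    case False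
    then obtain d' where d: "d = Suc (Suc d')"
      by (metis add_2_eq_Suc le_Suc_ex not_less)
    have degr: "degree r \<le> d'"
    proof (cases "r = 0")
      case False
      then have "degree q = 2 + degree r" unfolding r by (subst degree_mult_eq) auto
      then show ?thesis using degq d by simp
    qed simp
    have qs: "poly q (-1-t) = (-1) ^ d * poly q t" for t
    proof -
      have "poly [:1,2:] (-1-t) = - poly [:1,2::int:] t" by simp
      then have "poly ([:1,2:] ^ d) (-1-t) = (-1) ^ d * poly ([:1,2::int:] ^ d) t"
        by (simp only: poly_power power_minus[of "poly [:1,2:] t"])
      then show ?thesis using less.prems(2)[of t]
        unfolding q_def poly_diff poly_smult by (simp only: algebra_simps)
    qed
    have rs': "poly [:0,1,1:] t * (poly r (-1-t) - (-1) ^ d' * poly r t) = 0" for t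
    proof -
      have "poly [:0,1,1:] (-1-t) = poly [:0,1,1::int:] t" by (simp add: algebra_simps)
      then have "poly [:0,1,1:] t * poly r (-1-t) = (-1) ^ d' * (poly [:0,1,1:] t * poly r t)"
        using qs[of t] unfolding r poly_mult d by simp
      then show ?thesis by (simp only: algebra_simps)
    qed
    have "[:0,1,1:] * (r \<circ>\<^sub>p [:-1,-1:] - smult ((-1) ^ d') r) = 0"
      using rs' by (subst poly_all_0_iff_0[symmetric])
        (simp only: poly_mult poly_diff poly_smult poly_pcompose poly_pCons poly_0, simp)
    moreover have "[:0,1,1::int:] \<noteq> 0" by simp
    ultimately have "r \<circ>\<^sub>p [:-1,-1:] - smult ((-1) ^ d') r = 0" by (simp only: mult_eq_0_iff simp_thms)
    then have eq: "r \<circ>\<^sub>p [:-1,-1:] = smult ((-1) ^ d') r" by (simp only: right_minus_eq)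
    have rs: "poly r (-1-t) = (-1) ^ d' * poly r t" for t
    proof -
      have "poly r (-1-t) = poly (r \<circ>\<^sub>p [:-1,-1:]) t" by (simp add: poly_pcompose)
      also have "\<dots> = (-1) ^ d' * poly r t" unfolding eq by (simp only: poly_smult)
      finally show ?thesis .
    qed
    obtain g where "has_gamma d' r g" using less.IH[of d' r] degr rs d by auto
    then have "has_gamma d p (case_nat (poly p 0) g)"
      unfolding has_gamma_def d gexp_Suc_Suc
      using r d by (auto simp: q_def algebra_simps split: nat.splits)
    then show ?thesis by blast
  qed
qed

text \<open>Terms with i \<ge> 2 start at t^2, and (1 + 2t)^d begins with 1 + 2d t. For spheres this
  identifies \<gamma>_1 as the number of vertices beyond 2d.\<close>

lemma has_gamma_coeff1:
  assumes "has_gamma d p g"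
  shows "coeff p 1 = 2 * int d * g 0 + g 1"
proof -
  have lin: "coeff ([:1,2::int:] ^ n) 0 = 1 \<and> coeff ([:1,2::int:] ^ n) 1 = 2 * int n" for n
    by (induction n) (auto simp: coeff_mult)
  show ?thesis
  proof (cases "d < 2")
    case True
    then show ?thesis using assms lin[of d] by (auto simp: has_gamma_def gexp_small)
  next
    case False
    then obtain d' where d: "d = Suc (Suc d')"
      by (metis add_2_eq_Suc le_Suc_ex not_less)
    have "poly (gexp [:0,1,1:] [:1,2:] d' (\<lambda>i. g (Suc i))) 0 = g 1"
      by (subst poly_gexp_0) auto
    then have "coeff ([:0,1,1:] * gexp [:0,1,1:] [:1,2:] d' (\<lambda>i. g (Suc i))) 1 = g 1"
      by (simp add: poly_0_coeff_0 coeff_mult)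
    moreover have "p = smult (g 0) ([:1,2:] ^ d) + [:0,1,1:] * gexp [:0,1,1:] [:1,2:] d' (\<lambda>i. g (Suc i))"
      using assms unfolding has_gamma_def d gexp_Suc_Suc by (rule conjunct1)
    ultimately have "coeff p 1 = g 0 * coeff ([:1,2:] ^ d) 1 + g 1"
      by (simp only: coeff_add coeff_smult)
    then show ?thesis using lin[of d] by (simp only: mult_ac)
  qed
qed

section \<open>Passage to the h-polynomial\<close>

text \<open>Homogenise a face polynomial of degree at most \<open>d\<close> and set the variables to \<open>1\<close> and
  \<open>z - 1\<close>.\<close>

definition f_to_h :: "nat \<Rightarrow> int poly \<Rightarrow> int poly" where
  "f_to_h d p = (\<Sum>i\<le>d. smult (coeff p i) ([:-1,1:] ^ (d - i)))"

lemma f_to_h_add: "f_to_h d (p + q) = f_to_h d p + f_to_h d q"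
  by (simp add: f_to_h_def smult_add_left sum.distrib)

lemma f_to_h_smult: "f_to_h d (smult c p) = smult c (f_to_h d p)"
proof -
  have "[:c:] * (\<Sum>i\<le>d. smult (coeff p i) ([:-1,1:] ^ (d - i))) =
      (\<Sum>i\<le>d. smult (c * coeff p i) ([:-1,1:] ^ (d - i)))"
    unfolding sum_distrib_left by (intro sum.cong refl) (simp add: mult.commute)
  then show ?thesis by (simp add: f_to_h_def)
qed

lemma f_to_h_sum: "f_to_h d (\<Sum>x\<in>A. f x) = (\<Sum>x\<in>A. f_to_h d (f x))"
proof -
  have "f_to_h d 0 = 0" by (simp add: f_to_h_def)
  then show ?thesis by (induction A rule: infinite_finite_induct) (auto simp: f_to_h_add)
qed

lemma f_to_h_pCons: "f_to_h (Suc d) (pCons c p) = smult c ([:-1,1:] ^ Suc d) + f_to_h d p"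
  unfolding f_to_h_def by (subst sum.atMost_Suc_shift) simp

lemma f_to_h_up: "degree p \<le> d \<Longrightarrow> f_to_h (Suc d) p = [:-1,1:] * f_to_h d p"
proof -
  assume "degree p \<le> d"
  then have "coeff p (Suc d) = 0" by (simp add: coeff_eq_0)
  then have "f_to_h (Suc d) p = (\<Sum>i\<le>d. smult (coeff p i) ([:-1,1:] ^ (Suc d - i)))"
    by (simp add: f_to_h_def)
  also have "\<dots> = [:-1,1:] * f_to_h d p"
    unfolding f_to_h_def sum_distrib_left
    by (intro sum.cong refl) (simp add: Suc_diff_le)
  finally show ?thesis .
qed

text \<open>Homogenise with a second variable s and put t = 1, s = z - 1: then s + 2t becomes 1 + z,
  and, for \<open>f_to_h_quadratic\<close>, t s + t^2 becomes z. By the degree bound no coefficient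
  of \<open>p\<close> falls outside the sum.\<close>

lemma f_to_h_linear:
  assumes "degree p \<le> d"
  shows "f_to_h (Suc d) ([:1,2:] * p) = [:1,1:] * f_to_h d p"
proof -
  have "[:1,2:] * p = p + pCons 0 (smult 2 p)" by simp
  moreover have "f_to_h (Suc d) (p + pCons 0 (smult 2 p)) = [:-1,1:] * f_to_h d p + smult 2 (f_to_h d p)"
    unfolding f_to_h_add f_to_h_pCons f_to_h_smult f_to_h_up[OF assms] by simp
  ultimately show ?thesis by (simp add: numeral_poly)
qed

lemma f_to_h_quadratic:
  assumes "degree p \<le> d"
  shows "f_to_h (Suc (Suc d)) ([:0,1,1:] * p) = [:0,1:] * f_to_h d p"
proof -
  have "[:0,1,1:] * p = pCons 0 (p + pCons 0 p)" by simp
  then show ?thesis using f_to_h_up[OF assms]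
    by (simp add: f_to_h_add f_to_h_pCons)
qed

lemma f_to_h_gexp: "f_to_h d (gexp [:0,1,1:] [:1,2:] d g) = gexp [:0,1:] [:1,1:] d g"
proof -
  have pow: "f_to_h n ([:1,2:] ^ n) = [:1,1:] ^ n" for n
  proof (induction n)
    case 0 show ?case by (simp add: f_to_h_def)
  next
    case (Suc n)
    have "degree ([:1,2::int:] ^ n) \<le> n" by (rule order.trans[OF degree_power_le]) simp
    then show ?case using Suc by (simp only: power_Suc f_to_h_linear)
  qed
  have "f_to_h (n + 2 * i) ([:0,1,1:] ^ i * [:1,2:] ^ n) = [:0,1:] ^ i * [:1,1:] ^ n" for i n
  proof (induction i)
    case 0 then show ?case using pow by simp
  next
    case (Suc i)
    have "degree ([:0,1,1:] ^ i * [:1,2::int:] ^ n) \<le> n + 2 * i"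
    proof (rule order.trans[OF degree_mult_le])
      have "degree ([:0,1,1::int:] ^ i) \<le> 2 * i" "degree ([:1,2::int:] ^ n) \<le> n"
        by (rule order.trans[OF degree_power_le], simp)+
      then show "degree ([:0,1,1::int:] ^ i) + degree ([:1,2::int:] ^ n) \<le> n + 2 * i" by simp
    qed
    then show ?case using f_to_h_quadratic Suc by (simp only: power_Suc mult.assoc mult_Suc_right add_2_eq_Suc add_Suc_right)
  qed
  note step = this
  have "f_to_h d ([:0,1,1:] ^ i * [:1,2:] ^ (d - 2 * i)) = [:0,1:] ^ i * [:1,1:] ^ (d - 2 * i)"
    if "i \<le> d div 2" for i
  proof -
    have "d - 2 * i + 2 * i = d" using that by linarith
    then show ?thesis using step[of "d - 2 * i" i] by simp
  qed
  then show ?thesis unfolding gexp_def f_to_h_sum f_to_h_smult by (intro sum.cong refl) auto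
qed

definition face_poly :: "'a set set \<Rightarrow> int poly" where
  "face_poly \<Delta> = (\<Sum>f\<in>\<Delta>. monom 1 (card f))"

lemma coeff_face_poly: "finite \<Delta> \<Longrightarrow> coeff (face_poly \<Delta>) i = int (card {f \<in> \<Delta>. card f = i})"
  by (simp add: face_poly_def coeff_sum sum.If_cases Int_def)

lemma h_poly_eq: "finite \<Delta> \<Longrightarrow> h_poly d \<Delta> = f_to_h d (face_poly \<Delta>)"
  by (simp add: h_poly_def f_to_h_def coeff_face_poly)

lemma gamma_vec_eqI:
  assumes "finite \<Delta>" "has_gamma d (face_poly \<Delta>) g"
  shows "gamma_vec d \<Delta> = g"
proof -
  have ge: "(\<Sum>i\<le>d div 2. smult (\<gamma> i) (monom 1 i * [:1, 1:] ^ (d - 2 * i))) = gexp [:0,1:] [:1,1:] d \<gamma>" for \<gamma>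
    by (simp add: gexp_def monom_altdef)
  have h: "h_poly d \<Delta> = gexp [:0,1:] [:1,1:] d g"
    using assms by (simp add: h_poly_eq has_gamma_def f_to_h_gexp)
  show ?thesis unfolding gamma_vec_def ge
  proof (rule the_equality)
    show "h_poly d \<Delta> = gexp [:0,1:] [:1,1:] d g \<and> (\<forall>j>d div 2. g j = 0)"
      using h assms by (simp add: has_gamma_def)
    fix g' assume "h_poly d \<Delta> = gexp [:0,1:] [:1,1:] d g' \<and> (\<forall>j>d div 2. g' j = 0)"
    then show "g' = g" using assms h
      by (intro gexp_unique[of "[:0,1:]" "[:1,1:]" d]) (auto simp: has_gamma_def)
  qed
qed

section \<open>Facets and far vertices\<close>

context ugraph
begin

definition unsuspended :: "'a set \<Rightarrow> bool" where
  "unsuspended U \<longleftrightarrow> (\<forall>v\<in>U. card (nn U v) \<ge> 2)"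

definition joined :: "'a set \<Rightarrow> 'a set \<Rightarrow> bool" where
  "joined A B \<longleftrightarrow> (\<forall>a\<in>A. \<forall>b\<in>B. E a b)"

definition ring :: "nat \<Rightarrow> 'a set \<Rightarrow> bool" where
  "ring n A \<longleftrightarrow> (\<exists>f. bij_betw f {..<n} A \<and>
     (\<forall>i<n. \<forall>j<n. E (f i) (f j) \<longleftrightarrow> j = (i + 1) mod n \<or> i = (j + 1) mod n))"

primrec C5_join :: "nat \<Rightarrow> 'a set \<Rightarrow> bool" where
  "C5_join 0 U \<longleftrightarrow> U = {}"
| "C5_join (Suc k) U \<longleftrightarrow> (\<exists>A Z. U = A \<union> Z \<and> ring 5 A \<and> joined A Z \<and> C5_join k Z)"

text \<open>For a facet \<open>K\<close>, every \<open>v \<in> K\<close> has exactly one opposite vertex, whose only non-neighbour in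
  \<open>K\<close> is \<open>v\<close>. The other vertices outside \<open>K\<close> are the far ones; their number is \<open>\<gamma>\<^sub>1\<close>.\<close>

definition missed :: "'a set \<Rightarrow> 'a \<Rightarrow> 'a set" where
  "missed K y = {v \<in> K. \<not> E v y}"

definition far :: "'a set \<Rightarrow> 'a set \<Rightarrow> 'a set" where
  "far U K = {y \<in> U - K. card (missed K y) \<ge> 2}"

lemma ring5I:
  assumes "distinct [a, b, c, d, e]" "E a b" "E b c" "E c d" "E d e" "E e a"
    and "\<not> E a c" "\<not> E a d" "\<not> E b d" "\<not> E b e" "\<not> E c e"
  shows "ring 5 {a, b, c, d, e}"
proof -
  let ?f = "\<lambda>i. [a, b, c, d, e] ! i"
  have s: "{..<5} = {0, 1, 2, 3, 4::nat}" by auto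
  have q: "(\<forall>i<5. P i) \<longleftrightarrow> P 0 \<and> P 1 \<and> P 2 \<and> P 3 \<and> P (4::nat)" for P
    using s by (metis (no_types, lifting) insert_iff lessThan_iff singletonD)
  have "bij_betw ?f {..<5} {a, b, c, d, e}"
    unfolding s bij_betw_def using assms(1) by (auto simp: inj_on_def)
  moreover have "\<forall>i<5. \<forall>j<5. E (?f i) (?f j) \<longleftrightarrow> j = (i + 1) mod 5 \<or> i = (j + 1) mod 5"
    unfolding q using assms irrefl sym by simp blast
  ultimately show ?thesis unfolding ring_def by blast
qed

lemma ring6I:
  assumes "distinct [a, b, c, d, e, g]" "E a b" "E b c" "E c d" "E d e" "E e g" "E g a"
    and "\<not> E a c" "\<not> E a d" "\<not> E a e" "\<not> E b d" "\<not> E b e" "\<not> E b g" "\<not> E c e" "\<not> E c g" "\<not> E d g"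
  shows "ring 6 {a, b, c, d, e, g}"
proof -
  let ?f = "\<lambda>i. [a, b, c, d, e, g] ! i"
  have s: "{..<6} = {0, 1, 2, 3, 4, 5::nat}" by auto
  have q: "(\<forall>i<6. P i) \<longleftrightarrow> P 0 \<and> P 1 \<and> P 2 \<and> P 3 \<and> P 4 \<and> P (5::nat)" for P
    using s by (metis (no_types, lifting) insert_iff lessThan_iff singletonD)
  have "bij_betw ?f {..<6} {a, b, c, d, e, g}"
    unfolding s bij_betw_def using assms(1) by (auto simp: inj_on_def)
  moreover have "\<forall>i<6. \<forall>j<6. E (?f i) (?f j) \<longleftrightarrow> j = (i + 1) mod 6 \<or> i = (j + 1) mod 6"
    unfolding q using assms irrefl sym by simp blast
  ultimately show ?thesis unfolding ring_def by blast
qed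

lemma ring5E:
  assumes "ring 5 A" "x \<in> A"
  obtains b c d e where "A = {x, b, c, d, e}" "distinct [x, b, c, d, e]"
    "E x b" "E b c" "E c d" "E d e" "E e x"
    "\<not> E x c" "\<not> E x d" "\<not> E b d" "\<not> E b e" "\<not> E c e"
proof -
  obtain f where f: "bij_betw f {..<5} A"
    and E: "\<And>i j :: nat. i < 5 \<Longrightarrow> j < 5 \<Longrightarrow> E (f i) (f j) \<longleftrightarrow> j = (i + 1) mod 5 \<or> i = (j + 1) mod 5"
    using assms(1) by (auto simp: ring_def)
  have s: "{..<5} = {0, 1, 2, 3, 4::nat}" by auto
  obtain k where k: "k < 5" "x = f k" using f assms(2) by (auto simp: bij_betw_def)
  let ?g = "\<lambda>i. f ((k + i) mod 5)"
  have inj: "inj_on f {..<5}" using f by (simp add: bij_betw_def)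
  have k': "k \<in> {0, 1, 2, 3, 4}" using k(1) by auto
  have im: "A = f ` {0, 1, 2, 3, 4}" using f s by (auto simp: bij_betw_def)
  have "A = {?g 0, ?g 1, ?g 2, ?g 3, ?g 4}" using im k' by (auto simp: numeral_2_eq_2[symmetric])
  moreover have "distinct [?g 0, ?g 1, ?g 2, ?g 3, ?g 4]"
    using k' inj unfolding s by (auto simp: inj_on_def numeral_2_eq_2[symmetric])
  moreover have "?g 0 = x" using k by simp
  moreover have "E (?g 0) (?g 1)" "E (?g 1) (?g 2)" "E (?g 2) (?g 3)" "E (?g 3) (?g 4)" "E (?g 4) (?g 0)"
    "\<not> E (?g 0) (?g 2)" "\<not> E (?g 0) (?g 3)" "\<not> E (?g 1) (?g 3)" "\<not> E (?g 1) (?g 4)" "\<not> E (?g 2) (?g 4)"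
    using k' by (auto simp: E numeral_2_eq_2[symmetric])
  ultimately show ?thesis using that[of "?g 1" "?g 2" "?g 3" "?g 4"] by simp
qed

lemma ring_finite_card: "ring n A \<Longrightarrow> finite A \<and> card A = n"
  unfolding ring_def by (metis bij_betw_finite bij_betw_same_card card_lessThan finite_lessThan)

lemma joined_disjoint: "joined A B \<Longrightarrow> A \<inter> B = {}"
  using irrefl by (auto simp: joined_def)

lemma joined_sym: "joined A B \<Longrightarrow> joined B A"
  using sym by (auto simp: joined_def)

section \<open>Facets, opposite vertices, and the covering count\<close>

lemma ex_facet: "sph d U \<Longrightarrow> \<exists>K\<in>cliques U. card K = d"
proof (induction d arbitrary: U)
  case 0
  then show ?case using empty_clique by force
next
  case (Suc d)
  then obtain v where v: "v \<in> U" by auto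
  then obtain K where K: "K \<in> cliques (nb U v)" "card K = d" using Suc by auto
  then have "insert v K \<in> cliques U" using v sym by (auto simp: cliques_def nb_def)
  moreover have "card (insert v K) = Suc d"
    using K irrefl by (subst card_insert_disjoint) (auto simp: cliques_def nb_def)
  ultimately show ?case by blast
qed

lemma ex_facet_through:
  assumes "sph d U" "v \<in> U"
  shows "\<exists>K\<in>cliques U. card K = d \<and> v \<in> K"
proof -
  obtain K where K: "K \<in> cliques (nb U v)" "card K = d - 1"
    using ex_facet[OF sph_nb[OF assms]] by blast
  then have "insert v K \<in> cliques U" using assms(2) sym by (auto simp: cliques_def nb_def)
  moreover have "card (insert v K) = d"
    using K irrefl sph_pos[OF assms] by (subst card_insert_disjoint) (auto simp: cliques_def nb_def)
  ultimately show ?thesis by blast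
qed

lemma clique_card_le: "sph d U \<Longrightarrow> f \<in> cliques U \<Longrightarrow> card f \<le> d"
  using sph_lk[of f U d] by (auto simp: cliques_def)

lemma missed_nonempty:
  assumes "sph d U" "K \<in> cliques U" "card K = d" "y \<in> U - K"
  shows "missed K y \<noteq> {}"
proof
  assume "missed K y = {}"
  then have "insert y K \<in> cliques U" using assms sym by (auto simp: cliques_def missed_def)
  then have "card (insert y K) \<le> d" using clique_card_le[OF assms(1)] by blast
  then show False using assms by (auto simp: cliques_def)
qed

text \<open>The link of the ridge \<open>K - {v}\<close> is a sphere of dimension 0, that is, two
  vertices. One is \<open>v\<close>; the other is adjacent to all of \<open>K\<close> but
  \<open>v\<close>, since the facet cannot be enlarged.\<close>

lemma opposite_vertex:
  assumes "sph d U" "K \<in> cliques U" "card K = d" "v \<in> K"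
  shows "\<exists>!x. x \<in> U - K \<and> missed K x = {v}"
proof -
  let ?L = "lk U (K - {v})"
  have K: "finite K" "K \<subseteq> U" using assms(2) by (auto simp: cliques_def)
  have "sph (d - card (K - {v})) ?L"
    using sph_lk[of "K - {v}" U d] assms K by (auto intro: clique_subset)
  moreover have "d - card (K - {v}) = Suc 0"
    using K assms(3,4) by (metis card_Suc_Diff1 diff_Suc_Suc diff_add_inverse2 diff_diff_cancel diff_is_0_eq
      le_add2 plus_1_eq_Suc Suc_diff_diff diff_zero)
  ultimately have c2: "card ?L = 2" using sph_1_card by simp
  have vL: "v \<in> ?L" using assms(2,4) K by (auto simp: lk_def cliques_def)
  have char: "x \<in> ?L \<and> x \<noteq> v \<longleftrightarrow> x \<in> U - K \<and> missed K x = {v}" for x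
  proof
    assume x: "x \<in> ?L \<and> x \<noteq> v"
    then have "x \<in> U - K" using irrefl by (auto simp: lk_def)
    moreover have "missed K x \<subseteq> {v}" using x by (auto simp: lk_def missed_def)
    ultimately show "x \<in> U - K \<and> missed K x = {v}"
      using missed_nonempty[OF assms(1-3)] by blast
  next
    assume "x \<in> U - K \<and> missed K x = {v}"
    then show "x \<in> ?L \<and> x \<noteq> v" using assms(4) by (auto simp: lk_def missed_def)
  qed
  obtain p q where pq: "?L = {p, q}" "p \<noteq> q" using c2 by (auto simp: card_2_iff)
  then have "\<exists>!x. x \<in> ?L \<and> x \<noteq> v"
  proof (cases "v = p")
    case True
    then show ?thesis using pq by (intro ex1I[of _ q]) auto
  next
    case False
    then show ?thesis using pq vL by (intro ex1I[of _ p]) auto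
  qed
  then show ?thesis unfolding char .
qed

lemma nn_facet:
  assumes "K \<in> cliques U" "v \<in> K"
  shows "nn U v = {y \<in> U - K. v \<in> missed K y}"
  using assms by (auto simp: nn_def missed_def cliques_def)

lemma card_missed_cases:
  assumes "sph d U" "K \<in> cliques U" "card K = d" "y \<in> U - K"
  shows "y \<in> far U K \<or> (\<exists>v\<in>K. missed K y = {v})"
proof -
  have "finite (missed K y)" using assms(2) by (auto simp: cliques_def missed_def)
  then have "card (missed K y) > 0" using missed_nonempty[OF assms] by (simp add: card_gt_0_iff)
  then consider "card (missed K y) = 1" | "card (missed K y) \<ge> 2" by linarith
  then show ?thesis
  proof cases
    case 1
    then obtain v where "missed K y = {v}" by (auto simp: card_1_singleton_iff)
    then show ?thesis by (auto simp: missed_def)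
  qed (use assms(4) in \<open>auto simp: far_def\<close>)
qed

text \<open>The summand 1 is the opposite vertex. Bounds on numbers of non-neighbours thus become
  bounds on how often far vertices miss \<open>v\<close>.\<close>

lemma card_nn_facet:
  assumes "sph d U" "K \<in> cliques U" "card K = d" "v \<in> K"
  shows "card (nn U v) = Suc (card {y \<in> far U K. v \<in> missed K y})"
proof -
  obtain x where x: "x \<in> U - K" "missed K x = {v}"
    and u: "\<And>x'. x' \<in> U - K \<Longrightarrow> missed K x' = {v} \<Longrightarrow> x' = x"
    using opposite_vertex[OF assms] by blast
  have "nn U v = insert x {y \<in> far U K. v \<in> missed K y}"
    unfolding nn_facet[OF assms(2,4)]
  proof (intro equalityI subsetI)
    fix y assume y: "y \<in> {y \<in> U - K. v \<in> missed K y}"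
    then show "y \<in> insert x {y \<in> far U K. v \<in> missed K y}"
      using card_missed_cases[OF assms(1-3), of y] u by auto
  next
    fix y assume "y \<in> insert x {y \<in> far U K. v \<in> missed K y}"
    then show "y \<in> {y \<in> U - K. v \<in> missed K y}" using x by (auto simp: far_def)
  qed
  moreover have "x \<notin> far U K" using x by (auto simp: far_def)
  moreover have "finite (far U K)" using sph_finite[OF assms(1)] by (auto simp: far_def)
  ultimately show ?thesis by simp
qed

text \<open>\<open>U\<close> consists of \<open>K\<close>, the opposite vertices, and the far ones.
  Different vertices of \<open>K\<close> have different opposite vertices, because these have
  different missed sets.\<close>

lemma card_far:
  assumes "sph d U" "K \<in> cliques U" "card K = d"
  shows "card U = 2 * d + card (far U K)"
proof -
  define opp where "opp v = (THE x. x \<in> U - K \<and> missed K x = {v})" for v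
  have opp: "opp v \<in> U - K" "missed K (opp v) = {v}" if "v \<in> K" for v
    using theI'[OF opposite_vertex[OF assms that]] by (auto simp: opp_def)
  have opp_eq: "x = opp v" if "v \<in> K" "x \<in> U - K" "missed K x = {v}" for x v
    using opposite_vertex[OF assms that(1)] opp[OF that(1)] that by blast
  have inj: "inj_on opp K"
    using opp(2) by (intro inj_onI) (metis singleton_inject)
  have fin: "finite U" "finite K" using sph_finite[OF assms(1)] assms(2) by (auto simp: cliques_def)
  have U: "U = K \<union> (opp ` K \<union> far U K)"
  proof
    show "U \<subseteq> K \<union> (opp ` K \<union> far U K)"
      using card_missed_cases[OF assms] opp_eq by blast
    show "K \<union> (opp ` K \<union> far U K) \<subseteq> U"
      using opp assms(2) by (auto simp: far_def cliques_def)
  qed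
  have d: "K \<inter> (opp ` K \<union> far U K) = {}" "opp ` K \<inter> far U K = {}"
    using opp by (auto simp: far_def)
  have "finite (far U K)" using fin by (auto simp: far_def)
  then have "card U = card K + (card (opp ` K) + card (far U K))"
    using fin d by (subst U) (simp add: card_Un_disjoint)
  then show ?thesis using card_image[OF inj] assms(3) by simp
qed

text \<open>Two elements missed by \<open>y\<close> but by no vertex with a smaller missed set would make the link of
  the remaining part of the facet contain, hence equal, a double suspension avoiding \<open>y\<close>.\<close>

lemma missed_new_unique:
  assumes "sph d U" "K \<in> cliques U" "card K = d" "y \<in> far U K" "card (missed K y) \<ge> 3"
    and "i \<in> missed K y" "\<And>z. z \<in> far U K \<Longrightarrow> i \<in> missed K z \<Longrightarrow> \<not> missed K z \<subset> missed K y"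
    and "j \<in> missed K y" "\<And>z. z \<in> far U K \<Longrightarrow> j \<in> missed K z \<Longrightarrow> \<not> missed K z \<subset> missed K y"
  shows "i = j"
proof (rule ccontr)
  assume ij: "i \<noteq> j"
  define M where "M = missed K y"
  define L where "L = lk U (K - M)"
  have K: "finite K" "K \<subseteq> U" "\<And>x y. x \<in> K \<Longrightarrow> y \<in> K \<Longrightarrow> x \<noteq> y \<Longrightarrow> E x y"
    using assms(2) by (auto simp: cliques_def)
  have M: "M \<subseteq> K" "finite M" using K by (auto simp: M_def missed_def intro: finite_subset)
  have "K - M \<in> cliques U" "finite (K - M)" using clique_subset[OF assms(2)] K by auto
  then have "sph (d - card (K - M)) L" unfolding L_def using sph_lk assms(1) by blast
  moreover have "d - card (K - M) = card M"
    using M K assms(3) card_mono[OF K(1) M(1)] by (simp add: card_Diff_subset)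
  ultimately have sL: "sph (card M) L" by simp
  have MsubL: "M \<subseteq> L" using M K by (auto simp: L_def lk_def)
  \<comment> \<open>\<open>L\<close> is the link of the part of \<open>K\<close> that
    \<open>y\<close> does not miss. Outside \<open>K\<close> it contains exactly the vertices that
    miss nothing beyond \<open>M\<close>, among them \<open>y\<close>.\<close>
  have inL: "x \<in> L \<longleftrightarrow> missed K x \<subseteq> M" if "x \<in> U - K" for x
    using that by (auto simp: L_def lk_def missed_def)
  have yL: "y \<in> L" using inL assms(4) by (auto simp: far_def M_def)
  have LU: "L \<subseteq> U" by (auto simp: L_def lk_def)
  \<comment> \<open>Within the link of another \<open>k\<close> of \<open>M\<close>, a non-neighbour
    of \<open>a\<close> misses \<open>a\<close> but not \<open>k\<close>, so its missed set is
    strictly smaller than \<open>M\<close>. By the choice of \<open>a\<close> it is not far, and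
    only the opposite vertex of \<open>a\<close> remains.\<close>
  have single: "\<exists>x. x \<in> U - K \<and> missed K x = {a} \<and> (\<forall>k\<in>M. k \<noteq> a \<longrightarrow> nn (nb L k) a = {x})"
    if a: "a \<in> M" "\<And>z. z \<in> far U K \<Longrightarrow> a \<in> missed K z \<Longrightarrow> \<not> missed K z \<subset> M" for a
  proof -
    have "a \<in> K" using a M by auto
    then obtain x where x: "x \<in> U - K" "missed K x = {a}"
      and u: "\<And>x'. x' \<in> U - K \<Longrightarrow> missed K x' = {a} \<Longrightarrow> x' = x"
      using opposite_vertex[OF assms(1-3) \<open>a \<in> K\<close>] by blast
    have "nn (nb L k) a = {x}" if k: "k \<in> M" "k \<noteq> a" for k
    proof
      show "nn (nb L k) a \<subseteq> {x}"
      proof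
        fix z assume z: "z \<in> nn (nb L k) a"
        then have zL: "z \<in> L" "E k z" "z \<noteq> a" "\<not> E a z" by (auto simp: nn_def nb_def)
        have "z \<notin> K" using zL K(3)[OF \<open>a \<in> K\<close>, of z] by auto
        then have zU: "z \<in> U - K" using zL LU by auto
        have "missed K z \<subset> M" using zL inL[OF zU] k by (auto simp: missed_def)
        moreover have "a \<in> missed K z" using zL \<open>a \<in> K\<close> by (auto simp: missed_def)
        ultimately have "z \<notin> far U K" using a(2) by blast
        then obtain v where "missed K z = {v}" using card_missed_cases[OF assms(1-3) zU] by blast
        then show "z \<in> {x}" using \<open>a \<in> missed K z\<close> u[OF zU] by auto
      qed
      have "x \<in> L" using inL[OF x(1)] x(2) a(1) by auto
      moreover have "E k x" using x(2) k M by (auto simp: missed_def)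
      moreover have "\<not> E a x" using x(2) by (auto simp: missed_def)
      moreover have "x \<noteq> a" using x(1) \<open>a \<in> K\<close> by auto
      ultimately show "{x} \<subseteq> nn (nb L k) a" by (auto simp: nn_def nb_def)
    qed
    then show ?thesis using x by blast
  qed
  have iM: "i \<in> M" "j \<in> M" using assms by (auto simp: M_def)
  obtain xi where xi: "xi \<in> U - K" "missed K xi = {i}" "\<And>k. k \<in> M \<Longrightarrow> k \<noteq> i \<Longrightarrow> nn (nb L k) i = {xi}"
    using single[OF iM(1)] assms(7) unfolding M_def by metis
  obtain xj where xj: "xj \<in> U - K" "missed K xj = {j}" "\<And>k. k \<in> M \<Longrightarrow> k \<noteq> j \<Longrightarrow> nn (nb L k) j = {xj}"
    using single[OF iM(2)] assms(9) unfolding M_def by metis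
  \<comment> \<open>A third element \<open>k\<close> puts \<open>i\<close>, \<open>j\<close> and
    both opposite vertices into one link, where \<open>Q3\<close> shows that \<open>xi\<close> and
    \<open>xj\<close> are adjacent.\<close>
  have "\<not> M \<subseteq> {i, j}"
  proof
    assume "M \<subseteq> {i, j}"
    then have "card M \<le> card {i, j}" by (intro card_mono) auto
    then show False using assms(5) ij by (simp add: M_def)
  qed
  then obtain k where k: "k \<in> M" "k \<noteq> i" "k \<noteq> j" by auto
  have Eij: "E i j" "E k i" "E k j" using K(3) iM M k ij by auto
  define Q where "Q = nb (nb L i) j"
  have i_in: "i \<in> nb L j" "j \<in> nb L i" "i \<in> nb L k" "j \<in> nb L k"
    using MsubL iM Eij sym by (auto simp: nb_def)
  have sub: "\<And>m. m \<in> M \<Longrightarrow> sph (card M - 1) (nb L m)" using sph_nb[OF sL] MsubL by auto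
  have Q1: "nb (nb L j) xi = nb (nb L j) i"
    using nb_eq_if_nn_single[OF sub[OF iM(2)] i_in(1)] xi(3)[OF iM(2)] ij by simp
  have Q2: "nb (nb L i) xj = nb (nb L i) j"
    using nb_eq_if_nn_single[OF sub[OF iM(1)] i_in(2)] xj(3)[OF iM(1)] ij by simp
  have Q3: "nb (nb L k) xi = nb (nb L k) i"
    using nb_eq_if_nn_single[OF sub[OF k(1)] i_in(3)] xi(3)[OF k(1)] k by simp
  have adjQ: "E xi q" "E xj q" "E i q" "E j q" if "q \<in> Q" for q
  proof -
    have "q \<in> nb (nb L j) i" using that by (auto simp: Q_def nb_def)
    then show "E xi q" using Q1 by (auto simp: nb_def)
    have "q \<in> nb (nb L i) j" using that by (auto simp: Q_def)
    then show "E xj q" "E i q" "E j q" using Q2 by (auto simp: nb_def)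
  qed
  have xj_k: "E i xj" "E k xj" "E j xi" using xj(2) xi(2) iM M k ij by (auto simp: missed_def)
  have xL: "xi \<in> L" "xj \<in> L" using inL xi xj iM by auto
  have "xj \<in> nb (nb L k) i" using xL xj_k by (auto simp: nb_def)
  then have Exx: "E xi xj" using Q3 by (auto simp: nb_def)
  have nE: "\<not> E i xi" "\<not> E j xj" using xi(2) xj(2) by (auto simp: missed_def)
  have sQ: "sph (card M - 2) Q"
  proof -
    have "sph (card M - 1 - 1) Q" unfolding Q_def by (rule sph_nb[OF sub[OF iM(1)] i_in(2)])
    moreover have "card M - 1 - 1 = card M - 2" by simp
    ultimately show ?thesis by simp
  qed
  have neq: "i \<noteq> xi" "j \<noteq> xj" using xi xj iM M by auto
  \<comment> \<open>\<open>Q\<close> is suspended by \<open>j\<close>, \<open>xj\<close> and then by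
    \<open>i\<close>, \<open>xi\<close>. The result lies in \<open>L\<close> and has its dimension,
    so it is \<open>L\<close>; but \<open>y\<close> is adjacent neither to \<open>i\<close> nor to
    \<open>j\<close> and is none of the four apices.\<close>
  define W where "W = insert j (insert xj Q)"
  have cW: "closed_pm (Suc (card M - 2)) W"
    unfolding W_def
  proof (rule closed_pm_susp[OF sph_closed[OF sQ] neq(2) nE(2) sph_finite[OF sQ]])
    assume "card M - 2 = 0"
    then show "Q = {}" using sQ by simp
  qed (use adjQ in blast)+
  have "closed_pm (Suc (Suc (card M - 2))) (insert i (insert xi W))"
  proof (rule closed_pm_susp[OF cW neq(1) nE(1)])
    show "finite W" using sph_finite[OF sQ] by (simp add: W_def)
    show "E i x" "E xi x" if "x \<in> W" for x
      using that adjQ Eij(1) xj_k(1) Exx sym[OF xj_k(3)] unfolding W_def by blast+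
  qed simp
  moreover have "Suc (Suc (card M - 2)) = card M" using assms(5) by (simp add: M_def)
  moreover have "insert i (insert xi W) \<subseteq> L"
    using MsubL iM xL by (auto simp: W_def Q_def nb_def)
  ultimately have "insert i (insert xi W) = L" using closed_eq[OF sL] by simp
  moreover have "y \<notin> K" "\<not> E i y" "\<not> E j y" using iM assms(4) by (auto simp: far_def M_def missed_def)
  moreover have "y \<noteq> xi" "y \<noteq> xj" using xi(2) xj(2) assms(5) by (auto simp: M_def)
  moreover have "y \<notin> Q" using adjQ(3) calculation by blast
  ultimately show False using yL iM M unfolding W_def by blast
qed

text \<open>A vertex \<open>i\<close> of \<open>K\<close> that no member of \<open>P\<close> misses
  is charged to a far vertex missing \<open>i\<close> with the fewest missed vertices. Then no far
  vertex with a strictly smaller missed set misses \<open>i\<close>, so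
  \<open>missed_new_unique\<close> makes the charging injective. Together the claims give d \<le> 2
  \<open>card P\<close> + \<open>card Q\<close>.\<close>

lemma facet_covering:
  assumes "sph d U" "K \<in> cliques U" "card K = d" "\<And>v. v \<in> K \<Longrightarrow> \<exists>y\<in>far U K. v \<in> missed K y"
  defines "P \<equiv> {y \<in> far U K. card (missed K y) = 2}"
    and "Q \<equiv> {y \<in> far U K. card (missed K y) \<ge> 3}"
  shows "d \<le> card (\<Union>y\<in>P. missed K y) + card Q" "card P + card Q = card (far U K)"
    "card (\<Union>y\<in>P. missed K y) \<le> 2 * card P"
proof -
  have fin: "finite (far U K)" "finite K" using sph_finite[OF assms(1)] assms(2)
    by (auto simp: far_def cliques_def)
  then have finPQ: "finite P" "finite Q" by (auto simp: P_def Q_def)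
  have "far U K = P \<union> Q" "P \<inter> Q = {}" by (auto simp: P_def Q_def far_def)
  then show "card P + card Q = card (far U K)" using finPQ by (simp add: card_Un_disjoint)
  have "card (\<Union>y\<in>P. missed K y) \<le> (\<Sum>y\<in>P. card (missed K y))"
    by (rule card_UN_le[OF finPQ(1)])
  also have "\<dots> = (\<Sum>y\<in>P. 2)" by (intro sum.cong) (auto simp: P_def)
  finally show "card (\<Union>y\<in>P. missed K y) \<le> 2 * card P" by simp
  let ?R = "K - (\<Union>y\<in>P. missed K y)"
  have "\<exists>y. y \<in> Q \<and> i \<in> missed K y \<and>
      (\<forall>z. z \<in> far U K \<longrightarrow> i \<in> missed K z \<longrightarrow> \<not> missed K z \<subset> missed K y)" if i: "i \<in> ?R" for i
  proof -
    let ?R = "\<lambda>z. z \<in> far U K \<and> i \<in> missed K z"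
    obtain y0 where "?R y0" using assms(4)[of i] i by blast
    then obtain y where "?R y \<and> (\<forall>z. ?R z \<longrightarrow> card (missed K y) \<le> card (missed K z))"
      using ex_has_least_nat[of ?R y0 "\<lambda>z. card (missed K z)"] by blast
    then have y: "y \<in> far U K" "i \<in> missed K y"
      and min: "\<And>z. z \<in> far U K \<and> i \<in> missed K z \<Longrightarrow> card (missed K y) \<le> card (missed K z)"
      by auto
    have "card (missed K y) \<noteq> 2" using y i by (auto simp: P_def)
    moreover have "card (missed K y) \<ge> 2" using y by (auto simp: far_def)
    ultimately have "y \<in> Q" using y by (auto simp: Q_def)
    moreover have "\<not> missed K z \<subset> missed K y" if "z \<in> far U K" "i \<in> missed K z" for z
    proof
      assume "missed K z \<subset> missed K y"
      then have "card (missed K z) < card (missed K y)"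
        using fin by (intro psubset_card_mono) (auto simp: missed_def)
      then show False using min[of z] that by auto
    qed
    ultimately show ?thesis using y by blast
  qed
  then obtain g where g: "\<And>i. i \<in> ?R \<Longrightarrow> g i \<in> Q \<and> i \<in> missed K (g i) \<and>
      (\<forall>z. z \<in> far U K \<longrightarrow> i \<in> missed K z \<longrightarrow> \<not> missed K z \<subset> missed K (g i))" by metis
  have "inj_on g ?R"
  proof (rule inj_onI)
    fix i j assume ij: "i \<in> ?R" "j \<in> ?R" "g i = g j"
    have "g i \<in> far U K" "card (missed K (g i)) \<ge> 3" using g[OF ij(1)] by (auto simp: Q_def)
    then show "i = j"
      using g[OF ij(1)] g[OF ij(2)] ij(3) by (intro missed_new_unique[OF assms(1-3), of "g i"]) auto
  qed
  moreover have "g ` ?R \<subseteq> Q" using g by blast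
  ultimately have "card ?R \<le> card Q" using finPQ by (metis card_inj_on_le)
  moreover have "card K \<le> card (\<Union>y\<in>P. missed K y) + card ?R"
  proof -
    have "(\<Union>y\<in>P. missed K y) \<subseteq> K" by (auto simp: missed_def)
    then have "card ?R = card K - card (\<Union>y\<in>P. missed K y)"
      using fin by (meson card_Diff_subset finite_subset)
    then show ?thesis by simp
  qed
  ultimately show "d \<le> card (\<Union>y\<in>P. missed K y) + card Q" using assms(3) by simp
qed

lemma sum_missed:
  assumes "finite U" "K \<in> cliques U"
  shows "(\<Sum>v\<in>K. card {y \<in> far U K. v \<in> missed K y}) = (\<Sum>y\<in>far U K. card (missed K y))"
proof -
  have fin: "finite (far U K)" "finite K" using assms by (auto simp: far_def cliques_def)
  have "(\<Sum>v\<in>K. card {y \<in> far U K. v \<in> missed K y}) =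
      (\<Sum>v\<in>K. \<Sum>y\<in>far U K. if v \<in> missed K y then 1 else 0)"
    using fin by (intro sum.cong refl) (simp add: sum.If_cases Int_def)
  also have "\<dots> = (\<Sum>y\<in>far U K. \<Sum>v\<in>K. if v \<in> missed K y then 1 else 0)"
    by (rule sum.swap)
  also have "\<dots> = (\<Sum>y\<in>far U K. card (missed K y))"
    using fin by (intro sum.cong refl) (simp add: sum.If_cases Int_def missed_def)
  finally show ?thesis .
qed

end

section \<open>Spheres of large dimension\<close>

context ugraph
begin

lemma sum_eq_imp_pointwise:
  fixes c :: "'b \<Rightarrow> nat"
  assumes "finite K" "\<And>v. v \<in> K \<Longrightarrow> c v \<ge> m" "(\<Sum>v\<in>K. c v) \<le> m * card K" "v \<in> K"
  shows "c v = m"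
proof -
  have "(\<Sum>v\<in>K. m) \<le> (\<Sum>v\<in>K. c v)" using assms(2) by (rule sum_mono)
  then have "(\<Sum>v\<in>K. m) = (\<Sum>v\<in>K. c v)" using assms(3) by (simp add: mult.commute)
  then show ?thesis using sum_mono_inv[of "\<lambda>_. m" K c v] assms by simp
qed

text \<open>With p + q = l the covering count reads d \<le> 2p + q = 2l - q, so d \<ge> 2l leaves q
  = 0 and d = 2l. The far vertices then miss 2l = d vertices of \<open>K\<close> with multiplicity,
  and each vertex of \<open>K\<close> is missed at least once, hence exactly once.\<close>

lemma unsuspended_tight:
  assumes "sph d U" "unsuspended U" "card U = 2 * d + l" "d \<ge> 2 * l"
  shows "d = 2 * l \<and> (\<forall>v\<in>U. card (nn U v) = 2)"
proof -
  have main: "d = 2 * l \<and> (\<forall>v\<in>K. card (nn U v) = 2)" if K: "K \<in> cliques U" "card K = d" for K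
  proof -
    let ?c = "\<lambda>v. card {y \<in> far U K. v \<in> missed K y}"
    define P where "P = {y \<in> far U K. card (missed K y) = 2}"
    define Q where "Q = {y \<in> far U K. card (missed K y) \<ge> 3}"
    have fin: "finite U" "finite K" "finite (far U K)"
      using sph_finite[OF assms(1)] K by (auto simp: cliques_def far_def)
    have c1: "?c v \<ge> 1" if "v \<in> K" for v
    proof -
      have "v \<in> U" using that K by (auto simp: cliques_def)
      then show ?thesis using card_nn_facet[OF assms(1) K that] assms(2)
        by (auto simp: unsuspended_def)
    qed
    have cov: "\<exists>y\<in>far U K. v \<in> missed K y" if "v \<in> K" for v
      using c1[OF that] by (metis (mono_tags, lifting) card.empty empty_Collect_eq not_one_le_zero)
    have l: "card (far U K) = l" using card_far[OF assms(1) K] assms(3) by simp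
    note fc = facet_covering[OF assms(1) K cov, folded P_def Q_def]
    have q: "card Q = 0" "d = 2 * l" using fc assms(4) unfolding l by linarith+
    have "finite Q" using fin by (auto simp: Q_def)
    then have "Q = {}" using q by simp
    then have "card (missed K y) = 2" if "y \<in> far U K" for y
      using that by (fastforce simp: Q_def far_def)
    then have "(\<Sum>v\<in>K. ?c v) = 2 * l" using l by (simp add: sum_missed[OF fin(1) K(1)])
    then have "?c v = 1" if "v \<in> K" for v
      by (intro sum_eq_imp_pointwise[where c = ?c, OF fin(2) c1 _ that]) (use q(2) K(2) in auto)
    then show ?thesis using q(2) card_nn_facet[OF assms(1) K] by simp
  qed
  obtain K where "K \<in> cliques U" "card K = d" using ex_facet[OF assms(1)] by blast
  moreover have "card (nn U v) = 2" if "v \<in> U" for v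
    using ex_facet_through[OF assms(1) that] main by blast
  ultimately show ?thesis using main by blast
qed

text \<open>The covering count and d \<ge> 2l - 2 allow at most two members of \<open>Q\<close>. The
  three cases are settled by double counting, in which every vertex of \<open>K\<close> is now
  missed at least twice.\<close>

lemma facet_thrice:
  assumes "sph d U" "\<And>v. v \<in> U \<Longrightarrow> card (nn U v) \<ge> 3" "card U = 2 * d + l" "l \<ge> 2" "d + 2 \<ge> 2 * l"
    and K: "K \<in> cliques U" "card K = d"
  shows "d = 2 \<and> l = 2 \<or> d \<ge> 4 \<and> (\<forall>v\<in>K. card (nn U v) = 3) \<and> (\<exists>w\<in>U - K. K \<subseteq> nn U w)"
proof -
  let ?c = "\<lambda>v. card {y \<in> far U K. v \<in> missed K y}"
  define P where "P = {y \<in> far U K. card (missed K y) = 2}"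
  define Q where "Q = {y \<in> far U K. card (missed K y) \<ge> 3}"
  have fin: "finite U" "finite K" "finite (far U K)"
    using sph_finite[OF assms(1)] K by (auto simp: cliques_def far_def)
  then have finPQ: "finite P" "finite Q" by (auto simp: P_def Q_def)
  have KU: "K \<subseteq> U" using K by (auto simp: cliques_def)
  have c2: "?c v \<ge> 2" if "v \<in> K" for v
    using card_nn_facet[OF assms(1) K that] assms(2)[of v] KU that by auto
  have cov: "\<exists>y\<in>far U K. v \<in> missed K y" if "v \<in> K" for v
  proof (rule ccontr)
    assume "\<not> (\<exists>y\<in>far U K. v \<in> missed K y)"
    then have "{y \<in> far U K. v \<in> missed K y} = {}" by blast
    then have "?c v = 0" by (simp only: card.empty)
    then show False using c2[OF that] by linarith
  qed
  have l: "card (far U K) = l" using card_far[OF assms(1) K] assms(3) by simp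
  define u where "u = card (\<Union>y\<in>P. missed K y)"
  have fc: "d \<le> u + card Q" "card P + card Q = l" "u \<le> 2 * card P"
    using facet_covering[OF assms(1) K cov] unfolding P_def[symmetric] Q_def[symmetric] u_def l by auto
  have PQ: "far U K = P \<union> Q" "P \<inter> Q = {}" by (auto simp: P_def Q_def far_def)
  have "(\<Sum>v\<in>K. ?c v) = (\<Sum>y\<in>far U K. card (missed K y))"
    by (rule sum_missed[OF fin(1) K(1)])
  also have "\<dots> = (\<Sum>y\<in>P. card (missed K y)) + (\<Sum>y\<in>Q. card (missed K y))"
    unfolding PQ(1) using finPQ PQ(2) by (rule sum.union_disjoint)
  also have "(\<Sum>y\<in>P. card (missed K y)) = (\<Sum>y\<in>P. 2)" by (intro sum.cong) (auto simp: P_def)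
  finally have sumc: "(\<Sum>v\<in>K. ?c v) = 2 * card P + (\<Sum>y\<in>Q. card (missed K y))" by simp
  have "(\<Sum>v\<in>K. 2) \<le> (\<Sum>v\<in>K. ?c v)" using c2 by (intro sum_mono)
  then have dc: "2 * d \<le> 2 * card P + (\<Sum>y\<in>Q. card (missed K y))"
    using K(2) unfolding sumc by simp
  have mK: "missed K y \<subseteq> K" for y by (auto simp: missed_def)
  have "card Q \<le> 2" using fc assms(5) by linarith
  then consider "card Q = 0" | "card Q = 1" | "card Q = 2" by linarith
  then show ?thesis
  proof cases
    case 1
    then have "Q = {}" using finPQ by simp
    then have "d \<le> card P" using dc by simp
    then have "d = 2 \<and> l = 2" using 1 fc assms(4,5) by linarith
    then show ?thesis by blast
  next
    case 2
    then obtain w where w: "Q = {w}" by (auto simp: card_1_singleton_iff)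
    have le: "card (missed K w) \<le> d" using card_mono[OF fin(2) mK] K(2) by simp
    \<comment> \<open>Here \<open>card P\<close> is l - 1, so d \<ge> 2 \<open>card P\<close>, while
      double counting gives 2d \<le> 2 \<open>card P\<close> + \<open>card (missed K w)\<close> with
      last term at most d. Equality holds throughout, so \<open>w\<close> misses all of
      \<open>K\<close>.\<close>
    have dP: "d = 2 * card P" "card (missed K w) = d"
      using dc le fc 2 assms(5) unfolding w by simp_all
    then have mw: "missed K w = K" using card_seteq[OF fin(2) mK] K(2) by simp
    have "card (missed K w) \<ge> 3" "w \<in> U - K" using w by (auto simp: Q_def far_def)
    then have "d \<ge> 3" using dP by simp
    then have "d \<ge> 4" using dP by presburger
    moreover have "K \<subseteq> nn U w"
      using mw \<open>w \<in> U - K\<close> KU sym by (auto simp: nn_def missed_def)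
    moreover have "(\<Sum>v\<in>K. ?c v) \<le> 2 * card K" unfolding sumc using dP K(2) w by simp
    then have "?c v = 2" if "v \<in> K" for v
      by (intro sum_eq_imp_pointwise[where c = ?c, OF fin(2) c2 _ that]) auto
    then have "\<forall>v\<in>K. card (nn U v) = 3" using card_nn_facet[OF assms(1) K] by simp
    ultimately show ?thesis using \<open>w \<in> U - K\<close> by blast
  next
    case 3
    \<comment> \<open>Here \<open>card P\<close> is l - 2, so the covering count is an equality. The
      two vertices of \<open>K\<close> left over by \<open>P\<close> are missed twice each, so both
      members of \<open>Q\<close> miss both of them, and the member with fewest missed vertices
      violates \<open>missed_new_unique\<close>.\<close>
    have ud: "u + 2 = d" "u = 2 * card P" using fc 3 assms(5) by linarith+
    define R where "R = K - (\<Union>y\<in>P. missed K y)"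
    have "(\<Union>y\<in>P. missed K y) \<subseteq> K" using mK by blast
    then have "card R = d - u" unfolding R_def u_def
      using fin K(2) by (metis card_Diff_subset finite_subset)
    then have "card R = 2" using ud by simp
    then obtain a a' where a: "R = {a, a'}" "a \<noteq> a'" by (auto simp: card_2_iff)
    have inQ: "Q \<subseteq> {y \<in> far U K. x \<in> missed K y}" "z \<in> far U K \<Longrightarrow> x \<in> missed K z \<Longrightarrow> z \<in> Q"
      if x: "x \<in> R" for x z
    proof -
      have sub: "{y \<in> far U K. x \<in> missed K y} \<subseteq> Q" using x PQ by (auto simp: R_def)
      moreover have "card Q \<le> card {y \<in> far U K. x \<in> missed K y}" using 3 c2[of x] x by (auto simp: R_def)
      ultimately show "Q \<subseteq> {y \<in> far U K. x \<in> missed K y}" using card_seteq[OF finPQ(2)] by blast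
      show "z \<in> far U K \<Longrightarrow> x \<in> missed K z \<Longrightarrow> z \<in> Q" using sub by blast
    qed
    have "Q \<noteq> {}" using 3 by auto
    then obtain y where y: "y \<in> Q" "\<And>z. z \<in> Q \<Longrightarrow> card (missed K y) \<le> card (missed K z)"
      using ex_has_least_nat[of "\<lambda>z. z \<in> Q" _ "\<lambda>z. card (missed K z)"] by blast
    have no: "\<not> missed K z \<subset> missed K y" if "z \<in> Q" for z
    proof
      assume "missed K z \<subset> missed K y"
      then have "card (missed K z) < card (missed K y)"
        by (intro psubset_card_mono finite_subset[OF mK fin(2)])
      then show False using y(2)[OF that] by simp
    qed
    have "a = a'"
    proof (rule missed_new_unique[OF assms(1) K, of y])
      show "y \<in> far U K" "card (missed K y) \<ge> 3" using y by (auto simp: Q_def)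
      show "a \<in> missed K y" "a' \<in> missed K y" using inQ(1)[of a] inQ(1)[of a'] a y by auto
      show "\<not> missed K z \<subset> missed K y" if "z \<in> far U K" "a \<in> missed K z" for z
        using no inQ(2)[of a z] that a by auto
      show "\<not> missed K z \<subset> missed K y" if "z \<in> far U K" "a' \<in> missed K z" for z
        using no inQ(2)[of a' z] that a by auto
    qed
    then show ?thesis using a by simp
  qed
qed

text \<open>Otherwise some \<open>w\<close> misses a whole facet and has at least d \<ge> 4
  non-neighbours, while a facet through \<open>w\<close> shows that it has three.\<close>

lemma no_nn_pair:
  assumes "sph d U" "\<And>v. v \<in> U \<Longrightarrow> card (nn U v) \<ge> 3" "card U = 2 * d + l" "l \<ge> 2" "d + 2 \<ge> 2 * l"
  shows "d = 2 \<and> l = 2"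
proof -
  obtain K where K: "K \<in> cliques U" "card K = d" using ex_facet[OF assms(1)] by blast
  show ?thesis
  proof (rule ccontr)
    assume neg: "\<not> ?thesis"
    have F: "d \<ge> 4 \<and> (\<forall>v\<in>K. card (nn U v) = 3) \<and> (\<exists>w\<in>U - K. K \<subseteq> nn U w)"
      if "K \<in> cliques U" "card K = d" for K
      using facet_thrice[of d U l K] assms that neg by blast
    obtain w where w: "w \<in> U" "K \<subseteq> nn U w" "d \<ge> 4" using F[OF K] by blast
    obtain K' where K': "K' \<in> cliques U" "card K' = d" "w \<in> K'"
      using ex_facet_through[OF assms(1) w(1)] by blast
    have "card (nn U w) = 3" using F[OF K'(1,2)] K'(3) by blast
    moreover have "card K \<le> card (nn U w)"
      using w(2) sph_finite[OF assms(1)] by (intro card_mono) (auto simp: nn_def)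
    ultimately show False using w(3) K(2) by simp
  qed
qed

text \<open>The size bound leaves \<open>a\<close> and \<open>b\<close> one non-neighbour each
  besides \<open>v\<close>, called \<open>c\<close> and \<open>c'\<close>. In the link of
  \<open>b\<close> the vertices \<open>a\<close> and \<open>c\<close> are suspension partners, in
  the link of \<open>a\<close> so are \<open>b\<close> and \<open>c'\<close>; hence all of them are
  joined to the same \<open>L\<close>, and the five vertices form a pentagon in the order
  \<open>v\<close>, \<open>c\<close>, \<open>b\<close>, \<open>a\<close>, \<open>c'\<close>.\<close>

lemma pentagon_split:
  assumes "sph d U" "v \<in> U" "nn U v = {a, b}" "a \<noteq> b" "card (nn U a) \<ge> 2" "card (nn U b) \<ge> 2"
    and "card U \<le> card (nb (nb U a) b) + 5"
  shows "\<exists>A. U = A \<union> nb (nb U a) b \<and> ring 5 A \<and> joined A (nb (nb U a) b)"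
proof -
  define L where "L = nb (nb U a) b"
  have Eab: "E a b" "E b a" using nn_pair_adj[OF assms(1-4)] sym by auto
  have ab: "a \<in> U" "b \<in> U" "a \<noteq> v" "b \<noteq> v" "\<not> E v a" "\<not> E v b" "\<not> E a v" "\<not> E b v"
    using assms(3) sym by (auto simp: nn_def)
  have fin: "finite U" "finite (nb U a)" "finite (nb U b)"
    using sph_finite[OF assms(1)] by (auto simp: nb_def)
  \<comment> \<open>\<open>card U\<close> is \<open>card (nb (nb U y) x)\<close> + 2 +
    \<open>card (nn U y)\<close> + \<open>card (nn (nb U y) x)\<close>. As \<open>y\<close> has two
    non-neighbours, the bound leaves exactly one for \<open>x\<close> inside the link of
    \<open>y\<close>; exchanging \<open>x\<close> and \<open>y\<close> gives
    \<open>card (nn U x) = 2\<close>.\<close>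
  have key: "\<exists>c. nn U x = {v, c} \<and> c \<noteq> v \<and> nn (nb U y) x = {c}"
    if x: "x \<in> U" "y \<in> U" "E y x" "\<not> E v x" "\<not> E v y" "x \<noteq> v"
      and c: "card (nn U x) \<ge> 2" "card (nn U y) \<ge> 2" "card U \<le> card (nb (nb U y) x) + 5" for x y
  proof -
    have xin: "x \<in> nb U y" using x by (auto simp: nb_def)
    have f: "finite (nb U y)" using fin by (auto simp: nb_def)
    have ne: "nn (nb U y) x \<noteq> {}" using nn_nonempty[OF sph_nb[OF assms(1) x(2)] xin] .
    have "finite (nn (nb U y) x)" using f by (auto simp: nn_def)
    then have "card (nn (nb U y) x) \<ge> 1" using ne by (simp add: Suc_le_eq card_gt_0_iff)
    then have c1: "card (nn (nb U y) x) = 1"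
      using card_nb[OF fin(1) x(2)] card_nb[OF f xin] c by linarith
    have "x \<in> nb U y" "y \<in> nb U x" using xin x sym by (auto simp: nb_def)
    have "card (nb (nb U x) y) = card (nb (nb U y) x)" by (simp add: nb_nb_commute)
    moreover have "nn (nb U x) y \<noteq> {}" using nn_nonempty[OF sph_nb[OF assms(1) x(1)] \<open>y \<in> nb U x\<close>] .
    then have "card (nn (nb U x) y) \<ge> 1"
      using fin(1) by (simp add: Suc_le_eq card_gt_0_iff nn_def nb_def)
    moreover have "card (nb U x) = 1 + card (nb (nb U x) y) + card (nn (nb U x) y)"
      using fin(1) \<open>y \<in> nb U x\<close> by (intro card_nb) (auto simp: nb_def)
    ultimately have "card (nn U x) = 2" using card_nb[OF fin(1) x(1)] c by linarith
    moreover have "v \<in> nn U x" using assms(2) x sym by (auto simp: nn_def)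
    ultimately have "card (nn U x - {v}) = 1" by simp
    then obtain c where "nn U x - {v} = {c}" by (auto simp: card_1_singleton_iff)
    then have c: "nn U x = {v, c}" "c \<noteq> v" using \<open>v \<in> nn U x\<close> by auto
    have "nn (nb U y) x \<subseteq> nn U x - {v}" using x sym by (auto simp: nn_def nb_def)
    then have "nn (nb U y) x \<subseteq> {c}" using c by blast
    then have "nn (nb U y) x = {c}" using ne by blast
    then show ?thesis using c by blast
  qed
  have L': "nb (nb U b) a = L" by (simp add: L_def nb_nb_commute)
  obtain c where c: "nn U a = {v, c}" "c \<noteq> v" "nn (nb U b) a = {c}"
    using key[of a b] ab Eab assms(5-7) L' unfolding L_def by auto
  obtain c' where c': "nn U b = {v, c'}" "c' \<noteq> v" "nn (nb U a) b = {c'}"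
    using key[of b a] ab Eab assms(5-7) unfolding L_def by auto
  have cin: "c \<in> U" "E b c" "c \<noteq> a" "\<not> E a c" using c(3) by (auto simp: nn_def nb_def)
  have c'in: "c' \<in> U" "E a c'" "c' \<noteq> b" "\<not> E b c'" using c'(3) by (auto simp: nn_def nb_def)
  have ne: "c \<noteq> b" "c' \<noteq> a" "c \<noteq> c'" using cin c'in irrefl by auto
  have vc: "E v c" "E v c'" using assms(3) c c' cin c'in ne by (auto simp: nn_def)
  have Lc: "nb (nb U b) c = L" "nb (nb U a) c' = L"
    using nb_eq_if_nn_single[OF sph_nb[OF assms(1) ab(2)] _ c(3)]
      nb_eq_if_nn_single[OF sph_nb[OF assms(1) ab(1)] _ c'(3)] ab Eab L'
    by (auto simp: nb_def L_def)
  have joins: "E a x" "E b x" "E c x" "E c' x" "x \<in> U" if "x \<in> L" for x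
  proof -
    have "x \<in> nb (nb U a) b" "x \<in> nb (nb U b) c" "x \<in> nb (nb U a) c'"
      using that Lc by (auto simp: L_def)
    then show "E a x" "E b x" "E c x" "E c' x" "x \<in> U" by (auto simp: nb_def)
  qed
  have vL: "E v x" if "x \<in> L" for x
  proof -
    have "x \<noteq> v" "x \<noteq> a" "x \<noteq> b" using joins[OF that] ab irrefl by auto
    then have "x \<notin> nn U v" using assms(3) by auto
    then show ?thesis using joins(5)[OF that] \<open>x \<noteq> v\<close> by (auto simp: nn_def)
  qed
  let ?A = "{v, c, b, a, c'}"
  have joined: "joined ?A L" using joins vL by (auto simp: joined_def)
  have finL: "finite L" using fin by (auto simp: L_def nb_def)
  have dis: "distinct [v, c, b, a, c']" using ab c c' cin c'in ne assms(4) by auto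
  have "card (?A \<union> L) = 5 + card L"
    using joined_disjoint[OF joined] finL dis by (subst card_Un_disjoint) auto
  moreover have "?A \<union> L \<subseteq> U" using joins(5) assms(2) ab cin c'in by blast
  ultimately have UAL: "U = ?A \<union> L"
    using card_seteq[OF fin(1), of "?A \<union> L"] assms(7) unfolding L_def by simp
  \<comment> \<open>If they were adjacent, the double suspension of \<open>L\<close> with apices
    \<open>b\<close>, \<open>c'\<close> and \<open>a\<close>, \<open>c\<close> would fill
    \<open>U\<close> and leave out \<open>v\<close>.\<close>
  have "\<not> E c c'"
  proof
    assume E: "E c c'"
    have sL: "sph (d - 1 - 1) L" unfolding L_def
      by (rule sph_nb[OF sph_nb[OF assms(1) ab(1)]]) (use ab Eab in \<open>auto simp: nb_def\<close>)
    have "b \<in> nb U a" using ab Eab by (auto simp: nb_def)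
    then have "d - 1 > 0" using sph_pos[OF sph_nb[OF assms(1) ab(1)]] by blast
    then have d: "d = Suc (Suc (d - 1 - 1))" by simp
    have 1: "closed_pm (Suc (d - 1 - 1)) (insert b (insert c' L))"
    proof (rule closed_pm_susp[OF sph_closed[OF sL] _ c'in(4) finL])
      assume "d - 1 - 1 = 0"
      then show "L = {}" using sL by simp
    qed (use c'in joins in auto)
    have "closed_pm (Suc (Suc (d - 1 - 1))) (insert a (insert c (insert b (insert c' L))))"
    proof (rule closed_pm_susp[OF 1 _ cin(4)])
      show "E a x" "E c x" if "x \<in> insert b (insert c' L)" for x
        using that Eab c'in(2) sym[OF cin(2)] E joins by auto
    qed (use cin finL in auto)
    then have cl: "closed_pm d (insert a (insert c (insert b (insert c' L))))"
      by (simp only: d[symmetric])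
    have "insert a (insert c (insert b (insert c' L))) = U"
      by (rule closed_eq[OF assms(1) cl]) (use UAL in blast)
    then have "v \<in> insert a (insert c (insert b (insert c' L)))" using assms(2) by simp
    then show False using ab c(2) c'(2) vL irrefl by blast
  qed
  moreover have "ring 5 ?A"
    using dis vc(1) sym[OF cin(2)] Eab(2) c'in(2) sym[OF vc(2)] ab(5,6) cin(4) \<open>\<not> E c c'\<close> c'in(4) sym
    by (intro ring5I) auto
  ultimately show ?thesis using UAL joined unfolding L_def by blast
qed

lemma nn_joined:
  assumes "U = A \<union> Z" "joined A Z" "x \<in> Z"
  shows "nn U x = nn Z x"
  using assms sym by (auto simp: nn_def joined_def)

lemma unsuspended_joined:
  assumes "U = A \<union> Z" "joined A Z" "unsuspended U"
  shows "unsuspended Z"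
  unfolding unsuspended_def
proof
  fix v assume v: "v \<in> Z"
  then have "card (nn U v) \<ge> 2" using assms(1,3) by (simp add: unsuspended_def)
  then show "card (nn Z v) \<ge> 2" unfolding nn_joined[OF assms(1,2) v] .
qed

text \<open>Every vertex has exactly two non-neighbours, so for any \<open>v\<close> the edge
  between them meets the bound of \<open>pentagon_split\<close>. Its link is again unsuspended and
  tight, with l - 1 and d - 2.\<close>

lemma C5_join_if_tight:
  assumes "sph d U" "unsuspended U" "card U = 2 * d + l" "d \<ge> 2 * l"
  shows "d = 2 * l \<and> C5_join l U"
  using assms
proof (induction l arbitrary: d U)
  case 0
  then show ?case using unsuspended_tight[OF 0] by simp
next
  case (Suc l)
  have d: "d = 2 * Suc l" and nn2: "\<And>v. v \<in> U \<Longrightarrow> card (nn U v) = 2"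
    using unsuspended_tight[OF Suc.prems] by auto
  have fin: "finite U" using sph_finite[OF Suc.prems(1)] .
  obtain v where v: "v \<in> U" using sph_nonempty[OF Suc.prems(1)] d by auto
  obtain a b where ab: "nn U v = {a, b}" "a \<noteq> b" using nn2[OF v] by (auto simp: card_2_iff)
  then have abU: "a \<in> U" "b \<in> U" "\<not> E v a" "a \<noteq> v" "\<not> E v b" "b \<noteq> v" by (auto simp: nn_def)
  have Eab: "E a b" using nn_pair_adj[OF Suc.prems(1) v ab] .
  have b: "b \<in> nb U a" using Eab abU by (auto simp: nb_def)
  let ?L = "nb (nb U a) b"
  have "nn (nb U a) b \<subseteq> nn U b - {v}" using abU sym by (auto simp: nn_def nb_def)
  then have "card (nn (nb U a) b) \<le> card (nn U b - {v})"
    using fin by (intro card_mono) (auto simp: nn_def)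
  moreover have "v \<in> nn U b" using v abU sym by (auto simp: nn_def)
  ultimately have "card (nn (nb U a) b) \<le> 1" using nn2[OF abU(2)] by simp
  moreover have "card (nb U a) = 1 + card ?L + card (nn (nb U a) b)"
    using fin b by (intro card_nb) (auto simp: nb_def)
  ultimately have cL: "card U \<le> card ?L + 5" using card_nb[OF fin abU(1)] nn2[OF abU(1)] by simp
  obtain A where A: "U = A \<union> ?L" "ring 5 A" "joined A ?L"
    using pentagon_split[OF Suc.prems(1) v ab _ _ cL] nn2 abU by auto
  have "card U = 5 + card ?L"
    using ring_finite_card[OF A(2)] joined_disjoint[OF A(3)] fin
    by (subst A(1)) (simp add: card_Un_disjoint nb_def)
  then have cL2: "card ?L = 2 * (d - 2) + l" using Suc.prems(3) d by simp
  have "sph (d - 1 - 1) ?L" using sph_nb[OF sph_nb[OF Suc.prems(1) abU(1)] b] .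
  then have "sph (d - 2) ?L" by (simp add: numeral_2_eq_2)
  then have "C5_join l ?L"
    using Suc.IH[of "d - 2" ?L] unsuspended_joined[OF A(1,3) Suc.prems(2)] cL2 d by simp
  then show ?case using d A unfolding C5_join.simps by blast
qed

end

section \<open>The two extremal configurations on vertex sets\<close>

context ugraph
begin

definition first_config :: "nat \<Rightarrow> 'a set \<Rightarrow> bool" where
  "first_config l U \<longleftrightarrow> (\<exists>A Z. U = A \<union> Z \<and> ring 6 A \<and> joined A Z \<and> C5_join (l - 2) Z)"

text \<open>Here \<open>a\<close> is the vertex subdividing the edge \<open>{b, c}\<close> of the suspension, with apices \<open>v\<close> and
  \<open>b\<close>, of a join of pentagons; \<open>c\<close> and its neighbours \<open>p\<close>, \<open>q\<close> lie in the pentagon \<open>A\<close>.\<close>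

definition second_config :: "nat \<Rightarrow> 'a set \<Rightarrow> bool" where
  "second_config l U \<longleftrightarrow> (\<exists>v a b A Z p c q. U = {v, a, b} \<union> A \<union> Z \<and> ring 5 A \<and> C5_join (l - 2) Z \<and>
     joined ({v, a, b} \<union> A) Z \<and> v \<notin> A \<and> a \<notin> A \<and> b \<notin> A \<and> v \<noteq> a \<and> v \<noteq> b \<and>
     \<not> E v a \<and> \<not> E v b \<and> E a b \<and> joined {v} A \<and>
     {p, c, q} \<subseteq> A \<and> p \<noteq> q \<and> E c p \<and> E c q \<and>
     (\<forall>x\<in>A. E a x \<longleftrightarrow> x \<in> {p, c, q}) \<and> (\<forall>x\<in>A. E b x \<longleftrightarrow> x \<noteq> c))"

lemma second_configI:
  assumes "U = {v, a, b} \<union> A \<union> Z" "ring 5 A" "C5_join (l - 2) Z" "joined ({v, a, b} \<union> A) Z"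
    "v \<notin> A" "a \<notin> A" "b \<notin> A" "v \<noteq> a" "v \<noteq> b" "\<not> E v a" "\<not> E v b" "E a b" "joined {v} A"
    "{p, c, q} \<subseteq> A" "p \<noteq> q" "E c p" "E c q"
    "\<forall>x\<in>A. E a x \<longleftrightarrow> x \<in> {p, c, q}" "\<forall>x\<in>A. E b x \<longleftrightarrow> x \<noteq> c"
  shows "second_config l U"
  unfolding second_config_def
  by (intro exI[of _ v] exI[of _ a] exI[of _ b] exI[of _ A] exI[of _ Z] exI[of _ p] exI[of _ c]
      exI[of _ q] conjI assms)

text \<open>The graph is 2-regular and connected. The walk from \<open>v0\<close> in both directions
  cannot close up early, because a coincidence contradicts the degrees or yields fewer than six
  vertices closed under adjacency.\<close>

lemma hexagon:
  assumes "sph 2 U" "card U = 6"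
  shows "ring 6 U"
proof -
  have fin: "finite U" and conn: "connected_on U" and nbs: "\<And>v. v \<in> U \<Longrightarrow> sph (Suc 0) (nb U v)"
    using assms(1) by (auto simp: numeral_2_eq_2)
  have c2: "card (nb U v) = 2" if "v \<in> U" for v using sph_1_card[OF nbs[OF that]] .
  have closed: "card A = 6" if "A \<subseteq> U" "A \<noteq> {}" "\<And>a. a \<in> A \<Longrightarrow> nb U a \<subseteq> A" for A
    using conn that assms(2) unfolding connected_on_def by blast
  have other: "\<exists>y. nb U x = {z, y} \<and> y \<noteq> z" if "x \<in> U" "z \<in> nb U x" for x z
  proof -
    have "card (nb U x - {z}) = 1" using c2[OF that(1)] that(2) by simp
    then obtain y where "nb U x - {z} = {y}" by (auto simp: card_1_singleton_iff)
    then have "nb U x = {z, y} \<and> y \<noteq> z" using that(2) by auto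
    then show ?thesis by blast
  qed
  obtain v0 where v0: "v0 \<in> U" using sph_nonempty[OF assms(1)] by auto
  obtain v1 v5 where n0: "nb U v0 = {v1, v5}" "v1 \<noteq> v5" using c2[OF v0] by (auto simp: card_2_iff)
  have v15: "v1 \<in> U" "v5 \<in> U" "v0 \<in> nb U v1" "v0 \<in> nb U v5" "v0 \<noteq> v1" "v0 \<noteq> v5"
    using n0 v0 sym irrefl by (auto simp: nb_def set_eq_iff)
  obtain v2 where n1: "nb U v1 = {v0, v2}" "v2 \<noteq> v0" using other v15 by blast
  obtain v4 where n5: "nb U v5 = {v0, v4}" "v4 \<noteq> v0" using other v15 by blast
  have v24: "v2 \<in> U" "v4 \<in> U" "v1 \<in> nb U v2" "v5 \<in> nb U v4" "v2 \<noteq> v1" "v4 \<noteq> v5"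
    using n1 n5 v15 sym irrefl by (auto simp: nb_def set_eq_iff)
  have c3: "card {x, y, z} \<noteq> 6" "card {x, y, z, w} \<noteq> 6" "card {x, y, z, w, r} \<noteq> 6" for x y z w r :: 'a
    using card_length[of "[x, y, z]"] card_length[of "[x, y, z, w]"] card_length[of "[x, y, z, w, r]"]
    by auto
  have n2v5: "v2 \<noteq> v5"
  proof
    assume e: "v2 = v5"
    then have "v1 \<in> nb U v5" using v24 by simp
    then have "nb U v5 = {v0, v1}" using n5 v15 by auto
    then have "card {v0, v1, v5} = 6" using n0 n1 v0 v15 e by (intro closed) auto
    then show False using c3 by blast
  qed
  have n4v1: "v4 \<noteq> v1"
  proof
    assume e: "v4 = v1"
    then have "v5 \<in> nb U v1" using v24 by simp
    then show False using n1 v15 n2v5 by auto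
  qed
  obtain v3 where n2: "nb U v2 = {v1, v3}" "v3 \<noteq> v1" using other v24 by blast
  obtain v3' where n4: "nb U v4 = {v5, v3'}" "v3' \<noteq> v5" using other v24 by blast
  have v3: "v3 \<in> U" "v2 \<in> nb U v3" "v3 \<noteq> v2" "v3' \<in> U" "v4 \<in> nb U v3'" "v3' \<noteq> v4"
    using n2 n4 v24 sym irrefl by (auto simp: nb_def set_eq_iff)
  have n24: "v2 \<noteq> v4"
  proof
    assume e: "v2 = v4"
    then have "nb U v2 = {v1, v5}" using n2 v24 n0(2) by auto
    then have "card {v0, v1, v2, v5} = 6" using n0 n1 n5 v0 v15 v24 e by (intro closed) auto
    then show False using c3 by blast
  qed
  have v30: "v3 \<noteq> v0" using v3(2) n0 n24 v24 n2v5 by auto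
  have v35: "v3 \<noteq> v5" using v3(2) n5 n24 n1 by auto
  have v34: "v3 \<noteq> v4"
  proof
    assume e: "v3 = v4"
    then have "v3' = v2" using v3 n4 n2v5 by auto
    then have "card {v0, v1, v2, v4, v5} = 6" using n0 n1 n2 n4 n5 v0 v15 v24 e by (intro closed) auto
    then show False using c3 by blast
  qed
  have d: "distinct [v0, v1, v2, v3, v4, v5]"
    using v15 n0 n1 n5 n2 v24 n2v5 n4v1 n24 v30 v35 v34 v3 by auto
  have U: "U = {v0, v1, v2, v3, v4, v5}"
  proof (rule card_seteq[OF fin, symmetric])
    show "{v0, v1, v2, v3, v4, v5} \<subseteq> U" using v0 v15 v24 v3 by auto
    have "card (set [v0, v1, v2, v3, v4, v5]) = 6" using distinct_card[OF d] by simp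
    then show "card U \<le> card {v0, v1, v2, v3, v4, v5}" using assms(2) by simp
  qed
  have "v4 \<notin> nb U v0" "v4 \<notin> nb U v1" "v4 \<notin> nb U v2"
    unfolding n0(1) n1(1) n2(1) using d by auto
  then have "v3' \<noteq> v0" "v3' \<noteq> v1" "v3' \<noteq> v2" using v3(5) by blast+
  moreover have "v3' \<in> {v0, v1, v2, v3, v4, v5}" using v3(4) unfolding U .
  ultimately have "v3' = v3" using v3(6) n4(2) by blast
  then have n4: "nb U v4 = {v5, v3}" using n4 by simp
  have inU: "v0 \<in> U" "v1 \<in> U" "v2 \<in> U" "v3 \<in> U" "v4 \<in> U" "v5 \<in> U"
    using v0 v15 v24 v3 by blast+
  have adj: "E v0 y \<longleftrightarrow> y \<in> {v1, v5}" "E v1 y \<longleftrightarrow> y \<in> {v0, v2}" "E v2 y \<longleftrightarrow> y \<in> {v1, v3}"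
    "E v4 y \<longleftrightarrow> y \<in> {v5, v3}" "E v5 y \<longleftrightarrow> y \<in> {v0, v4}" if "y \<in> U" for y
    unfolding n0(1)[symmetric] n1(1)[symmetric] n2(1)[symmetric] n4[symmetric] n5(1)[symmetric]
    using that by (auto simp: nb_def)
  have "E v3 v4" "\<not> E v3 v5"
    using adj(4)[OF inU(4)] adj(5)[OF inU(4)] sym d by auto
  then have "ring 6 {v0, v1, v2, v3, v4, v5}"
    using d by (intro ring6I) (auto simp: adj inU)
  then show ?thesis using U by simp
qed

lemma nb_nb_pentagon:
  assumes "U = A \<union> Z" "ring 5 A" "joined A Z" "x \<in> A" "y \<in> A" "E x y"
  shows "nb (nb U x) y = Z"
proof -
  obtain b c d e where A: "A = {x, b, c, d, e}" "distinct [x, b, c, d, e]"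
    "E x b" "E b c" "E c d" "E d e" "E e x"
    "\<not> E x c" "\<not> E x d" "\<not> E b d" "\<not> E b e" "\<not> E c e"
    using ring5E[OF assms(2,4)] by metis
  have "\<not> E b b" "\<not> E e e" "\<not> E x x" "\<not> E e b" using irrefl A sym by blast+
  then have "\<not> (E x z \<and> E y z)" if "z \<in> A" for z
    using that assms(4-6) A irrefl sym unfolding A(1) by blast
  then show ?thesis using assms by (auto simp: nb_def joined_def)
qed

lemma sph_pentagon_rest:
  assumes "sph d U" "U = A \<union> Z" "ring 5 A" "joined A Z"
  shows "sph (d - 2) Z" "d \<ge> 2"
proof -
  obtain x where x: "x \<in> A" using ring_finite_card[OF assms(3)] by (metis all_not_in_conv card.empty zero_neq_numeral)
  obtain y where y: "y \<in> A" "E x y" using ring5E[OF assms(3) x] by (metis insertCI)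
  have "x \<in> U" "y \<in> nb U x" using x y assms(2) by (auto simp: nb_def)
  then have "sph (d - 1) (nb U x)" "sph (d - 1 - 1) (nb (nb U x) y)" "d - 1 > 0"
    using sph_nb[OF assms(1)] sph_nb sph_pos by blast+
  then show "sph (d - 2) Z" "d \<ge> 2" using nb_nb_pentagon[OF assms(2-4) x y] by (auto simp: numeral_2_eq_2)
qed

text \<open>The two non-neighbours of a pentagon vertex \<open>x\<close> span the opposite edge,
  whose link is \<open>Z\<close>, and the link of \<open>x\<close> is the suspension of
  \<open>Z\<close>. The total factor is 1 + 5t + 5t^2.\<close>

lemma fpoly_pentagon:
  assumes "sph d U" "U = A \<union> Z" "ring 5 A" "joined A Z"
  shows "fpoly U = [:1,2:] * ([:1,2:] * fpoly Z) + [:0,1,1:] * fpoly Z"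
proof -
  obtain x where x: "x \<in> A" using ring_finite_card[OF assms(3)] by (metis all_not_in_conv card.empty zero_neq_numeral)
  obtain b c d' e where A: "A = {x, b, c, d', e}" "distinct [x, b, c, d', e]"
    "E x b" "E b c" "E c d'" "E d' e" "E e x"
    "\<not> E x c" "\<not> E x d'" "\<not> E b d'" "\<not> E b e" "\<not> E c e"
    using ring5E[OF assms(3) x] by metis
  have J: "E a z" if "a \<in> A" "z \<in> Z" for a z using assms(4) that by (auto simp: joined_def)
  have nnx: "nn U x = {c, d'}"
    using A J x assms(2) sym by (auto simp: nn_def)
  have nbx: "nb U x = {b, e} \<union> Z"
    using A J x assms(2) sym irrefl by (auto simp: nb_def)
  have xU: "x \<in> U" using x assms(2) by simp
  have nnb: "nn (nb U x) b = {e}"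
    unfolding nbx using A J by (auto simp: nn_def)
  have "nb (nb U x) b = Z" using nb_nb_pentagon[OF assms(2-4) x] A by auto
  then have 1: "fpoly (nb U x) = [:1,2:] * fpoly Z"
    using fpoly_susp[OF sph_nb[OF assms(1) xU] _ nnb] nbx by auto
  have "nb (nb U c) d' = Z" using nb_nb_pentagon[OF assms(2-4), of c d'] A by auto
  then show ?thesis using fpoly_nn_pair[OF assms(1) xU nnx] A 1 by auto
qed

text \<open>A pentagon contained in \<open>L\<close> is split off by induction. If one is not
  contained, its trace on \<open>L\<close> has neither a path end nor just one vertex, as these
  would make a link in \<open>L\<close>, or \<open>L\<close> itself, a cone. Two non-adjacent
  vertices remain, and rigidity shows that \<open>L\<close> contains all of the other
  pentagons.\<close>

lemma C5_join_sub:
  assumes "C5_join k X" "sph (2 * k) X" "L \<subseteq> X" "sph (2 * k - 1) L" "k \<ge> 1"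
  shows "\<exists>A Z p q. X = A \<union> Z \<and> ring 5 A \<and> joined A Z \<and> C5_join (k - 1) Z \<and> L = {p, q} \<union> Z \<and>
    p \<in> A \<and> q \<in> A \<and> p \<noteq> q \<and> \<not> E p q"
  using assms
proof (induction k arbitrary: X L)
  case (Suc k)
  obtain A Z where AZ: "X = A \<union> Z" "ring 5 A" "joined A Z" "C5_join k Z"
    using Suc.prems(1) by auto
  have J: "E a z" "E z a" if "a \<in> A" "z \<in> Z" for a z using AZ(3) that sym by (auto simp: joined_def)
  have sZ: "sph (2 * k) Z" using sph_pentagon_rest(1)[OF Suc.prems(2) AZ(1-3)] by simp
  have sL: "sph (Suc (2 * k)) L" using Suc.prems(4) by simp
  show ?case
  proof (cases "A \<subseteq> L")
    case True
    then have L: "L = A \<union> (Z \<inter> L)" using Suc.prems(3) AZ(1) by blast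
    have jL: "joined A (Z \<inter> L)" using AZ(3) by (auto simp: joined_def)
    have k: "k \<ge> 1" and sL': "sph (2 * k - 1) (Z \<inter> L)"
      using sph_pentagon_rest[OF sL L AZ(2) jL] by auto
    obtain A' Z' p q where I: "Z = A' \<union> Z'" "ring 5 A'" "joined A' Z'" "C5_join (k - 1) Z'"
      "Z \<inter> L = {p, q} \<union> Z'" "p \<in> A'" "q \<in> A'" "p \<noteq> q" "\<not> E p q"
      using Suc.IH[OF AZ(4) sZ _ sL' k] by blast
    have "joined A Z'" "joined A' (A \<union> Z')" using I AZ(3) J by (auto simp: joined_def)
    then have "C5_join k (A \<union> Z')" using k I(4) AZ(2) by (cases k) auto
    moreover have "X = A' \<union> (A \<union> Z')" "L = {p, q} \<union> (A \<union> Z')" using AZ(1) I L by auto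
    ultimately show ?thesis using I \<open>joined A' (A \<union> Z')\<close> by (metis diff_Suc_1)
  next
    case False
    then obtain m where m: "m \<in> A" "m \<notin> L" by blast
    obtain b c d e where A: "A = {m, b, c, d, e}" "distinct [m, b, c, d, e]"
      "E m b" "E b c" "E c d" "E d e" "E e m"
      "\<not> E m c" "\<not> E m d" "\<not> E b d" "\<not> E b e" "\<not> E c e"
      using ring5E[OF AZ(2) m(1)] by metis
    have s: "E c b" "E d c" "E e d" "\<not> E d b" "\<not> E e b" "\<not> E e c"
      using A sym by blast+
    have LX: "x \<in> {b, c, d, e} \<or> x \<in> Z" if "x \<in> L" for x
      using that Suc.prems(3) AZ(1) A(1) m by blast
    \<comment> \<open>If \<open>y\<close> is the only neighbour of \<open>x\<close> in the trace of
      \<open>L\<close> on \<open>A\<close>, everything else in the link of \<open>x\<close> lies in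
      \<open>Z\<close>, so that link is a cone with apex \<open>y\<close>. This removes the edges of
      the path \<open>b\<close>, \<open>c\<close>, \<open>d\<close>, \<open>e\<close> starting from
      its ends.\<close>
    have no_end: False if "x \<in> A" "x \<in> L" "y \<in> A" "y \<in> L" "E x y"
      and u: "\<And>z. z \<in> A \<Longrightarrow> z \<in> L \<Longrightarrow> E x z \<Longrightarrow> z = y" for x y
    proof -
      have "nn (nb L x) y = {}"
      proof -
        have "E y z" if "z \<in> L" "E x z" "z \<noteq> y" for z
          using that u Suc.prems(3) AZ(1) J(1)[OF \<open>y \<in> A\<close>] by blast
        then show ?thesis by (auto simp: nn_def nb_def)
      qed
      moreover have "y \<in> nb L x" using that(4,5) by (auto simp: nb_def)
      ultimately show False using nn_nonempty[OF sph_nb[OF sL that(2)]] by blast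
    qed
    have b_c: "\<not> (b \<in> L \<and> c \<in> L)" using no_end[of b c] A s m irrefl by blast
    have d_e: "\<not> (d \<in> L \<and> e \<in> L)" using no_end[of e d] A s m irrefl by blast
    have c_d: "\<not> (c \<in> L \<and> d \<in> L)" using no_end[of c d] b_c A s m irrefl by blast
    have single: "\<exists>y\<in>A \<inter> L. y \<noteq> x" if x: "x \<in> A" "x \<in> L" for x
    proof (rule ccontr)
      assume "\<not> ?thesis"
      then have "nn L x = {}" using J(1)[OF x(1)] Suc.prems(3) AZ(1) by (auto simp: nn_def)
      then show False using nn_nonempty[OF sL x(2)] by blast
    qed
    \<comment> \<open>Dimension: \<open>L\<close> has a clique with 2k + 1 vertices, while cliques
      of \<open>Z\<close> have at most 2k.\<close>
    have "A \<inter> L \<noteq> {}"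
    proof
      assume "A \<inter> L = {}"
      then have LZ: "L \<subseteq> Z" using Suc.prems(3) AZ(1) by blast
      obtain K where "K \<in> cliques L" "card K = Suc (2 * k)" using ex_facet[OF sL] by blast
      then show False using clique_card_le[OF sZ] cliques_mono[OF LZ] by fastforce
    qed
    then obtain p where p: "p \<in> A" "p \<in> L" by blast
    obtain q where q: "q \<in> A" "q \<in> L" "q \<noteq> p" using single[OF p] by blast
    have pe: "A \<inter> L \<subseteq> {b, c, d, e}" using A(1) m by blast
    have AL: "A \<inter> L = {p, q} \<and> \<not> E p q"
      using p q pe b_c c_d d_e A s by blast
    have "x \<in> Z" if "x \<in> L" "E p x" for x
    proof (rule ccontr)
      assume "x \<notin> Z"
      then have "x \<in> A \<inter> L" using that(1) Suc.prems(3) AZ(1) by blast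
      then have "x = p \<or> x = q" using AL by simp
      then show False using that(2) AL irrefl by auto
    qed
    then have "nb L p = Z \<inter> L" using J(1)[OF p(1)] by (auto simp: nb_def)
    then have "sph (2 * k) (Z \<inter> L)" using sph_nb[OF sL p(2)] by simp
    then have "Z \<inter> L = Z" using closed_eq[OF sZ sph_closed] by blast
    then have "L = {p, q} \<union> Z" using AL Suc.prems(3) AZ(1) by blast
    then show ?thesis using AZ AL p q by (metis diff_Suc_1)
  qed
qed simp

text \<open>The link of the edge between \<open>a\<close> and \<open>b\<close> has codimension 1 in
  the link of \<open>v\<close>, so by \<open>C5_join_sub\<close> it is \<open>{p, q}\<close> joined
  with \<open>Z\<close>, and \<open>p\<close>, \<open>q\<close> cut the pentagon \<open>A\<close>
  into the vertex \<open>c\<close> and the edge \<open>{c1, c2}\<close>. No vertex of the link of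
  \<open>v\<close> outside \<open>L\<close> is adjacent to both \<open>a\<close> and
  \<open>b\<close>, so one of them takes \<open>c\<close> and the other the edge.\<close>

lemma second_config_if:
  assumes "sph d U" "v \<in> U" "nn U v = {a, b}" "a \<noteq> b" "l \<ge> 2" "d = 2 * l - 1"
    and "C5_join (l - 1) (nb U v)"
  shows "second_config l U"
proof -
  have Eab: "E a b" "E b a" using nn_pair_adj[OF assms(1-4)] sym by auto
  have ab: "a \<in> U" "b \<in> U" "a \<noteq> v" "b \<noteq> v" "\<not> E v a" "\<not> E v b"
    using assms(3) by (auto simp: nn_def)
  define N where "N = nb U v"
  define L where "L = nb (nb U a) b"
  have U: "U = {v, a, b} \<union> N" using nb_partition[OF assms(2)] assms(3) by (auto simp: N_def)
  have nN: "v \<notin> N" "a \<notin> N" "b \<notin> N" using ab irrefl by (auto simp: N_def nb_def)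
  have LN: "L \<subseteq> N"
  proof
    fix x assume "x \<in> L"
    then have x: "x \<in> U" "E a x" "E b x" by (auto simp: L_def nb_def)
    then have "x \<noteq> v" "x \<noteq> a" "x \<noteq> b" using ab irrefl sym by blast+
    then show "x \<in> N" using x U by blast
  qed
  have bin: "b \<in> nb U a" "a \<in> nb U b" using ab Eab by (auto simp: nb_def)
  have "sph (d - 1) N" unfolding N_def using sph_nb[OF assms(1,2)] .
  then have sN: "sph (2 * (l - 1)) N" using assms(5,6) by (simp add: algebra_simps)
  have "sph (d - 1 - 1) L" unfolding L_def using sph_nb[OF sph_nb[OF assms(1) ab(1)] bin(1)] .
  moreover have "d - 1 - 1 = 2 * (l - 1) - 1" using assms(5,6) by simp
  ultimately have sL: "sph (2 * (l - 1) - 1) L" by simp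
  have l1: "l - 1 \<ge> 1" using assms(5) by simp
  obtain A Z p q where S: "N = A \<union> Z" "ring 5 A" "joined A Z" "C5_join (l - 1 - 1) Z" "L = {p, q} \<union> Z"
    "p \<in> A" "q \<in> A" "p \<noteq> q" "\<not> E p q"
    using C5_join_sub[OF _ sN LN sL] assms(7) l1 unfolding N_def[symmetric] by blast
  have "\<exists>c c1 c2. A = {p, c, q, c1, c2} \<and> distinct [p, c, q, c1, c2] \<and> E p c \<and> E c q \<and> E q c1 \<and>
      E c1 c2 \<and> E c2 p"
  proof -
    obtain x2 x3 x4 x5 where A: "A = {p, x2, x3, x4, x5}" "distinct [p, x2, x3, x4, x5]"
      "E p x2" "E x2 x3" "E x3 x4" "E x4 x5" "E x5 p"
      using ring5E[OF S(2,6)] by metis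
    then have "q = x3 \<or> q = x4" using S sym by auto
    then show ?thesis
    proof
      assume "q = x3"
      then show ?thesis using A by blast
    next
      assume "q = x4"
      then have "A = {p, x5, q, x3, x2}" "distinct [p, x5, q, x3, x2]" using A by auto
      then show ?thesis using A \<open>q = x4\<close> sym by blast
    qed
  qed
  then obtain c c1 c2 where A: "A = {p, c, q, c1, c2}" "distinct [p, c, q, c1, c2]"
    "E p c" "E c q" "E q c1" "E c1 c2" "E c2 p" by blast
  have cs: "c \<notin> L" "c1 \<notin> L" "c2 \<notin> L" "c \<in> N" "c1 \<in> N" "c2 \<in> N"
    using A S(1,3,5) irrefl by (auto simp: joined_def)
  have not_both: "\<not> (E a x \<and> E b x)" if "x \<in> N" "x \<notin> L" for x
    using that by (auto simp: L_def N_def nb_def)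
  have side: "g \<subseteq> nb U a \<or> g \<subseteq> nb U b" if "g \<in> cliques N" for g
    using clique_side[OF assms(1-3)] that by (simp add: N_def)
  have side_c: "E a c \<or> E b c" using side[of "{c}"] cs by (auto simp: cliques_def nb_def)
  have side_12: "E a c1 \<and> E a c2 \<or> E b c1 \<and> E b c2"
    using side[of "{c1, c2}"] cs A(6) sym by (auto simp: cliques_def nb_def)
  have LE: "E a x" "E b x" if "x \<in> L" for x using that by (auto simp: L_def nb_def)
  \<comment> \<open>The roles of \<open>a\<close> and \<open>b\<close> are symmetric;
    \<open>y\<close> is the one adjacent to \<open>c1\<close> and \<open>c2\<close>.\<close>
  have build: "second_config l U"
    if xy: "{x, y} = {a, b}" "E x y" "E y c1" "E y c2" for x y
  proof -
    have x: "x \<in> U" "\<not> E v x" "x \<notin> N" "x \<noteq> v" and y: "y \<in> U" "\<not> E v y" "y \<notin> N" "y \<noteq> v" "y \<in> nb U x"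
      using xy ab nN bin by (auto simp: doubleton_eq_iff)
    have LE': "E x z" "E y z" if "z \<in> L" for z using LE[OF that] xy(1) by (auto simp: doubleton_eq_iff)
    have nb': "\<not> (E x z \<and> E y z)" if "z \<in> N" "z \<notin> L" for z
      using not_both[OF that] xy(1) by (auto simp: doubleton_eq_iff)
    have nx: "\<not> E x c1" "\<not> E x c2" using nb' cs xy by auto
    \<comment> \<open>Otherwise all vertices of the link of \<open>x\<close> other than
      \<open>y\<close> lie in \<open>L\<close>, and that link is a cone with apex
      \<open>y\<close>.\<close>
    have xc: "E x c"
    proof (rule ccontr)
      assume n: "\<not> E x c"
      have "nn (nb U x) y = {}"
      proof -
        have "E y z" if "z \<in> U" "E x z" "z \<noteq> y" for z
        proof -
          have "z \<in> {v, x, y} \<union> N" using that U xy(1) by auto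
          then have "z \<in> N" using that x(2) irrefl sym by auto
          then have "z \<in> L" using S(1,5) A(1) that n nx by auto
          then show ?thesis using LE' by blast
        qed
        then show ?thesis by (auto simp: nn_def nb_def)
      qed
      then show False using nn_nonempty[OF sph_nb[OF assms(1) x(1)] y(5)] by blast
    qed
    then have yc: "\<not> E y c" using nb' cs by blast
    have pq: "E x p" "E x q" "E y p" "E y q" using LE' S(5) by auto
    have ZL: "E x z" "E y z" "E v z" if "z \<in> Z" for z
      using that LE' S(1,5) by (auto simp: N_def nb_def)
    have U': "U = {v, x, y} \<union> A \<union> Z" using U xy(1) S(1) by auto
    have j: "joined ({v, x, y} \<union> A) Z" using ZL S(3) by (auto simp: joined_def)
    have jv: "joined {v} A" using S(1) by (auto simp: joined_def N_def nb_def)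
    have xA: "\<forall>z\<in>A. E x z \<longleftrightarrow> z \<in> {p, c, q}" using A pq xc nx by auto
    have yA: "\<forall>z\<in>A. E y z \<longleftrightarrow> z \<noteq> c" using A pq yc xy by auto
    have "l - 1 - 1 = l - 2" by simp
    then have CZ: "C5_join (l - 2) Z" using S(4) by simp
    have pcq: "{p, c, q} \<subseteq> A" "E c p" "E c q" using A sym by auto
    have "v \<notin> A" "x \<notin> A" "y \<notin> A" using nN S(1) x y by auto
    moreover have "v \<noteq> x" "v \<noteq> y" using x(4) y(4) by auto
    ultimately show ?thesis
      by (intro second_configI[OF U' S(2) CZ j _ _ _ _ _ x(2) y(2) xy(2) jv pcq(1) S(8) pcq(2,3) xA yA])
  qed
  show ?thesis using side_12 build[of a b] build[of b a] Eab by blast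
qed

end

section \<open>The top entries of the gamma vector\<close>

lemma pderiv_sum: "pderiv (\<Sum>x\<in>A. f x) = (\<Sum>x\<in>A. pderiv (f x))"
  by (induction A rule: infinite_finite_induct) (auto simp: pderiv_add)

context ugraph
begin

text \<open>A face with k vertices is counted once in the link of each of them, which matches the
  factor k in the derivative of t^k.\<close>

lemma pderiv_fpoly:
  assumes "finite U"
  shows "pderiv (fpoly U) = (\<Sum>v\<in>U. fpoly (nb U v))"
proof -
  have fin: "finite (cliques U)" using finite_cliques[OF assms] .
  have "pderiv (fpoly U) = (\<Sum>f\<in>cliques U. pderiv (monom 1 (card f)))"
    by (simp add: fpoly_def pderiv_sum)
  also have "\<dots> = (\<Sum>f\<in>cliques U. \<Sum>v\<in>U. if v \<in> f then monom 1 (card f - 1) else 0)"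
  proof (intro sum.cong refl)
    fix f assume f: "f \<in> cliques U"
    then have "f \<subseteq> U" by (simp add: cliques_def)
    then have "{v \<in> U. v \<in> f} = f" by blast
    then have "(\<Sum>v\<in>U. if v \<in> f then monom (1::int) (card f - 1) else 0) = of_nat (card f) * monom 1 (card f - 1)"
      using assms by (simp add: sum.If_cases Int_def)
    also have "\<dots> = pderiv (monom 1 (card f))"
      by (simp add: pderiv_monom of_nat_poly smult_monom)
    finally show "pderiv (monom 1 (card f)) = (\<Sum>v\<in>U. if v \<in> f then monom (1::int) (card f - 1) else 0)" ..
  qed
  also have "\<dots> = (\<Sum>v\<in>U. \<Sum>f\<in>cliques U. if v \<in> f then monom 1 (card f - 1) else 0)"
    by (rule sum.swap)
  also have "\<dots> = (\<Sum>v\<in>U. fpoly (nb U v))"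
  proof (intro sum.cong refl)
    fix v assume v: "v \<in> U"
    have eq: "{f \<in> cliques U. v \<in> f} = insert v ` cliques (nb U v)"
    proof -
      have "v \<in> f" if "f \<in> insert v ` cliques (nb U v)" for f using that by blast
      moreover have "v \<notin> f" if "f \<in> cliques (U - {v})" for f using that by (auto simp: cliques_def)
      ultimately show ?thesis unfolding cliques_insert[OF v] by blast
    qed
    have g: "v \<notin> g" "finite g" if "g \<in> cliques (nb U v)" for g
      using that by (auto simp: cliques_def nb_def irrefl)
    have inj: "inj_on (insert v) (cliques (nb U v))"
      by (intro inj_onI) (metis insert_ident g(1))
    have "(\<Sum>f\<in>cliques U. if v \<in> f then monom (1::int) (card f - 1) else 0) =
        (\<Sum>f\<in>{f \<in> cliques U. v \<in> f}. monom 1 (card f - 1))"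
      using fin by (simp add: sum.If_cases Int_def)
    also have "\<dots> = (\<Sum>g\<in>cliques (nb U v). monom 1 (card (insert v g) - 1))"
      unfolding eq by (subst sum.reindex[OF inj]) simp
    also have "\<dots> = fpoly (nb U v)"
      unfolding fpoly_def using g by (intro sum.cong refl) simp
    finally show "(\<Sum>f\<in>cliques U. if v \<in> f then monom (1::int) (card f - 1) else 0) = fpoly (nb U v)" .
  qed
  finally show ?thesis .
qed

text \<open>The Dehn-Sommerville relations. By induction on the links both sides have the same
  derivative; the constant is compared at 0, where the claim is the Euler relation.\<close>

lemma fpoly_symmetric:
  "sph d U \<Longrightarrow> fpoly U \<circ>\<^sub>p [:-1,-1:] = smult ((-1) ^ d) (fpoly U)"
proof (induction d arbitrary: U)
  case 0
  then show ?case by (simp add: fpoly_empty pcompose_1)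
next
  case (Suc d)
  have fin: "finite U" using Suc.prems by simp
  have IH: "fpoly (nb U v) \<circ>\<^sub>p [:-1,-1:] = smult ((-1) ^ d) (fpoly (nb U v))" if "v \<in> U" for v
    using Suc that by simp
  define q where "q = fpoly U \<circ>\<^sub>p [:-1,-1:] - smult ((-1) ^ Suc d) (fpoly U)"
  have comp: "(\<Sum>v\<in>U. fpoly (nb U v)) \<circ>\<^sub>p [:-1,-1:] = smult ((-1) ^ d) (\<Sum>v\<in>U. fpoly (nb U v))"
  proof -
    have "(\<Sum>v\<in>U. fpoly (nb U v)) \<circ>\<^sub>p [:-1,-1:] = (\<Sum>v\<in>U. fpoly (nb U v) \<circ>\<^sub>p [:-1,-1:])"
      by (rule pcompose_sum)
    also have "\<dots> = (\<Sum>v\<in>U. [:(-1) ^ d:] * fpoly (nb U v))"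
      using IH by (intro sum.cong refl) simp
    also have "\<dots> = [:(-1) ^ d:] * (\<Sum>v\<in>U. fpoly (nb U v))" by (rule sum_distrib_left[symmetric])
    finally show ?thesis by simp
  qed
  have "pderiv q = 0"
    unfolding q_def pderiv_diff pderiv_pcompose pderiv_smult pderiv_fpoly[OF fin] comp
    by (simp add: pderiv_pCons)
  then obtain c where c: "q = [:c:]" using pderiv_iszero by blast
  have "poly q 0 = 0"
    using sph_euler[OF Suc.prems] poly_fpoly_0[OF fin] by (simp add: q_def poly_pcompose)
  then have "c = 0" unfolding c by simp
  then have "q = 0" using c by simp
  then show ?case unfolding q_def by (simp only: right_minus_eq)
qed

lemma degree_fpoly:
  assumes "sph d U"
  shows "degree (fpoly U) \<le> d"
  unfolding fpoly_def
proof (rule degree_sum_le)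
  show "finite (cliques U)" using finite_cliques[OF sph_finite[OF assms]] .
  fix f assume "f \<in> cliques U"
  then show "degree (monom (1::int) (card f)) \<le> d"
    using clique_card_le[OF assms] degree_monom_le order.trans by blast
qed

lemma sph_has_gamma:
  assumes "sph d U"
  shows "\<exists>g. has_gamma d (fpoly U) g"
proof (rule has_gamma_exists[OF degree_fpoly[OF assms]])
  fix t :: int
  have "poly (fpoly U) (-1-t) = poly (fpoly U \<circ>\<^sub>p [:-1,-1:]) t" by (simp add: poly_pcompose)
  then show "poly (fpoly U) (-1-t) = (-1) ^ d * poly (fpoly U) t"
    unfolding fpoly_symmetric[OF assms] by simp
qed

lemma coeff_fpoly_1:
  assumes "finite U"
  shows "coeff (fpoly U) 1 = int (card U)"
proof -
  have "coeff (fpoly U) 1 = coeff (pderiv (fpoly U)) 0" by (simp add: coeff_pderiv)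
  also have "\<dots> = (\<Sum>v\<in>U. coeff (fpoly (nb U v)) 0)"
    by (simp add: pderiv_fpoly[OF assms] coeff_sum)
  also have "\<dots> = (\<Sum>v\<in>U. 1)"
    using assms by (intro sum.cong refl) (simp add: poly_fpoly_0 nb_def flip: poly_0_coeff_0)
  finally show ?thesis by simp
qed

lemma gamma_0_1:
  assumes "sph d U" "has_gamma d (fpoly U) g"
  shows "g 0 = 1" "g 1 = int (card U) - 2 * int d"
proof -
  have fin: "finite U" using sph_finite[OF assms(1)] .
  have "poly (fpoly U) 0 = g 0"
    using assms(2) by (simp add: has_gamma_def poly_gexp_0)
  then show g0: "g 0 = 1" using poly_fpoly_0[OF fin] by simp
  show "g 1 = int (card U) - 2 * int d"
    using has_gamma_coeff1[OF assms(2)] coeff_fpoly_1[OF fin] g0 by simp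
qed

section \<open>Induction over suspensions and pentagons\<close>

lemma unsuspended_cases:
  assumes "sph d U"
  obtains "unsuspended U" | v w where "v \<in> U" "nn U v = {w}"
proof (cases "unsuspended U")
  case False
  then obtain v where v: "v \<in> U" "card (nn U v) < 2" by (auto simp: unsuspended_def not_le)
  moreover have "card (nn U v) > 0"
    using nn_nonempty[OF assms v(1)] sph_finite[OF assms] by (simp add: card_gt_0_iff nn_def)
  ultimately have "card (nn U v) = 1" by simp
  then obtain w where "nn U v = {w}" by (auto simp: card_1_singleton_iff)
  then show ?thesis using v that by blast
qed

text \<open>Each pentagon multiplies the \<gamma>-polynomial by 1 + t, as
  \<open>fpoly_pentagon\<close> shows.\<close>

lemma C5_join_gamma:
  "sph d U \<Longrightarrow> C5_join l U \<Longrightarrow> has_gamma d (fpoly U) (\<lambda>j. int (l choose j))"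
proof (induction l arbitrary: d U)
  case 0
  then have "d = 0" using sph_nonempty by auto
  then show ?case using has_gamma_1 0
    by (auto simp: fpoly_empty elim!: has_gamma_ext)
next
  case (Suc l)
  obtain A Z where AZ: "U = A \<union> Z" "ring 5 A" "joined A Z" "C5_join l Z" using Suc.prems(2) by auto
  have d: "d = Suc (Suc (d - 2))" and sZ: "sph (d - 2) Z"
    using sph_pentagon_rest[OF Suc.prems(1) AZ(1-3)] by auto
  have I: "has_gamma (d - 2) (fpoly Z) (\<lambda>j. int (l choose j))" using Suc.IH[OF sZ AZ(4)] .
  have "has_gamma (Suc (Suc (d - 2))) (fpoly U)
      (\<lambda>j. int (l choose j) + case_nat 0 (\<lambda>j. int (l choose j)) j)"
    unfolding fpoly_pentagon[OF Suc.prems(1) AZ(1-3)]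
    by (intro has_gamma_add has_gamma_susp has_gamma_shift I)
  then show ?case unfolding d[symmetric]
    by (rule has_gamma_ext) (auto split: nat.splits)
qed

lemma suspended_step:
  assumes "sph d U" "v \<in> U" "nn U v = {w}" "card U = 2 * d + l" "has_gamma d (fpoly U) g"
  shows "\<exists>d'. d = Suc d' \<and> sph d' (nb U v) \<and> card (nb U v) = 2 * d' + l \<and>
    has_gamma d' (fpoly (nb U v)) g"
proof -
  obtain d' where d: "d = Suc d'" using sph_pos[OF assms(1,2)] gr0_implies_Suc by blast
  have s: "sph d' (nb U v)" using sph_nb[OF assms(1,2)] d by simp
  obtain g' where g': "has_gamma d' (fpoly (nb U v)) g'" using sph_has_gamma[OF s] by blast
  have "has_gamma d (fpoly U) g'"
    unfolding fpoly_susp[OF assms(1-3)] d using g' by (rule has_gamma_susp)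
  then have "g' = g" using has_gamma_unique assms(5) by blast
  moreover have "card (nb U v) = 2 * d' + l"
    using card_nb[OF sph_finite[OF assms(1)] assms(2)] assms(3,4) d by simp
  ultimately show ?thesis using d s g' by blast
qed

text \<open>Suspensions change neither \<open>g\<close> nor \<open>l\<close>. Without them,
  \<open>g l\<close> vanishes by degree if d < 2l, and otherwise the sphere is a join of l
  pentagons. The premise d \<le> 2l separates such joins from their suspensions.\<close>

lemma top_gamma:
  assumes "sph d U" "card U = 2 * d + l" "has_gamma d (fpoly U) g"
  shows "(\<forall>j>l. g j = 0) \<and> g l \<in> {0, 1} \<and> (g l = 1 \<longrightarrow> d \<le> 2 * l \<longrightarrow> C5_join l U)"
  using assms
proof (induction d arbitrary: U)
  case 0
  then have "U = {}" "l = 0" by auto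
  moreover have "g j = 0" if "j > 0" for j using has_gamma_zero[OF 0(3), of j] that by simp
  moreover have "g 0 = 1" using gamma_0_1[OF 0(1,3)] by simp
  ultimately show ?case by auto
next
  case (Suc d)
  from Suc.prems(1) show ?case
  proof (rule unsuspended_cases)
    assume un: "unsuspended U"
    show ?thesis
    proof (cases "Suc d < 2 * l")
      case True
      then have "g j = 0" if "j \<ge> l" for j using has_gamma_zero[OF Suc.prems(3), of j] that by simp
      then show ?thesis by auto
    next
      case False
      then have "C5_join l U" using C5_join_if_tight[OF Suc.prems(1) un Suc.prems(2)] by simp
      moreover from this have "g = (\<lambda>j. int (l choose j))"
        using C5_join_gamma[OF Suc.prems(1)] has_gamma_unique[OF Suc.prems(3)] by blast
      ultimately show ?thesis by (simp add: binomial_eq_0)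
    qed
  next
    fix v w assume vw: "v \<in> U" "nn U v = {w}"
    have s: "sph d (nb U v)" "card (nb U v) = 2 * d + l" "has_gamma d (fpoly (nb U v)) g"
      using suspended_step[OF Suc.prems(1) vw Suc.prems(2,3)] by auto
    \<comment> \<open>The link has the same \<open>g\<close> in smaller dimension, so in this range
      the degree bound makes \<open>g l\<close> vanish and the implication from
      \<open>g l = 1\<close> is vacuous.\<close>
    have "g l = 0" if "Suc d \<le> 2 * l" using has_gamma_zero[OF s(3), of l] that by simp
    then show ?thesis using Suc.IH[OF s] by auto
  qed
qed

lemma first_config_extend:
  assumes "U = A \<union> L" "ring 5 A" "joined A L" "first_config l L" "l \<ge> 2"
  shows "first_config (Suc l) U"
proof -
  obtain B Z where B: "L = B \<union> Z" "ring 6 B" "joined B Z" "C5_join (l - 2) Z"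
    using assms(4) by (auto simp: first_config_def)
  have "joined A Z" "joined B (A \<union> Z)" using B assms(3) sym by (auto simp: joined_def)
  moreover have "Suc l - 2 = Suc (l - 2)" using assms(5) by simp
  ultimately have "C5_join (Suc l - 2) (A \<union> Z)" using B(4) assms(2) by auto
  moreover have "U = B \<union> (A \<union> Z)" using assms(1) B(1) by blast
  ultimately show ?thesis using B(2) \<open>joined B (A \<union> Z)\<close> unfolding first_config_def by blast
qed

lemma second_config_extend:
  assumes "U = A' \<union> L" "ring 5 A'" "joined A' L" "second_config l L" "l \<ge> 2"
  shows "second_config (Suc l) U"
proof -
  obtain v a b A Z p c q where S: "L = {v, a, b} \<union> A \<union> Z" "ring 5 A" "C5_join (l - 2) Z"
    "joined ({v, a, b} \<union> A) Z" "v \<notin> A" "a \<notin> A" "b \<notin> A" "v \<noteq> a" "v \<noteq> b" "\<not> E v a" "\<not> E v b" "E a b"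
    "joined {v} A" "{p, c, q} \<subseteq> A" "p \<noteq> q" "E c p" "E c q"
    "\<forall>x\<in>A. E a x \<longleftrightarrow> x \<in> {p, c, q}" "\<forall>x\<in>A. E b x \<longleftrightarrow> x \<noteq> c"
    using assms(4) unfolding second_config_def by (elim exE conjE) (rule that; assumption)
  have j: "joined A' Z" "joined ({v, a, b} \<union> A) (A' \<union> Z)"
    using S(4) joined_sym[OF assms(3)] assms(3) unfolding S(1) by (auto simp: joined_def)
  have "Suc l - 2 = Suc (l - 2)" using assms(5) by simp
  then have C: "C5_join (Suc l - 2) (A' \<union> Z)" using S(3) assms(2) j(1) by auto
  have U: "U = {v, a, b} \<union> A \<union> (A' \<union> Z)" using assms(1) S(1) by blast
  show ?thesis by (rule second_configI[OF U S(2) C j(2) S(5-19)])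
qed

lemma pentagon_gamma:
  assumes "sph d U" "U = A \<union> L" "ring 5 A" "joined A L" "has_gamma d (fpoly U) g"
  shows "\<exists>h. has_gamma (d - 2) (fpoly L) h \<and> g = (\<lambda>j. h j + case_nat 0 h j)"
proof -
  have d: "d = Suc (Suc (d - 2))" and sL: "sph (d - 2) L"
    using sph_pentagon_rest[OF assms(1-4)] by auto
  obtain h where h: "has_gamma (d - 2) (fpoly L) h" using sph_has_gamma[OF sL] by blast
  have "has_gamma (Suc (Suc (d - 2))) (fpoly U) (\<lambda>j. h j + case_nat 0 h j)"
    unfolding fpoly_pentagon[OF assms(1-4)]
    by (intro has_gamma_add has_gamma_susp has_gamma_shift h)
  then show ?thesis using h has_gamma_unique[OF assms(5)] d by metis
qed

lemma unsuspended_gamma: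
  assumes "l \<ge> 2" "sph d U" "unsuspended U" "card U = 2 * d + l" "has_gamma d (fpoly U) g"
  shows "g l = 1 \<and> g (l - 1) = int l \<or>
    g l = 0 \<and> g (l - 1) \<in> {0, 1, 2} \<and> (g (l - 1) = 2 \<longrightarrow> first_config l U \<or> second_config l U)"
  using assms
proof (induction l arbitrary: d U g)
  case (Suc k)
  define l where "l = Suc k"
  have l: "l \<ge> 2" "k = l - 1" using Suc.prems(1) by (auto simp: l_def)
  note sU = Suc.prems(2) and un = Suc.prems(3) and cU = Suc.prems(4)[folded l_def] and g = Suc.prems(5)
  have fin: "finite U" using sph_finite[OF sU] .
  have goal: ?case if "g l = 1 \<and> g (l - 1) = int l \<or>
    g l = 0 \<and> g (l - 1) \<in> {0, 1, 2} \<and> (g (l - 1) = 2 \<longrightarrow> first_config l U \<or> second_config l U)"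
    using that unfolding l_def .
  show ?case
  proof (rule goal, cases "2 * l \<le> d")
    case True
    then have "C5_join l U" using C5_join_if_tight[OF sU un cU] by simp
    then have "g = (\<lambda>j. int (l choose j))"
      using C5_join_gamma[OF sU] has_gamma_unique[OF g] by blast
    moreover have "l choose (l - 1) = l" using l by (cases l) auto
    ultimately show "g l = 1 \<and> g (l - 1) = int l \<or> g l = 0 \<and> g (l - 1) \<in> {0, 1, 2} \<and>
        (g (l - 1) = 2 \<longrightarrow> first_config l U \<or> second_config l U)" by simp
  next
    case d2l: False
    have gl: "g l = 0" using has_gamma_zero[OF g, of l] d2l by simp
    have "g (l - 1) \<in> {0, 1, 2} \<and> (g (l - 1) = 2 \<longrightarrow> first_config l U \<or> second_config l U)"
    proof (cases "2 * l \<le> d + 2")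
      case False
      then have "g (l - 1) = 0" using has_gamma_zero[OF g, of "l - 1"] by simp
      then show ?thesis by simp
    next
      case dl: True
      show ?thesis
      proof (cases "\<forall>v\<in>U. card (nn U v) \<ge> 3")
        case True
        then have "d = 2" "l = 2" using no_nn_pair[OF sU _ cU l(1) dl] by auto
        then have "ring 6 U" "g (l - 1) = 2" using hexagon sU cU gamma_0_1[OF sU g] by auto
        moreover have "C5_join (l - 2) {}" "joined U {}" using \<open>l = 2\<close> by (auto simp: joined_def)
        ultimately have "first_config l U" unfolding first_config_def
          by (intro exI[of _ U] exI[of _ "{}"]) simp
        then show ?thesis using \<open>g (l - 1) = 2\<close> by simp
      next
        case False
        then obtain v where v: "v \<in> U" "card (nn U v) < 3" by auto
        moreover have "card (nn U v) \<ge> 2" using un v(1) by (simp add: unsuspended_def)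
        ultimately have nn2: "card (nn U v) = 2" by simp
        then obtain a b where ab: "nn U v = {a, b}" "a \<noteq> b" by (auto simp: card_2_iff)
        then have abU: "a \<in> U" "b \<in> U" by (auto simp: nn_def)
        have nnab: "card (nn U a) \<ge> 2" "card (nn U b) \<ge> 2" using un abU by (auto simp: unsuspended_def)
        have Eab: "E a b" using nn_pair_adj[OF sU v(1) ab] .
        then have b: "b \<in> nb U a" using abU by (simp add: nb_def)
        define L where "L = nb (nb U a) b"
        have "d - 1 > 0" using sph_pos[OF sph_nb[OF sU abU(1)] b] .
        then have d2: "d \<ge> 2" by simp
        have "sph (d - 1 - 1) L" unfolding L_def using sph_nb[OF sph_nb[OF sU abU(1)] b] .
        then have sL: "sph (d - 2) L" by (simp add: numeral_2_eq_2)
        show ?thesis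
        proof (cases "card U \<le> card L + 5")
          case True
          then obtain A where A: "U = A \<union> L" "ring 5 A" "joined A L"
            using pentagon_split[OF sU v(1) ab nnab] unfolding L_def by blast
          have "finite L" using fin by (auto simp: L_def nb_def)
          then have "card U = 5 + card L"
            using ring_finite_card[OF A(2)] joined_disjoint[OF A(3)]
            by (subst A(1)) (simp add: card_Un_disjoint)
          then have cL: "card L = 2 * (d - 2) + (l - 1)" using cU d2 l by simp
          have unL: "unsuspended L" using unsuspended_joined[OF A(1,3) un] .
          \<comment> \<open>For l = 2 only d = 2 and d = 3 are left, where \<open>L\<close> would be
            empty with one vertex, or a sphere of dimension 0 with three.\<close>
          have l3: "l \<ge> 3"
          proof (rule ccontr)
            assume "\<not> l \<ge> 3"
            then have "d = 2 \<or> d = 3" "l = 2" using l d2l d2 by auto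
            then show False
            proof (elim disjE)
              assume "d = 2"
              then show False using sL cL \<open>l = 2\<close> by simp
            next
              assume "d = 3"
              then have "sph (Suc 0) L" using sL by simp
              then show False using sph_1_card cL \<open>d = 3\<close> \<open>l = 2\<close> by fastforce
            qed
          qed
          obtain h where h: "has_gamma (d - 2) (fpoly L) h" "g = (\<lambda>j. h j + case_nat 0 h j)"
            using pentagon_gamma[OF sU A g] by blast
          \<comment> \<open>This follows from d - 2 < 2(l - 1). It removes one summand of
            \<open>g (l - 1)\<close> and excludes the alternative \<open>h k = 1\<close> in the
            induction hypothesis for \<open>k\<close>, which is l - 1.\<close>
          have h1: "h (l - 1) = 0" using has_gamma_zero[OF h(1), of "l - 1"] d2l d2 l by simp
          have "l - 1 = Suc (l - 2)" using l by simp
          then have g1: "g (l - 1) = h (l - 2)" using h(2) h1 by simp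
          have k2: "2 \<le> k" using l3 l by simp
          have "k - 1 = l - 2" using l by simp
          then have "h (l - 2) \<in> {0, 1, 2} \<and> (h (l - 2) = 2 \<longrightarrow> first_config k L \<or> second_config k L)"
            using Suc.IH[OF k2 sL unL _ h(1)] cL h1 l by auto
          moreover have "first_config k L \<or> second_config k L \<Longrightarrow> first_config l U \<or> second_config l U"
            unfolding l_def using first_config_extend[OF A _ k2] second_config_extend[OF A _ k2] by blast
          ultimately show ?thesis unfolding g1 by blast
        next
          case False
          define N where "N = nb U v"
          have sN: "sph (d - 1) N" unfolding N_def using sph_nb[OF sU v(1)] .
          have cN: "card N = 2 * (d - 1) + (l - 1)"
            using card_nb[OF fin v(1)] nn2 cU d2 l by (simp add: N_def)
          obtain m where m: "card L = 2 * (d - 2) + m"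
            using card_sph_ge[OF sL] le_Suc_ex by blast
          \<comment> \<open>As the bound for splitting off a pentagon fails, the entry of index l -
            2 is the top one for \<open>L\<close> or beyond it, so \<open>top_gamma\<close> bounds
            it by 1.\<close>
          have ml: "m \<le> l - 2" using False m cU d2 by simp
          obtain gN where gN: "has_gamma (d - 1) (fpoly N) gN" using sph_has_gamma[OF sN] by blast
          obtain gL where gL: "has_gamma (d - 2) (fpoly L) gL" using sph_has_gamma[OF sL] by blast
          have dd: "Suc (d - 1) = d" "Suc (Suc (d - 2)) = d" using d2 by auto
          have "has_gamma d (fpoly U) (\<lambda>j. gN j + case_nat 0 gL j)"
            unfolding fpoly_nn_pair[OF sU v(1) ab] N_def[symmetric] L_def[symmetric]
            using has_gamma_susp[OF gN] has_gamma_shift[OF gL] unfolding dd by (rule has_gamma_add)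
          then have "g = (\<lambda>j. gN j + case_nat 0 gL j)" using has_gamma_unique[OF g] by blast
          moreover have "l - 1 = Suc (l - 2)" using l by simp
          ultimately have g1: "g (l - 1) = gN (l - 1) + gL (l - 2)" by simp
          have tN: "gN (l - 1) \<in> {0, 1}" "gN (l - 1) = 1 \<Longrightarrow> d - 1 \<le> 2 * (l - 1) \<Longrightarrow> C5_join (l - 1) N"
            using top_gamma[OF sN cN gN] by auto
          have tL: "gL (l - 2) \<in> {0, 1}"
            using top_gamma[OF sL m gL] ml by (cases "m = l - 2") auto
          have "second_config l U" if "g (l - 1) = 2"
          proof -
            have 1: "gN (l - 1) = 1" using that g1 tN(1) tL by auto
            \<comment> \<open>A nonzero entry of index l - 1 for \<open>N\<close> needs d - 1 \<ge>
              2(l - 1), and d < 2l in the present case.\<close>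
            then have "d = 2 * l - 1" using has_gamma_zero[OF gN, of "l - 1"] d2l l by fastforce
            moreover from this have "C5_join (l - 1) (nb U v)" using tN(2)[OF 1] l by (simp add: N_def)
            ultimately show ?thesis using second_config_if[OF sU v(1) ab l(1)] by simp
          qed
          then show ?thesis using g1 tN(1) tL by auto
        qed
      qed
    qed
    then show "g l = 1 \<and> g (l - 1) = int l \<or> g l = 0 \<and> g (l - 1) \<in> {0, 1, 2} \<and>
        (g (l - 1) = 2 \<longrightarrow> first_config l U \<or> second_config l U)" using gl by blast
  qed
qed simp

end

section \<open>Face polynomials of joins, links and subdivisions\<close>

lemma simplicial_complexD:
  assumes "simplicial_complex X"
  shows "finite (\<Union>X)" "{} \<in> X" "f \<in> X \<Longrightarrow> g \<subseteq> f \<Longrightarrow> g \<in> X" "finite X" "f \<in> X \<Longrightarrow> finite f"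
proof -
  show *: "finite (\<Union>X)" "{} \<in> X" "f \<in> X \<Longrightarrow> g \<subseteq> f \<Longrightarrow> g \<in> X"
    using assms by (auto simp: simplicial_complex_def)
  show "finite X" using *(1) by (rule finite_UnionD)
  show "f \<in> X \<Longrightarrow> finite f" using *(1) by (meson Union_upper finite_subset)
qed

lemma Union_join:
  assumes "{} \<in> A" "{} \<in> B"
  shows "\<Union>(join A B) = \<Union>A \<union> \<Union>B"
proof
  show "\<Union>(join A B) \<subseteq> \<Union>A \<union> \<Union>B" by (auto simp: join_def)
  have "f \<union> {} \<in> join A B" if "f \<in> A" for f using that assms(2) unfolding join_def by blast
  moreover have "{} \<union> f \<in> join A B" if "f \<in> B" for f using that assms(1) unfolding join_def by blast
  ultimately show "\<Union>A \<union> \<Union>B \<subseteq> \<Union>(join A B)" by auto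
qed

lemma Union_relabel: "\<Union>(relabel \<phi> X) = \<phi> ` \<Union>X"
  by (auto simp: relabel_def)

lemma in_join_iff:
  assumes "\<Union>A \<inter> \<Union>B = {}"
  shows "x \<in> join A B \<longleftrightarrow> x \<subseteq> \<Union>A \<union> \<Union>B \<and> x \<inter> \<Union>A \<in> A \<and> x \<inter> \<Union>B \<in> B"
proof
  assume "x \<in> join A B"
  then obtain f g where fg: "x = f \<union> g" "f \<in> A" "g \<in> B" by (auto simp: join_def)
  then have "x \<inter> \<Union>A = f" "x \<inter> \<Union>B = g" using assms by blast+
  then show "x \<subseteq> \<Union>A \<union> \<Union>B \<and> x \<inter> \<Union>A \<in> A \<and> x \<inter> \<Union>B \<in> B" using fg by auto
next
  assume *: "x \<subseteq> \<Union>A \<union> \<Union>B \<and> x \<inter> \<Union>A \<in> A \<and> x \<inter> \<Union>B \<in> B"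
  then have "x = x \<inter> \<Union>A \<union> x \<inter> \<Union>B" by blast
  then show "x \<in> join A B" using * unfolding join_def by blast
qed

lemma simplicial_complex_join:
  assumes "simplicial_complex A" "simplicial_complex B" "\<Union>A \<inter> \<Union>B = {}"
  shows "simplicial_complex (join A B)"
  unfolding simplicial_complex_def
proof (intro conjI ballI allI impI)
  show "finite (\<Union>(join A B))"
    using simplicial_complexD[OF assms(1)] simplicial_complexD[OF assms(2)] by (simp add: Union_join)
  show "{} \<in> join A B"
    using simplicial_complexD(2)[OF assms(1)] simplicial_complexD(2)[OF assms(2)]
    by (simp add: in_join_iff[OF assms(3)])
  fix f g assume "f \<in> join A B" "g \<subseteq> f"
  then have *: "g \<subseteq> \<Union>A \<union> \<Union>B" "g \<inter> \<Union>A \<subseteq> f \<inter> \<Union>A" "g \<inter> \<Union>B \<subseteq> f \<inter> \<Union>B"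
    "f \<inter> \<Union>A \<in> A" "f \<inter> \<Union>B \<in> B"
    unfolding in_join_iff[OF assms(3)] by auto
  show "g \<in> join A B"
    unfolding in_join_iff[OF assms(3)]
    using *(1) simplicial_complexD(3)[OF assms(1) *(4,2)] simplicial_complexD(3)[OF assms(2) *(5,3)] by simp
qed

lemma simplicial_complex_relabel:
  assumes "simplicial_complex X"
  shows "simplicial_complex (relabel \<phi> X)"
  unfolding simplicial_complex_def
proof (intro conjI ballI allI impI)
  show "finite (\<Union>(relabel \<phi> X))" using simplicial_complexD(1)[OF assms] by (simp add: Union_relabel)
  show "{} \<in> relabel \<phi> X" using simplicial_complexD(2)[OF assms] by (auto simp: relabel_def)
  fix f g assume "f \<in> relabel \<phi> X" "g \<subseteq> f"
  then obtain h where "h \<in> X" "g \<subseteq> \<phi> ` h" by (auto simp: relabel_def)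
  then obtain k where "k \<subseteq> h" "g = \<phi> ` k" by (auto simp: subset_image_iff)
  then show "g \<in> relabel \<phi> X" using simplicial_complexD(3)[OF assms \<open>h \<in> X\<close>] by (auto simp: relabel_def)
qed

lemma face_poly_join:
  assumes "simplicial_complex A" "simplicial_complex B" "\<Union>A \<inter> \<Union>B = {}"
  shows "face_poly (join A B) = face_poly A * face_poly B"
proof -
  have j: "join A B = (\<lambda>(f, g). f \<union> g) ` (A \<times> B)" by (auto simp: join_def)
  have inj: "inj_on (\<lambda>(f, g). f \<union> g) (A \<times> B)"
  proof (rule inj_onI, clarify)
    fix f g f' g' assume *: "f \<in> A" "g \<in> B" "f' \<in> A" "g' \<in> B" "f \<union> g = f' \<union> g'"
    have "f = (f \<union> g) \<inter> \<Union>A" "f' = (f' \<union> g') \<inter> \<Union>A" "g = (f \<union> g) \<inter> \<Union>B" "g' = (f' \<union> g') \<inter> \<Union>B"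
      using *(1-4) assms(3) by blast+
    then show "f = f' \<and> g = g'" using *(5) by metis
  qed
  have "face_poly (join A B) = (\<Sum>(f, g)\<in>A \<times> B. monom 1 (card (f \<union> g)))"
    unfolding face_poly_def j by (subst sum.reindex[OF inj]) (simp add: case_prod_unfold)
  also have "\<dots> = (\<Sum>(f, g)\<in>A \<times> B. monom 1 (card f) * monom 1 (card g))"
  proof (rule sum.cong[OF refl], clarify)
    fix f g assume fg: "f \<in> A" "g \<in> B"
    have "f \<inter> g = {}" using fg assms(3) by blast
    then have "card (f \<union> g) = card f + card g"
      using simplicial_complexD(5)[OF assms(1) fg(1)] simplicial_complexD(5)[OF assms(2) fg(2)]
      by (rule card_Un_disjoint[rotated 2])
    then show "monom (1::int) (card (f \<union> g)) = monom 1 (card f) * monom 1 (card g)"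
      by (simp add: mult_monom)
  qed
  also have "\<dots> = face_poly A * face_poly B"
    unfolding face_poly_def sum_product sum.cartesian_product ..
  finally show ?thesis .
qed

lemma inj_on_image_sets: "inj_on \<phi> (\<Union>X) \<Longrightarrow> inj_on (\<lambda>f. \<phi> ` f) X"
  by (rule inj_onI) (meson Union_upper inj_on_image_eq_iff)

lemma face_poly_relabel:
  assumes "inj_on \<phi> (\<Union>X)"
  shows "face_poly (relabel \<phi> X) = face_poly X"
proof -
  have "card (\<phi> ` f) = card f" if "f \<in> X" for f
    using assms that by (intro card_image) (meson Union_upper inj_on_subset)
  then show ?thesis
    unfolding face_poly_def relabel_def sum.reindex[OF inj_on_image_sets[OF assms]]
    by (intro sum.cong) auto
qed

lemma link_empty: "link X {} = X" by (auto simp: link_def)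

lemma link_join:
  assumes "simplicial_complex A" "simplicial_complex B" "\<Union>A \<inter> \<Union>B = {}" "f \<in> A" "g \<in> B"
  shows "link (join A B) (f \<union> g) = join (link A f) (link B g)"
proof
  show "link (join A B) (f \<union> g) \<subseteq> join (link A f) (link B g)"
  proof
    fix x assume "x \<in> link (join A B) (f \<union> g)"
    then have x: "x \<in> join A B" "x \<inter> (f \<union> g) = {}" "x \<union> (f \<union> g) \<in> join A B" by (auto simp: link_def)
    have eq: "(x \<union> (f \<union> g)) \<inter> \<Union>A = x \<inter> \<Union>A \<union> f" "(x \<union> (f \<union> g)) \<inter> \<Union>B = x \<inter> \<Union>B \<union> g"
      using assms(3-5) by blast+
    have "x \<inter> \<Union>A \<in> link A f" "x \<inter> \<Union>B \<in> link B g"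
      using x eq unfolding in_join_iff[OF assms(3)] link_def by auto
    moreover have "x = x \<inter> \<Union>A \<union> x \<inter> \<Union>B" using x(1) unfolding in_join_iff[OF assms(3)] by blast
    ultimately show "x \<in> join (link A f) (link B g)" unfolding join_def by blast
  qed
  show "join (link A f) (link B g) \<subseteq> link (join A B) (f \<union> g)"
  proof
    fix x assume "x \<in> join (link A f) (link B g)"
    then obtain h k where hk: "x = h \<union> k" "h \<in> A" "h \<inter> f = {}" "h \<union> f \<in> A" "k \<in> B" "k \<inter> g = {}" "k \<union> g \<in> B"
      by (auto simp: join_def link_def)
    have "x \<in> join A B" using hk by (auto simp: join_def)
    moreover have "x \<inter> (f \<union> g) = {}" using hk assms(3-5) by blast
    moreover have "x \<union> (f \<union> g) = (h \<union> f) \<union> (k \<union> g)" using hk(1) by blast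
    then have "x \<union> (f \<union> g) \<in> join A B" using hk(4,7) unfolding join_def by blast
    ultimately show "x \<in> link (join A B) (f \<union> g)" by (simp add: link_def)
  qed
qed

lemma link_relabel:
  fixes \<phi> :: "'a \<Rightarrow> 'b"
  assumes "inj_on \<phi> (\<Union>X)" "f \<in> X"
  shows "link (relabel \<phi> X) (\<phi> ` f) = relabel \<phi> (link X f)"
proof -
  have sub: "h \<subseteq> \<Union>X" if "h \<in> X" for h using that by blast
  have "\<phi> ` g \<inter> \<phi> ` f = {} \<longleftrightarrow> g \<inter> f = {}" if "g \<in> X" for g
    using inj_on_image_Int[OF assms(1) sub[OF that] sub[OF assms(2)]] by (metis image_is_empty)
  moreover have "\<phi> ` g \<union> \<phi> ` f \<in> relabel \<phi> X \<longleftrightarrow> g \<union> f \<in> X" if "g \<in> X" for g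
  proof
    assume "\<phi> ` g \<union> \<phi> ` f \<in> relabel \<phi> X"
    then obtain h where h: "h \<in> X" "\<phi> ` (g \<union> f) = \<phi> ` h" by (auto simp: relabel_def image_Un)
    then have "g \<union> f = h" using inj_on_image_eq_iff[OF assms(1), of "g \<union> f" h] sub that assms(2) by simp
    then show "g \<union> f \<in> X" using h by simp
  next
    assume "g \<union> f \<in> X"
    then show "\<phi> ` g \<union> \<phi> ` f \<in> relabel \<phi> X" unfolding relabel_def by (metis image_Un imageI)
  qed
  ultimately have "{g \<in> X. \<phi> ` g \<inter> \<phi> ` f = {} \<and> \<phi> ` g \<union> \<phi> ` f \<in> relabel \<phi> X} = link X f"
    unfolding link_def by blast
  moreover have "link (relabel \<phi> X) (\<phi> ` f) =
      (\<lambda>g. \<phi> ` g) ` {g \<in> X. \<phi> ` g \<inter> \<phi> ` f = {} \<and> \<phi> ` g \<union> \<phi> ` f \<in> relabel \<phi> X}"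
  proof -
    have "{y \<in> h ` X. P y} = h ` {x \<in> X. P (h x)}" for h :: "'a set \<Rightarrow> 'b set" and P by auto
    from this[of "(`) \<phi>" "\<lambda>g. g \<inter> \<phi> ` f = {} \<and> g \<union> \<phi> ` f \<in> relabel \<phi> X"]
    show ?thesis unfolding link_def relabel_def .
  qed
  ultimately show ?thesis unfolding relabel_def[of \<phi> "link X f"] by simp
qed

lemma simplicial_complex_link:
  assumes "simplicial_complex X" "f \<in> X"
  shows "simplicial_complex (link X f)"
proof -
  have "\<Union>(link X f) \<subseteq> \<Union>X" by (auto simp: link_def)
  then have "finite (\<Union>(link X f))" using simplicial_complexD(1)[OF assms(1)] finite_subset by blast
  moreover have "g \<in> link X f" if "h \<in> link X f" "g \<subseteq> h" for g h
  proof -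
    have "g \<union> f \<subseteq> h \<union> f" "g \<inter> f = {}" "h \<union> f \<in> X" "h \<in> X" using that by (auto simp: link_def)
    then show ?thesis using that(2) simplicial_complexD(3)[OF assms(1)] by (simp add: link_def)
  qed
  moreover have "{} \<in> link X f" using assms simplicial_complexD(2) by (simp add: link_def)
  ultimately show ?thesis unfolding simplicial_complex_def by blast
qed

text \<open>For each face of the link of the edge, its union with \<open>{u, v}\<close> is lost and
  its unions with \<open>{w}\<close>, \<open>{w, u}\<close> and \<open>{w, v}\<close> are gained.
  The balance is t + 2t^2 - t^2.\<close>

lemma face_poly_stellar:
  assumes X: "simplicial_complex X" and e: "{u, v} \<in> X" "u \<noteq> v" and w: "w \<notin> \<Union>X"
  shows "face_poly (stellar_subdivision {u, v} w X) =
    face_poly X + [:0,1,1:] * face_poly (link X {u, v})"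
proof -
  let ?L = "link X {u, v}"
  define R where "R = {g \<in> X. \<not> {u, v} \<subseteq> g}"
  have L: "g \<in> X" "u \<notin> g" "v \<notin> g" "w \<notin> g" "finite g" "{u, v} \<union> g \<in> X" if "g \<in> ?L" for g
    using that w simplicial_complexD(5)[OF X, of g] by (auto simp: link_def Un_commute)
  have uv: "u \<in> \<Union>X" "v \<in> \<Union>X" "w \<noteq> u" "w \<noteq> v" using e w by auto
  have finX: "finite X" using simplicial_complexD(4)[OF X] .
  have finL: "finite ?L" using finX by (auto simp: link_def)
  have part: "(\<Sum>f\<in>(\<lambda>g. h \<union> g) ` ?L. monom (1::int) (card f)) = monom 1 (card h) * face_poly ?L"
    if h: "finite h" "h \<subseteq> {u, v, w}" for h
  proof -
    have dis: "h \<inter> g = {}" if "g \<in> ?L" for g using L[OF that] h(2) by blast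
    have inj: "inj_on (\<lambda>g. h \<union> g) ?L"
    proof (rule inj_onI)
      fix g g' assume *: "g \<in> ?L" "g' \<in> ?L" "h \<union> g = h \<union> g'"
      show "g = g'" using dis[OF *(1)] dis[OF *(2)] *(3) by blast
    qed
    have "card (h \<union> g) = card h + card g" if "g \<in> ?L" for g
      using dis[OF that] L(5)[OF that] h(1) by (simp add: card_Un_disjoint)
    then show ?thesis unfolding sum.reindex[OF inj] face_poly_def sum_distrib_left
      by (intro sum.cong) (auto simp: mult_monom)
  qed
  have Xeq: "X = R \<union> (\<lambda>g. {u, v} \<union> g) ` ?L"
  proof
    show "X \<subseteq> R \<union> (\<lambda>g. {u, v} \<union> g) ` ?L"
    proof
      fix f assume f: "f \<in> X"
      show "f \<in> R \<union> (\<lambda>g. {u, v} \<union> g) ` ?L"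
      proof (cases "{u, v} \<subseteq> f")
        case True
        then have "f = {u, v} \<union> (f - {u, v})" by blast
        moreover have "f - {u, v} \<in> ?L"
        proof -
          have "(f - {u, v}) \<union> {u, v} = f" using True by blast
          then show ?thesis using f simplicial_complexD(3)[OF X f, of "f - {u, v}"] unfolding link_def by auto
        qed
        ultimately show ?thesis by blast
      qed (use f in \<open>simp add: R_def\<close>)
    qed
    show "R \<union> (\<lambda>g. {u, v} \<union> g) ` ?L \<subseteq> X" using L(6) by (auto simp: R_def)
  qed
  have subs: "{h. h \<subset> {u, v}} = {{}, {u}, {v}}" using e(2) by auto
  have Seq: "stellar_subdivision {u, v} w X =
      R \<union> ((\<lambda>g. {w} \<union> g) ` ?L \<union> ((\<lambda>g. {w, u} \<union> g) ` ?L \<union> (\<lambda>g. {w, v} \<union> g) ` ?L))"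
  proof -
    have "{{w} \<union> h \<union> g | h g. h \<subset> {u, v} \<and> g \<in> ?L} =
        {{w} \<union> h \<union> g | h g. h \<in> {{}, {u}, {v}} \<and> g \<in> ?L}" using subs by blast
    also have "\<dots> = (\<lambda>g. {w} \<union> g) ` ?L \<union> ((\<lambda>g. {w, u} \<union> g) ` ?L \<union> (\<lambda>g. {w, v} \<union> g) ` ?L)"
    proof (intro set_eqI iffI)
      fix f assume "f \<in> {{w} \<union> h \<union> g | h g. h \<in> {{}, {u}, {v}} \<and> g \<in> ?L}"
      then obtain h g where "f = {w} \<union> h \<union> g" "h \<in> {{}, {u}, {v}}" "g \<in> ?L" by blast
      then show "f \<in> (\<lambda>g. {w} \<union> g) ` ?L \<union> ((\<lambda>g. {w, u} \<union> g) ` ?L \<union> (\<lambda>g. {w, v} \<union> g) ` ?L)"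
        by auto
    next
      fix f assume "f \<in> (\<lambda>g. {w} \<union> g) ` ?L \<union> ((\<lambda>g. {w, u} \<union> g) ` ?L \<union> (\<lambda>g. {w, v} \<union> g) ` ?L)"
      then obtain g where g: "g \<in> ?L" and "f = {w} \<union> {} \<union> g \<or> f = {w} \<union> {u} \<union> g \<or> f = {w} \<union> {v} \<union> g"
        by auto
      then show "f \<in> {{w} \<union> h \<union> g | h g. h \<in> {{}, {u}, {v}} \<and> g \<in> ?L}" by blast
    qed
    finally show ?thesis unfolding stellar_subdivision_def R_def by simp
  qed
  have w_R: "w \<notin> f" if "f \<in> R" for f using that w by (auto simp: R_def)
  have finR: "finite R" using finX by (simp add: R_def)
  have X1: "face_poly X = face_poly R + monom 1 2 * face_poly ?L"
  proof -
    have "R \<inter> (\<lambda>g. {u, v} \<union> g) ` ?L = {}" by (auto simp: R_def)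
    then have "(\<Sum>f\<in>R \<union> (\<lambda>g. {u, v} \<union> g) ` ?L. monom (1::int) (card f)) =
        face_poly R + (\<Sum>f\<in>(\<lambda>g. {u, v} \<union> g) ` ?L. monom 1 (card f))"
      unfolding face_poly_def using finR finL by (intro sum.union_disjoint) auto
    moreover have "card {u, v} = 2" using e(2) by simp
    moreover have "face_poly X = (\<Sum>f\<in>R \<union> (\<lambda>g. {u, v} \<union> g) ` ?L. monom 1 (card f))"
      unfolding face_poly_def by (rule sum.cong[OF Xeq refl])
    ultimately show ?thesis using part[of "{u, v}"] by (simp only: finite.intros) simp
  qed
  have "face_poly (stellar_subdivision {u, v} w X) =
      face_poly R + (monom 1 1 * face_poly ?L + (monom 1 2 * face_poly ?L + monom 1 2 * face_poly ?L))"
  proof -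
    have d1: "R \<inter> ((\<lambda>g. {w} \<union> g) ` ?L \<union> ((\<lambda>g. {w, u} \<union> g) ` ?L \<union> (\<lambda>g. {w, v} \<union> g) ` ?L)) = {}"
      using w_R by blast
    have d2: "(\<lambda>g. {w} \<union> g) ` ?L \<inter> ((\<lambda>g. {w, u} \<union> g) ` ?L \<union> (\<lambda>g. {w, v} \<union> g) ` ?L) = {}"
    proof -
      have "u \<notin> f" "v \<notin> f" if "f \<in> (\<lambda>g. {w} \<union> g) ` ?L" for f using that L uv by auto
      moreover have "u \<in> f \<or> v \<in> f" if "f \<in> (\<lambda>g. {w, u} \<union> g) ` ?L \<union> (\<lambda>g. {w, v} \<union> g) ` ?L" for f using that by auto
      ultimately show ?thesis by blast
    qed
    have d3: "(\<lambda>g. {w, u} \<union> g) ` ?L \<inter> (\<lambda>g. {w, v} \<union> g) ` ?L = {}"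
    proof -
      have "v \<notin> f" if "f \<in> (\<lambda>g. {w, u} \<union> g) ` ?L" for f using that L uv e(2) by auto
      moreover have "v \<in> f" if "f \<in> (\<lambda>g. {w, v} \<union> g) ` ?L" for f using that by auto
      ultimately show ?thesis by blast
    qed
    have c: "card {w} = 1" "card {w, u} = 2" "card {w, v} = 2" using uv by simp_all
    have fs: "finite ((\<lambda>g. h \<union> g) ` ?L)" for h using finL by simp
    show ?thesis unfolding Seq face_poly_def[of "R \<union> _"]
      unfolding sum.union_disjoint[OF finR finite_UnI[OF fs finite_UnI[OF fs fs]] d1]
        sum.union_disjoint[OF fs finite_UnI[OF fs fs] d2] sum.union_disjoint[OF fs fs d3]
      using part[of "{w}"] part[of "{w, u}"] part[of "{w, v}"] unfolding c face_poly_def[of R] by simp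
  qed
  moreover have "[:0,1,1:] = monom 1 1 + monom (1::int) 2" by (simp add: monom_altdef numeral_2_eq_2)
  ultimately show ?thesis unfolding X1 by (simp only: algebra_simps)
qed

lemma face_poly_two_points: "x \<noteq> y \<Longrightarrow> face_poly {{}, {x}, {y}} = [:1,2:]"
  by (simp add: face_poly_def monom_altdef one_pCons)

lemma simplicial_complex_two_points: "simplicial_complex {{}, {x}, {y}}"
  unfolding simplicial_complex_def by (auto simp: subset_singleton_iff)

section \<open>Cycle complexes\<close>

lemma cycle_complex_card_le: "f \<in> cycle_complex n \<Longrightarrow> card f \<le> 2"
  by (auto simp: cycle_complex_def card_insert_if)

lemma Union_cycle_complex: "\<Union>(cycle_complex n) = {..<n}"
  by (auto simp: cycle_complex_def)

lemma simplicial_complex_cycle: "simplicial_complex (cycle_complex n)"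
  unfolding simplicial_complex_def
proof (intro conjI ballI allI impI)
  show "finite (\<Union>(cycle_complex n))" by (simp add: Union_cycle_complex)
  show "{} \<in> cycle_complex n" by (simp add: cycle_complex_def)
  fix f g assume f: "f \<in> cycle_complex n" "g \<subseteq> f"
  have e: "{} \<in> cycle_complex n" "i < n \<Longrightarrow> {i} \<in> cycle_complex n" for i by (auto simp: cycle_complex_def)
  from f(1) consider "f = {}" | i where "f = {i}" "i < n" | i where "f = {i, (i + 1) mod n}" "i < n"
    by (auto simp: cycle_complex_def)
  then show "g \<in> cycle_complex n"
  proof cases
    case (3 i)
    have "g = {} \<or> g = {i} \<or> g = {(i + 1) mod n} \<or> g = f" using f(2) unfolding 3 by blast
    moreover have "(i + 1) mod n < n" using 3 by (intro mod_less_divisor) auto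
    ultimately show ?thesis using e 3 f(1) by auto
  qed (use f e in \<open>auto simp: subset_singleton_iff\<close>)
qed

text \<open>Injectivity excludes n = 2, where the two edges coincide; n \<ge> 2 excludes an edge
  with equal ends.\<close>

lemma face_poly_cycle:
  assumes "inj_on (\<lambda>i. {i, (i + 1) mod n}) {..<n}" "n \<ge> 2"
  shows "face_poly (cycle_complex n) = [:1, int n, int n:]"
proof -
  have c2: "card {i, (i + 1) mod n} = 2" if "i < n" for i
  proof -
    have "i \<noteq> (i + 1) mod n" using that assms(2) by (cases "i + 1 = n") auto
    then show ?thesis by simp
  qed
  have C: "cycle_complex n = {{}} \<union> ((\<lambda>i. {i}) ` {..<n} \<union> (\<lambda>i. {i, (i + 1) mod n}) ` {..<n})"
    by (auto simp: cycle_complex_def)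
  have d: "{{}} \<inter> ((\<lambda>i. {i}) ` {..<n} \<union> (\<lambda>i. {i, (i + 1) mod n}) ` {..<n}) = {}" by auto
  have "x \<noteq> y" if "x \<in> (\<lambda>i. {i}) ` {..<n}" "y \<in> (\<lambda>i. {i, (i + 1) mod n}) ` {..<n}" for x y
  proof -
    have "card x = 1" "card y = 2" using that c2 by auto
    then show ?thesis by auto
  qed
  then have d2: "(\<lambda>i. {i}) ` {..<n} \<inter> (\<lambda>i. {i, (i + 1) mod n}) ` {..<n} = {}" by blast
  have 1: "(\<Sum>f\<in>(\<lambda>i. {i}) ` {..<n}. monom (1::int) (card f)) = of_nat n * monom 1 1"
    by (subst sum.reindex) (auto simp: inj_on_def)
  have 2: "(\<Sum>f\<in>(\<lambda>i. {i, (i + 1) mod n}) ` {..<n}. monom (1::int) (card f)) = of_nat n * monom 1 2"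
    using c2 by (subst sum.reindex[OF assms(1)]) simp
  have "face_poly (cycle_complex n) = (\<Sum>f\<in>{{} :: nat set}. monom 1 (card f)) +
      ((\<Sum>f\<in>(\<lambda>i. {i}) ` {..<n}. monom 1 (card f)) +
       (\<Sum>f\<in>(\<lambda>i. {i, (i + 1) mod n}) ` {..<n}. monom 1 (card f)))"
  proof -
    have f: "finite {{} :: nat set}" "finite ((\<lambda>i. {i}) ` {..<n})"
      "finite ((\<lambda>i. {i, (i + 1) mod n}) ` {..<n})" by auto
    show ?thesis unfolding face_poly_def C
      unfolding sum.union_disjoint[OF f(1) finite_UnI[OF f(2,3)] d] sum.union_disjoint[OF f(2,3) d2] ..
  qed
  also have "\<dots> = 1 + (of_nat n * monom 1 1 + of_nat n * monom 1 2)"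
    unfolding 1 2 by simp
  also have "\<dots> = [:1, int n, int n:]"
    by (simp add: of_nat_poly monom_altdef numeral_2_eq_2 one_pCons)
  finally show ?thesis .
qed

lemma lessThan_5_6: "{..<5} = {0, 1, 2, 3, 4::nat}" "{..<6} = {0, 1, 2, 3, 4, 5::nat}" by auto

text \<open>This is 1 + 5t + 5t^2, arranged so that the \<gamma>-polynomial 1 + t can be read off;
  for the hexagon it is 1 + 2t.\<close>

lemma face_poly_C5: "face_poly (cycle_complex 5) = [:1,2:]^2 + [:0,1,1:]"
proof -
  have "inj_on (\<lambda>i. {i, (i + 1) mod 5}) {..<5::nat}"
    unfolding lessThan_5_6 by (auto simp: inj_on_def doubleton_eq_iff)
  then show ?thesis by (subst face_poly_cycle) (auto simp: power2_eq_square)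
qed

lemma face_poly_C6: "face_poly (cycle_complex 6) = [:1,2:]^2 + [:0,1,1:] + [:0,1,1:]"
proof -
  have "inj_on (\<lambda>i. {i, (i + 1) mod 6}) {..<6::nat}"
    unfolding lessThan_5_6 by (auto simp: inj_on_def doubleton_eq_iff)
  then show ?thesis by (subst face_poly_cycle) (auto simp: power2_eq_square)
qed

lemma cycle_edge_iff:
  assumes "x \<noteq> y"
  shows "{x, y} \<in> cycle_complex n \<longleftrightarrow> x < n \<and> y < n \<and> (y = (x + 1) mod n \<or> x = (y + 1) mod n)"
proof
  assume "{x, y} \<in> cycle_complex n"
  then obtain i where "i < n" "{x, y} = {i, (i + 1) mod n}"
    using assms by (auto simp: cycle_complex_def doubleton_eq_iff)
  moreover from this have "(i + 1) mod n < n" by (intro mod_less_divisor) auto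
  ultimately show "x < n \<and> y < n \<and> (y = (x + 1) mod n \<or> x = (y + 1) mod n)"
    by (auto simp: doubleton_eq_iff)
next
  assume "x < n \<and> y < n \<and> (y = (x + 1) mod n \<or> x = (y + 1) mod n)"
  then show "{x, y} \<in> cycle_complex n" unfolding cycle_complex_def by (auto simp: insert_commute)
qed

lemma face_poly_link_C5:
  assumes "i < 5"
  shows "face_poly (link (cycle_complex 5) {i}) = [:1,2:]"
proof -
  let ?x = "(i + 1) mod 5" and ?y = "(i + 4) mod 5"
  have "link (cycle_complex 5) {i} = {{}, {?x}, {?y}}"
  proof
    have i: "i \<in> {0, 1, 2, 3, 4}" using assms by auto
    show "link (cycle_complex 5) {i} \<subseteq> {{}, {?x}, {?y}}"
    proof
      fix g assume "g \<in> link (cycle_complex 5) {i}"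
      then have g: "g \<in> cycle_complex 5" "i \<notin> g" "insert i g \<in> cycle_complex 5" by (auto simp: link_def)
      have "finite g" using simplicial_complexD(5)[OF simplicial_complex_cycle g(1)] .
      then have "card g \<le> 1" using cycle_complex_card_le[OF g(3)] g(2) by simp
      then consider "g = {}" | z where "g = {z}" using \<open>finite g\<close> by (auto simp: le_Suc_eq card_1_singleton_iff)
      then show "g \<in> {{}, {?x}, {?y}}"
      proof cases
        case (2 z)
        then have "z < 5" "z = (i + 1) mod 5 \<or> i = (z + 1) mod 5"
          using g(2,3) cycle_edge_iff[of i z 5] by auto
        moreover from this have "z \<in> {0, 1, 2, 3, 4}" by auto
        ultimately have "z = ?x \<or> z = ?y" using i by auto
        then show ?thesis using 2 by auto
      qed simp
    qed
    have "{i, ?x} \<in> cycle_complex 5" "{i, ?y} \<in> cycle_complex 5" "{i} \<in> cycle_complex 5"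
      "{} \<in> cycle_complex 5" "{?x} \<in> cycle_complex 5" "{?y} \<in> cycle_complex 5" "?x \<noteq> i" "?y \<noteq> i"
      using i cycle_edge_iff[of i ?x 5] cycle_edge_iff[of i ?y 5] by (auto simp: cycle_complex_def)
    then show "{{}, {?x}, {?y}} \<subseteq> link (cycle_complex 5) {i}" by (auto simp: link_def insert_commute)
  qed
  moreover have "?x \<noteq> ?y" by presburger
  ultimately show ?thesis by (simp add: face_poly_two_points)
qed

section \<open>Euler characteristic and connectedness from homology\<close>

text \<open>Stated for a subspace, as chains are part of the space of all functions on lists;
  finiteness enters through \<open>W\<close>. A basis of the kernel is extended to one of
  \<open>S\<close>, and \<open>f\<close> is injective on the span of the added vectors.\<close>

lemma (in vector_space_pair) rank_nullity:
  assumes f: "Vector_Spaces.linear s1 s2 f" and S: "vs1.subspace S" and W: "finite W" "S \<subseteq> vs1.span W"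
  shows "vs1.dim S = vs1.dim {x \<in> S. f x = 0} + vs2.dim (f ` S)"
proof -
  let ?K = "{x \<in> S. f x = 0}"
  obtain B0 where B0: "B0 \<subseteq> ?K" "vs1.independent B0" "?K \<subseteq> vs1.span B0" "card B0 = vs1.dim ?K"
    using vs1.basis_exists by blast
  have "B0 \<subseteq> S" using B0(1) by blast
  then obtain B where B: "B0 \<subseteq> B" "B \<subseteq> S" "vs1.independent B" "S \<subseteq> vs1.span B"
    using vs1.maximal_independent_subset_extend B0(2) by metis
  have finB: "finite B" using vs1.independent_span_bound[OF W(1) B(3)] B(2) W(2) by blast
  define C where "C = B - B0"
  have C: "C \<subseteq> B" "C \<subseteq> S" "vs1.independent C" "finite C"
    using B finB vs1.independent_mono by (auto simp: C_def)
  have CS: "vs1.span C \<subseteq> S" using vs1.span_minimal[OF C(2) S] .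
  have zero: "x = 0" if "x \<in> vs1.span B0" "x \<in> vs1.span C" for x
  proof -
    have "vs1.representation B x = vs1.representation B0 x"
      by (rule vs1.representation_extend[OF B(3) that(1) B(1)])
    moreover have "vs1.representation B x = vs1.representation C x"
      by (rule vs1.representation_extend[OF B(3) that(2) C(1)])
    ultimately have "vs1.representation B0 x b = 0" for b
      using vs1.representation_ne_zero[of B0 x b] vs1.representation_ne_zero[of C x b]
      by (auto simp: C_def)
    then show ?thesis using vs1.sum_nonzero_representation_eq[OF B0(2) that(1)] by simp
  qed
  have inj: "inj_on f (vs1.span C)"
  proof (rule inj_onI)
    fix x y assume xy: "x \<in> vs1.span C" "y \<in> vs1.span C" "f x = f y"
    then have "x - y \<in> vs1.span C" by (simp add: vs1.span_diff)
    moreover have "f (x - y) = 0" using xy(3) linear_diff[OF f] by simp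
    ultimately have "x - y = 0" using CS B0(3) zero by blast
    then show "x = y" by simp
  qed
  have "f x \<in> vs2.span (f ` C)" if "x \<in> S" for x
  proof -
    have "x \<in> vs1.span (B0 \<union> C)" using that B(1,4) by (auto simp: C_def Un_absorb1)
    then obtain y z where "y \<in> vs1.span B0" "z \<in> vs1.span C" "x = y + z"
      unfolding vs1.span_Un by auto
    moreover have "f y = 0" if "y \<in> vs1.span B0" for y
      using linear_eq_0_on_span[OF f _ that] B0(1) by blast
    ultimately have "f x = f z" "z \<in> vs1.span C" using linear_add[OF f] by auto
    then show ?thesis using linear_span_image[OF f, of C] by auto
  qed
  then have "card (f ` C) = vs2.dim (f ` S)"
    using C(2) linear_independent_injective_image[OF f C(3) inj]
    by (intro vs2.basis_card_eq_dim) auto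
  moreover have "card (f ` C) = card C"
    using inj_on_subset[OF inj vs1.span_superset] by (rule card_image)
  moreover have "card B = card B0 + card C"
    using B(1) finB by (simp add: C_def card_Diff_subset finite_subset card_mono)
  moreover have "card B = vs1.dim S" using vs1.basis_card_eq_dim B by blast
  ultimately show ?thesis using B0(4) by simp
qed

abbreviation fscale :: "'k::field \<Rightarrow> ('b \<Rightarrow> 'k) \<Rightarrow> 'b \<Rightarrow> 'k" where
  "fscale a f \<equiv> (\<lambda>x. a * f x)"

interpretation fv: vector_space "fscale :: 'k::field \<Rightarrow> ('b \<Rightarrow> 'k) \<Rightarrow> 'b \<Rightarrow> 'k"
  by unfold_locales (auto simp: fun_eq_iff algebra_simps)

interpretation fvp: vector_space_pair
  "fscale :: 'k::field \<Rightarrow> ('b \<Rightarrow> 'k) \<Rightarrow> 'b \<Rightarrow> 'k" "fscale :: 'k::field \<Rightarrow> ('b \<Rightarrow> 'k) \<Rightarrow> 'b \<Rightarrow> 'k"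
  by unfold_locales

text \<open>The ranking \<open>r\<close> orders the vertices; the parity of the count is the
  orientation sign of an ordering of a face.\<close>

fun inversions :: "('a \<Rightarrow> nat) \<Rightarrow> 'a list \<Rightarrow> nat" where
  "inversions r [] = 0"
| "inversions r (x # xs) = length (filter (\<lambda>y. r y < r x) xs) + inversions r xs"

lemma inversions_swap:
  assumes "r u \<noteq> r v"
  shows "(-1 :: 'k::field) ^ inversions r (xs @ u # v # ys) = - ((-1) ^ inversions r (xs @ v # u # ys))"
proof (induction xs)
  case Nil
  then show ?case using assms by (auto simp: power_add not_less)
next
  case (Cons x xs)
  then show ?case by (simp add: power_add)
qed

text \<open>Adjacent swaps generate all rearrangements: the head of \<open>s\<close> is moved to the
  front of \<open>t\<close>, and induction handles the tails. It will be applied to a chain times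
  the orientation sign.\<close>

lemma swap_invariant:
  assumes "\<And>xs u v ys. distinct (xs @ u # v # ys) \<Longrightarrow> set (xs @ u # v # ys) = set s \<Longrightarrow>
      g (xs @ u # v # ys) = g (xs @ v # u # ys)"
    and "distinct s" "distinct t" "set t = set s"
  shows "g t = g s"
  using assms
proof (induction s arbitrary: g t)
  case (Cons x s)
  have "x \<in> set t" using Cons.prems(4) by auto
  then obtain a b where t: "t = a @ x # b" by (auto dest: split_list)
  have move: "g (a @ x # b) = g (x # a @ b)"
    if "distinct (a @ x # b)" "set (a @ x # b) = set (x # s)" for a b
    using that
  proof (induction a arbitrary: b rule: rev_induct)
    case (snoc y a)
    have "g (a @ y # x # b) = g (a @ x # y # b)" using snoc.prems by (intro Cons.prems(1)) auto
    moreover have "g (a @ x # y # b) = g (x # a @ y # b)" using snoc.prems by (intro snoc.IH) auto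
    ultimately show ?case by simp
  qed simp
  have ab: "distinct (a @ b)" "set (a @ b) = set s"
    using Cons.prems(2-4) unfolding t by auto
  have "g (x # a @ b) = g (x # s)"
  proof (rule Cons.IH[of "\<lambda>l. g (x # l)", OF _ _ ab])
    fix xs u v ys assume *: "distinct (xs @ u # v # ys)" "set (xs @ u # v # ys) = set s"
    have "x \<notin> set (xs @ u # v # ys)" using Cons.prems(2) unfolding *(2) by simp
    then show "g (x # xs @ u # v # ys) = g (x # xs @ v # u # ys)"
      using Cons.prems(1)[of "x # xs" u v ys] * by auto
  qed (use Cons.prems(2) in simp)
  then show ?case using move Cons.prems(3,4) unfolding t by simp
qed simp

text \<open>The diagonal has a hypothesis of its own, because in characteristic 2 antisymmetry does
  not make it vanish.\<close>

lemma antisym_sum_zero: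
  fixes c :: "'a \<Rightarrow> 'a \<Rightarrow> 'k::field"
  assumes "finite A" "\<And>u v. c u v = - c v u" "\<And>u. c u u = 0"
  shows "(\<Sum>u\<in>A. \<Sum>v\<in>A. c u v) = 0"
  using assms(1)
proof (induction A)
  case (insert a A)
  have "(\<Sum>u\<in>A. c u a) + (\<Sum>v\<in>A. c a v) = 0"
    by (simp add: assms(2)[of _ a] sum_negf)
  then show ?case using insert by (simp add: sum.distrib assms(3))
qed simp

section \<open>Chain spaces and their dimensions\<close>

lemma chains_supp:
  assumes "c \<in> chains \<Delta> i" "c s \<noteq> 0"
  shows "distinct s" "set s \<in> \<Delta>" "int (length s) = i + 1"
  using assms by (auto simp: chains_def)

lemma chainsI:
  assumes "\<And>s. c s \<noteq> 0 \<Longrightarrow> distinct s \<and> set s \<in> \<Delta> \<and> int (length s) = i + 1"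
    and "\<And>xs u v ys. c (xs @ u # v # ys) = - c (xs @ v # u # ys)"
  shows "c \<in> chains \<Delta> i"
  using assms unfolding chains_def by blast

lemma chains_swap: "c \<in> chains \<Delta> i \<Longrightarrow> c (xs @ u # v # ys) = - c (xs @ v # u # ys)"
  unfolding chains_def by blast

lemma chains_repeat: "c \<in> chains \<Delta> i \<Longrightarrow> \<not> distinct s \<Longrightarrow> c s = 0"
  using chains_supp by blast

lemma subspace_chains: "fv.subspace (chains \<Delta> i :: ('a list \<Rightarrow> 'k::field) set)"
proof (rule fv.subspaceI)
  show "0 \<in> (chains \<Delta> i :: ('a list \<Rightarrow> 'k) set)" by (simp add: chains_def)
next
  fix x y :: "'a list \<Rightarrow> 'k" assume xy: "x \<in> chains \<Delta> i" "y \<in> chains \<Delta> i"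
  show "x + y \<in> chains \<Delta> i"
  proof (rule chainsI)
    fix s assume "(x + y) s \<noteq> 0"
    then have "x s \<noteq> 0 \<or> y s \<noteq> 0" by auto
    then show "distinct s \<and> set s \<in> \<Delta> \<and> int (length s) = i + 1"
      using chains_supp xy by blast
  next
    fix xs u v ys
    show "(x + y) (xs @ u # v # ys) = - (x + y) (xs @ v # u # ys)"
      using chains_swap[OF xy(1), of xs u v ys] chains_swap[OF xy(2), of xs u v ys] by simp
  qed
next
  fix a and x :: "'a list \<Rightarrow> 'k" assume x: "x \<in> chains \<Delta> i"
  show "fscale a x \<in> chains \<Delta> i"
  proof (rule chainsI)
    fix s assume "a * x s \<noteq> 0"
    then have "x s \<noteq> 0" by auto
    then show "distinct s \<and> set s \<in> \<Delta> \<and> int (length s) = i + 1"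
      using chains_supp x by blast
  next
    fix xs u v ys
    show "a * x (xs @ u # v # ys) = - (a * x (xs @ v # u # ys))"
      using chains_swap[OF x, of xs u v ys] by simp
  qed
qed

lemma linear_boundary:
  "Vector_Spaces.linear fscale fscale (boundary \<Delta> :: ('a list \<Rightarrow> 'k::field) \<Rightarrow> _)"
proof (rule Vector_Spaces.linear_iff[THEN iffD2], intro conjI allI)
  show "vector_space (fscale :: 'k \<Rightarrow> ('a list \<Rightarrow> 'k) \<Rightarrow> _)"
    "vector_space (fscale :: 'k \<Rightarrow> ('a list \<Rightarrow> 'k) \<Rightarrow> _)"
    by (rule fv.vector_space_axioms)+
qed (auto simp: boundary_def fun_eq_iff sum.distrib sum_distrib_left)

lemma boundary_chain:
  assumes "simplicial_complex \<Delta>" "c \<in> chains \<Delta> i"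
  shows "boundary \<Delta> c \<in> chains \<Delta> (i - 1)"
proof (rule chainsI)
  fix s assume "boundary \<Delta> c s \<noteq> 0"
  then obtain v where "c (v # s) \<noteq> 0" unfolding boundary_def
    by (rule sum.not_neutral_contains_not_neutral)
  then have *: "distinct (v # s)" "set (v # s) \<in> \<Delta>" "int (length (v # s)) = i + 1"
    using chains_supp[OF assms(2)] by blast+
  then show "distinct s \<and> set s \<in> \<Delta> \<and> int (length s) = i - 1 + 1"
    using assms(1) by (auto simp: simplicial_complex_def)
next
  fix xs u v ys
  have "c (w # xs @ u # v # ys) = - c (w # xs @ v # u # ys)" for w
    using chains_swap[OF assms(2), of "w # xs" u v ys] by simp
  then show "boundary \<Delta> c (xs @ u # v # ys) = - boundary \<Delta> c (xs @ v # u # ys)"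
    unfolding boundary_def sum_negf[symmetric] by (intro sum.cong refl)
qed

lemma boundary_boundary:
  assumes "simplicial_complex \<Delta>" "c \<in> chains \<Delta> i"
  shows "boundary \<Delta> (boundary \<Delta> c) = (\<lambda>_. 0)"
proof
  fix s
  have "(\<Sum>u\<in>\<Union>\<Delta>. \<Sum>v\<in>\<Union>\<Delta>. c (v # u # s)) = 0"
  proof (rule antisym_sum_zero)
    show "finite (\<Union>\<Delta>)" using assms(1) by (simp add: simplicial_complex_def)
    show "c (v # u # s) = - c (u # v # s)" for u v using chains_swap[OF assms(2), of "[]" v u s] by simp
    show "c (u # u # s) = 0" for u by (rule chains_repeat[OF assms(2)]) simp
  qed
  then show "boundary \<Delta> (boundary \<Delta> c) s = 0" by (simp add: boundary_def)
qed

lemma sum_fun_apply: "(\<Sum>f\<in>A. g f) s = (\<Sum>f\<in>A. g f s)"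
  by (induction A rule: infinite_finite_induct) auto

text \<open>Each face gives the chain \<open>b f\<close> that takes the orientation sign on the
  orderings of \<open>f\<close>. Evaluation at one fixed ordering \<open>e f\<close> separates these
  chains and reads off coordinates.\<close>

lemma chains_basis:
  fixes \<Delta> :: "'a set set" and i :: int
  assumes "simplicial_complex \<Delta>"
  defines "F \<equiv> {f \<in> \<Delta>. int (card f) = i + 1}"
  shows "\<exists>b :: 'a set \<Rightarrow> 'a list \<Rightarrow> 'k::field. b ` F \<subseteq> chains \<Delta> i \<and> inj_on b F \<and>
    fv.independent (b ` F) \<and> chains \<Delta> i \<subseteq> fv.span (b ` F)"
proof -
  have fin: "finite (\<Union>\<Delta>)" using assms(1) by (simp add: simplicial_complex_def)
  then obtain r :: "'a \<Rightarrow> nat" where r: "inj_on r (\<Union>\<Delta>)"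
    using finite_imp_inj_to_nat_seg by blast
  have finF: "finite F" using simplicial_complexD(4)[OF assms(1)] by (simp add: F_def)
  have sgr: "(-1 :: 'k) ^ inversions r (xs @ u # v # ys) = - ((-1) ^ inversions r (xs @ v # u # ys))"
    if "distinct (xs @ u # v # ys)" "set (xs @ u # v # ys) \<in> \<Delta>" for xs u v ys
  proof (rule inversions_swap)
    have "u \<noteq> v" "u \<in> \<Union>\<Delta>" "v \<in> \<Union>\<Delta>"
      using that(1) UnionI[OF that(2), of u] UnionI[OF that(2), of v] by auto
    then show "r u \<noteq> r v" using r by (auto dest: inj_onD)
  qed
  define b :: "'a set \<Rightarrow> 'a list \<Rightarrow> 'k" where
    "b f = (\<lambda>s. if distinct s \<and> set s = f then (-1) ^ inversions r s else 0)" for f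
  define e where "e f = (SOME s. distinct s \<and> set s = f)" for f :: "'a set"
  have e: "distinct (e f)" "set (e f) = f" if "f \<in> \<Delta>" for f
    using someI_ex[OF finite_distinct_list[OF simplicial_complexD(5)[OF assms(1) that]]]
    by (auto simp: e_def conj_commute)
  have b_e: "b f (e f) \<noteq> 0" if "f \<in> \<Delta>" for f
    using e[OF that] by (simp add: b_def)
  have b_e': "b g (e f) = 0" if "f \<in> \<Delta>" "g \<noteq> f" for f g
    using e[OF that(1)] that(2) by (simp add: b_def)
  have b_chain: "b f \<in> chains \<Delta> i" if f: "f \<in> F" for f
  proof (rule chainsI)
    fix s assume "b f s \<noteq> 0"
    then have "distinct s" "set s = f" by (auto simp: b_def split: if_splits)
    then show "distinct s \<and> set s \<in> \<Delta> \<and> int (length s) = i + 1"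
      using f distinct_card[of s] by (auto simp: F_def)
  next
    fix xs u v ys
    show "b f (xs @ u # v # ys) = - b f (xs @ v # u # ys)"
    proof (cases "distinct (xs @ u # v # ys) \<and> set (xs @ u # v # ys) = f")
      case True
      moreover from this have "distinct (xs @ v # u # ys) \<and> set (xs @ v # u # ys) = f" by auto
      ultimately show ?thesis using sgr[of xs u v ys] f unfolding b_def by (simp add: F_def)
    next
      case False
      moreover from this have "\<not> (distinct (xs @ v # u # ys) \<and> set (xs @ v # u # ys) = f)" by auto
      ultimately show ?thesis unfolding b_def by (simp only: if_False minus_zero)
    qed
  qed
  have "inj_on b F"
    using b_e b_e' by (intro inj_onI) (metis (mono_tags, lifting) F_def mem_Collect_eq)
  moreover have "fv.independent (b ` F)"
  proof
    assume "fv.dependent (b ` F)"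
    then obtain f where f: "f \<in> F" "b f \<in> fv.span (b ` F - {b f})"
      unfolding fv.dependent_def by blast
    have "fv.span (b ` F - {b f}) \<subseteq> {c. c (e f) = 0}"
    proof (rule fv.span_minimal)
      show "b ` F - {b f} \<subseteq> {c. c (e f) = 0}"
      proof
        fix c assume "c \<in> b ` F - {b f}"
        then obtain g where "c = b g" "g \<noteq> f" by blast
        then show "c \<in> {c. c (e f) = 0}" using b_e'[of f g] f(1) by (simp add: F_def)
      qed
      show "fv.subspace {c. c (e f) = (0 :: 'k)}" by (rule fv.subspaceI) auto
    qed
    then show False using f b_e[of f] by (auto simp: F_def)
  qed
  moreover have "c \<in> fv.span (b ` F)" if c: "c \<in> chains \<Delta> i" for c
  proof -
    \<comment> \<open>The sign is its own inverse, so \<open>c\<close> and the combination agree at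
      \<open>e f\<close>, and by \<open>swap_invariant\<close> at every ordering of
      \<open>f\<close>.\<close>
    define a where "a f = c (e f) * (-1) ^ inversions r (e f)" for f
    have "c = (\<Sum>f\<in>F. fscale (a f) (b f))"
    proof
      fix s
      show "c s = (\<Sum>f\<in>F. fscale (a f) (b f)) s"
      proof (cases "distinct s \<and> set s \<in> F")
        case True
        then have sF: "set s \<in> F" "set s \<in> \<Delta>" by (auto simp: F_def)
        let ?g = "\<lambda>l. c l * (-1) ^ inversions r l"
        have "?g (e (set s)) = ?g s"
        proof (rule swap_invariant)
          fix xs u v ys assume "distinct (xs @ u # v # ys)" "set (xs @ u # v # ys) = set s"
          then show "?g (xs @ u # v # ys) = ?g (xs @ v # u # ys)"
            using sgr[of xs u v ys] chains_swap[OF c, of xs u v ys] sF(2) by simp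
        qed (use e[OF sF(2)] True in auto)
        then have "a (set s) * (-1) ^ inversions r s = c s"
          by (simp add: a_def mult.assoc flip: power_mult_distrib)
        moreover have "(\<Sum>f\<in>F. fscale (a f) (b f)) s = (\<Sum>f\<in>F. if f = set s then a f * (-1) ^ inversions r s else 0)"
          using True by (simp add: sum_fun_apply b_def) (intro sum.cong; auto)
        ultimately show ?thesis using sF(1) finF by simp
      next
        case False
        have "c s = 0"
        proof (rule ccontr)
          assume "c s \<noteq> 0"
          then have "distinct s" "set s \<in> \<Delta>" "int (length s) = i + 1" using chains_supp[OF c] by blast+
          then show False using False distinct_card[of s] by (simp add: F_def)
        qed
        moreover have "(\<Sum>f\<in>F. fscale (a f) (b f)) s = 0"
          using False by (auto simp: sum_fun_apply b_def intro!: sum.neutral)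
        ultimately show ?thesis by simp
      qed
    qed
    moreover have "(\<Sum>f\<in>F. fscale (a f) (b f)) \<in> fv.span (b ` F)"
      by (intro fv.span_sum fv.span_scale fv.span_base) auto
    ultimately show ?thesis by simp
  qed
  ultimately show ?thesis using b_chain by (intro exI[of _ b] conjI image_subsetI subsetI) auto
qed


lemma chains_finite_span:
  assumes "simplicial_complex \<Delta>"
  shows "\<exists>W. finite W \<and> (chains \<Delta> i :: ('a list \<Rightarrow> 'k::field) set) \<subseteq> fv.span W"
proof -
  obtain b :: "'a set \<Rightarrow> 'a list \<Rightarrow> 'k" where
    "chains \<Delta> i \<subseteq> fv.span (b ` {f \<in> \<Delta>. int (card f) = i + 1})"
    using chains_basis[OF assms, of i, where ?'k = 'k] by (elim exE conjE) (rule that)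
  then show ?thesis using simplicial_complexD(4)[OF assms] by (intro exI conjI) auto
qed

lemma dim_chains:
  assumes "simplicial_complex \<Delta>"
  shows "fv.dim (chains \<Delta> i :: ('a list \<Rightarrow> 'k::field) set) = card {f \<in> \<Delta>. int (card f) = i + 1}"
proof -
  obtain b :: "'a set \<Rightarrow> 'a list \<Rightarrow> 'k" where b:
    "b ` {f \<in> \<Delta>. int (card f) = i + 1} \<subseteq> chains \<Delta> i" "inj_on b {f \<in> \<Delta>. int (card f) = i + 1}"
    "fv.independent (b ` {f \<in> \<Delta>. int (card f) = i + 1})"
    "chains \<Delta> i \<subseteq> fv.span (b ` {f \<in> \<Delta>. int (card f) = i + 1})"
    using chains_basis[OF assms, of i, where ?'k = 'k] by (elim exE conjE) (rule that)
  show ?thesis using fv.dim_unique[OF b(1,4,3)] card_image[OF b(2)] by simp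
qed

lemma dim_chains_split:
  assumes "simplicial_complex \<Delta>"
  shows "card {f \<in> \<Delta>. int (card f) = i + 1} =
    fv.dim (cycles \<Delta> i :: ('a list \<Rightarrow> 'k::field) set) +
    fv.dim (boundaries \<Delta> (i - 1) :: ('a list \<Rightarrow> 'k) set)"
proof -
  obtain W :: "('a list \<Rightarrow> 'k) set" where W: "finite W" "chains \<Delta> i \<subseteq> fv.span W"
    using chains_finite_span[OF assms] by blast
  show ?thesis
    using fvp.rank_nullity[OF linear_boundary subspace_chains W, of \<Delta>] dim_chains[OF assms, of i, where ?'k = 'k]
    by (simp add: cycles_def boundaries_def zero_fun_def)
qed

lemma subspace_boundaries: "fv.subspace (boundaries \<Delta> i :: ('a list \<Rightarrow> 'k::field) set)"
  unfolding boundaries_def by (rule fvp.linear_subspace_image[OF linear_boundary subspace_chains])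

lemma subspace_cycles: "fv.subspace (cycles \<Delta> i :: ('a list \<Rightarrow> 'k::field) set)"
proof -
  have "cycles \<Delta> i = {c. boundary \<Delta> c = 0} \<inter> (chains \<Delta> i :: ('a list \<Rightarrow> 'k) set)"
    by (auto simp: cycles_def zero_fun_def)
  then show ?thesis
    using fv.subspace_inter[OF fvp.linear_subspace_kernel[OF linear_boundary] subspace_chains] by metis
qed

lemma boundaries_subset_cycles:
  assumes "simplicial_complex \<Delta>"
  shows "boundaries \<Delta> i \<subseteq> cycles \<Delta> i"
  using boundary_chain[OF assms, of _ "i + 1"] boundary_boundary[OF assms, of _ "i + 1"]
  by (auto simp: boundaries_def cycles_def)

lemma cycles_eq_boundaries:
  assumes "simplicial_complex \<Delta>" "homology_zero TYPE('k::field) \<Delta> i"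
  shows "cycles \<Delta> i = (boundaries \<Delta> i :: ('a list \<Rightarrow> 'k) set)"
proof
  show "boundaries \<Delta> i \<subseteq> (cycles \<Delta> i :: ('a list \<Rightarrow> 'k) set)"
    by (rule boundaries_subset_cycles[OF assms(1)])
  show "cycles \<Delta> i \<subseteq> (boundaries \<Delta> i :: ('a list \<Rightarrow> 'k) set)"
  proof
    fix z :: "'a list \<Rightarrow> 'k" assume z: "z \<in> cycles \<Delta> i"
    have "(\<lambda>s. z s - z s) \<in> (boundaries \<Delta> i :: ('a list \<Rightarrow> 'k) set)"
      using fv.subspace_0[OF subspace_boundaries, of \<Delta> i] by (simp add: zero_fun_def)
    then have "z \<in> homology_class \<Delta> i z" using z by (simp add: homology_class_def)
    moreover have "homology_class \<Delta> i z = homology_class \<Delta> i (\<lambda>_. 0)"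
      using assms(2) z unfolding homology_zero_def reduced_homology_def by blast
    ultimately have "z \<in> homology_class \<Delta> i (\<lambda>_. 0)" by (simp only:)
    then show "z \<in> boundaries \<Delta> i" by (simp add: homology_class_def)
  qed
qed

text \<open>Without nonzero boundaries each homology class is a single cycle, so the given
  isomorphism is a linear bijection from the cycles onto the field, and the cycle sent to 1
  spans.\<close>

lemma dim_top_cycles:
  assumes "homology_iso_field TYPE('k::field) \<Delta> i" "boundaries \<Delta> i = {0 :: 'a list \<Rightarrow> 'k}"
  shows "fv.dim (cycles \<Delta> i :: ('a list \<Rightarrow> 'k) set) = 1"
proof -
  let ?Z = "cycles \<Delta> i :: ('a list \<Rightarrow> 'k) set"
  have cls: "homology_class \<Delta> i z = {z}" if "z \<in> ?Z" for z
    using that fv.subspace_0[OF subspace_boundaries, of \<Delta> i] unfolding homology_class_def assms(2)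
    by (auto simp: fun_eq_iff)
  obtain \<phi> :: "('a list \<Rightarrow> 'k) set \<Rightarrow> 'k" where
    bij: "bij_betw \<phi> (reduced_homology \<Delta> i) UNIV" and
    scale: "\<And>a x. x \<in> ?Z \<Longrightarrow> \<phi> (homology_class \<Delta> i (\<lambda>s. a * x s)) = a * \<phi> (homology_class \<Delta> i x)"
    using assms(1) unfolding homology_iso_field_def by blast
  have inj: "z = z'" if "z \<in> ?Z" "z' \<in> ?Z" "\<phi> (homology_class \<Delta> i z) = \<phi> (homology_class \<Delta> i z')" for z z'
  proof -
    have "homology_class \<Delta> i z = homology_class \<Delta> i z'"
      using bij that unfolding bij_betw_def reduced_homology_def by (auto dest: inj_onD)
    then show ?thesis using cls that by simp
  qed
  have "1 \<in> \<phi> ` (homology_class \<Delta> i ` ?Z)"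
    using bij unfolding bij_betw_def reduced_homology_def by simp
  then obtain z where z: "z \<in> ?Z" "\<phi> (homology_class \<Delta> i z) = 1" by auto
  have zs: "fscale a z \<in> ?Z" for a using fv.subspace_scale[OF subspace_cycles z(1)] .
  have "z \<noteq> 0"
  proof
    assume "z = 0"
    then have "(\<lambda>s. 0 * z s) = z" by (simp add: zero_fun_def)
    then show False using scale[OF z(1), of 0] z(2) by simp
  qed
  moreover have "?Z \<subseteq> fv.span {z}"
  proof
    fix x assume x: "x \<in> ?Z"
    have "x = fscale (\<phi> (homology_class \<Delta> i x)) z"
      using scale[OF z(1)] z(2) by (intro inj[OF x zs]) simp
    then show "x \<in> fv.span {z}"
      using fv.span_scale[OF fv.span_base[of z "{z}"]] by (metis singletonI)
  qed
  ultimately show ?thesis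
    using z(1) by (intro fv.dim_unique[of "{z}"]) auto
qed

text \<open>The alternating sum telescopes: rank and nullity split \<open>c j\<close> into
  \<open>z j\<close> and \<open>b j\<close>, vanishing homology below the top gives
  \<open>z j = b (Suc j)\<close>, and only \<open>z d = 1\<close> survives.\<close>

lemma euler_characteristic:
  assumes sc: "simplicial_complex \<Delta>" and le: "\<And>f. f \<in> \<Delta> \<Longrightarrow> card f \<le> d"
    and zero: "\<And>i. i < int d - 1 \<Longrightarrow> homology_zero TYPE('k::field) \<Delta> i"
    and top: "homology_iso_field TYPE('k) \<Delta> (int d - 1)"
  shows "poly (face_poly \<Delta>) (-1) = (-1) ^ d"
proof -
  \<comment> \<open>The index counts vertices: faces with j vertices carry chains of degree j - 1,
    whose boundaries lie in degree j - 2.\<close>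
  define c where "c j = card {f \<in> \<Delta>. card f = j}" for j
  define b where "b j = fv.dim (boundaries \<Delta> (int j - 2) :: ('a list \<Rightarrow> 'k) set)" for j
  define z where "z j = fv.dim (cycles \<Delta> (int j - 1) :: ('a list \<Rightarrow> 'k) set)" for j
  have split: "c j = z j + b j" for j
    using dim_chains_split[OF sc, of "int j - 1", where ?'k = 'k] by (simp add: c_def z_def b_def)
  have zb: "z j = b (Suc j)" if "j < d" for j
  proof -
    have "int j - 1 < int d - 1" using that by simp
    then show ?thesis using cycles_eq_boundaries[OF sc zero] by (simp add: z_def b_def algebra_simps)
  qed
  have "chains \<Delta> (-1) \<subseteq> {c :: 'a list \<Rightarrow> 'k. boundary \<Delta> c = 0}"
  proof
    fix e :: "'a list \<Rightarrow> 'k" assume e: "e \<in> chains \<Delta> (-1)"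
    have "e (v # s) = 0" for v s using chains_supp(3)[OF e, of "v # s"] by force
    then show "e \<in> {c. boundary \<Delta> c = 0}" by (simp add: boundary_def fun_eq_iff)
  qed
  then have "boundaries \<Delta> (int 0 - 2) \<subseteq> {0 :: 'a list \<Rightarrow> 'k}" by (auto simp: boundaries_def)
  then have b0: "b 0 = 0" using fv.dim_le_card[of _ "{}"] by (simp add: b_def)
  have ez: "e = 0" if "e \<in> chains \<Delta> (int d)" for e :: "'a list \<Rightarrow> 'k"
  proof
    fix s
    show "e s = 0 s"
    proof (rule ccontr)
      assume "e s \<noteq> 0 s"
      then have "distinct s" "set s \<in> \<Delta>" "int (length s) = int d + 1"
        using chains_supp[OF that] by auto
      then show False using le[of "set s"] distinct_card[of s] by simp
    qed
  qed
  have "boundary \<Delta> e = 0" if "e \<in> chains \<Delta> (int d)" for e :: "'a list \<Rightarrow> 'k"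
    unfolding ez[OF that] by (simp add: boundary_def fun_eq_iff)
  then have "boundaries \<Delta> (int d - 1) \<subseteq> {0 :: 'a list \<Rightarrow> 'k}"
    by (auto simp: boundaries_def)
  then have "boundaries \<Delta> (int d - 1) = {0 :: 'a list \<Rightarrow> 'k}"
    using fv.subspace_0[OF subspace_boundaries, of \<Delta> "int d - 1"] by blast
  then have zd: "z d = 1" using dim_top_cycles[OF top] by (simp add: z_def)
  have part: "(\<Sum>j<n. (-1) ^ j * int (c j)) = - ((-1) ^ n * int (b n))" if "n \<le> d" for n
    using that
  proof (induction n)
    case 0
    then show ?case using b0 by simp
  next
    case (Suc n)
    then show ?case using zb[of n] by (simp add: split algebra_simps)
  qed
  have "poly (face_poly \<Delta>) (-1) = (\<Sum>f\<in>\<Delta>. (-1) ^ card f)"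
    by (simp add: face_poly_def poly_sum poly_monom)
  also have "\<dots> = (\<Sum>j\<in>{..d}. \<Sum>f\<in>{f \<in> \<Delta>. card f = j}. (-1) ^ card f)"
    using le simplicial_complexD(4)[OF sc] by (intro sum.group[symmetric]) auto
  also have "\<dots> = (\<Sum>j\<le>d. (-1) ^ j * int (c j))"
    by (intro sum.cong refl) (simp add: c_def)
  also have "\<dots> = (\<Sum>j<d. (-1) ^ j * int (c j)) + (-1) ^ d * int (c d)"
    by (simp flip: lessThan_Suc_atMost)
  also have "\<dots> = (-1) ^ d" using part[of d] split[of d] zd by (simp add: algebra_simps)
  finally show ?thesis .
qed

text \<open>For \<open>a\<close> in \<open>A\<close> and \<open>b\<close> outside, the difference of
  the two points is a cycle, hence the boundary of some \<open>e\<close>. Its sum over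
  \<open>A\<close> is 1; but no edge leaves \<open>A\<close>, so only values of \<open>e\<close> on
  pairs inside \<open>A\<close> contribute, and these cancel.\<close>

lemma connected_if_homology_zero:
  assumes sc: "simplicial_complex \<Delta>" and zero: "homology_zero TYPE('k::field) \<Delta> 0"
    and A: "A \<subseteq> \<Union>\<Delta>" "A \<noteq> {}" "\<And>a b. a \<in> A \<Longrightarrow> {a, b} \<in> \<Delta> \<Longrightarrow> b \<in> A"
  shows "A = \<Union>\<Delta>"
proof (rule ccontr)
  assume "A \<noteq> \<Union>\<Delta>"
  then obtain a b where ab: "a \<in> A" "b \<in> \<Union>\<Delta>" "b \<notin> A" using A by blast
  have fin: "finite (\<Union>\<Delta>)" using sc by (simp add: simplicial_complex_def)
  have single: "{x} \<in> \<Delta>" if "x \<in> \<Union>\<Delta>" for x using that sc by (auto simp: simplicial_complex_def)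
  define c where "c s = (if s = [a] then 1 else if s = [b] then -1 else (0 :: 'k))" for s
  have c: "c \<in> chains \<Delta> 0"
    using single ab A(1) by (intro chainsI) (auto simp: c_def append_eq_Cons_conv split: if_splits)
  have "boundary \<Delta> c s = 0" for s
  proof (cases s)
    case Nil
    have "boundary \<Delta> c s = (\<Sum>v\<in>\<Union>\<Delta>. (if v = a then 1 else 0) + (if v = b then -1 else 0))"
      unfolding boundary_def Nil using ab by (intro sum.cong refl) (auto simp: c_def)
    also have "\<dots> = 0" using fin ab A(1) by (simp add: sum.distrib subset_iff)
    finally show ?thesis .
  next
    case (Cons x xs)
    then show ?thesis by (simp add: boundary_def c_def)
  qed
  then have "c \<in> cycles \<Delta> 0" using c by (auto simp: cycles_def)
  then obtain e where e: "e \<in> chains \<Delta> 1" "c = boundary \<Delta> e"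
    using cycles_eq_boundaries[OF sc zero] by (auto simp: boundaries_def)
  have "(\<Sum>x\<in>A. c [x]) = (\<Sum>x\<in>A. \<Sum>v\<in>A. e [v, x])"
  proof (rule sum.cong[OF refl])
    fix x assume x: "x \<in> A"
    have "e [v, x] = 0" if "v \<notin> A" for v
    proof (rule ccontr)
      assume "e [v, x] \<noteq> 0"
      then have "{x, v} \<in> \<Delta>" using chains_supp(2)[OF e(1)] by (force simp: insert_commute)
      then show False using A(3)[OF x] that by blast
    qed
    then show "c [x] = (\<Sum>v\<in>A. e [v, x])"
      unfolding e(2) boundary_def using fin A(1) by (intro sum.mono_neutral_right) auto
  qed
  also have "\<dots> = 0"
  proof (rule antisym_sum_zero)
    show "finite A" using fin A(1) finite_subset by blast
    show "e [v, u] = - e [u, v]" for u v using chains_swap[OF e(1), of "[]" v u "[]"] by simp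
    show "e [u, u] = 0" for u by (rule chains_repeat[OF e(1)]) simp
  qed
  also have "(\<Sum>x\<in>A. c [x]) = (\<Sum>x\<in>A. if x = a then 1 else 0)"
    using ab by (intro sum.cong refl) (auto simp: c_def)
  also have "\<dots> = 1" using ab finite_subset[OF A(1) fin] by simp
  finally show False by simp
qed

section \<open>The graph of a flag complex\<close>

definition edge :: "'a set set \<Rightarrow> 'a \<Rightarrow> 'a \<Rightarrow> bool" where
  "edge \<Delta> u v \<longleftrightarrow> u \<noteq> v \<and> {u, v} \<in> \<Delta>"

lemma ugraph_edge: "ugraph (edge \<Delta>)"
  by unfold_locales (auto simp: edge_def insert_commute)

lemma flag_face:
  assumes "simplicial_complex \<Delta>" "flag_complex \<Delta>" "f \<subseteq> \<Union>\<Delta>" "finite f"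
    and "\<And>x y. x \<in> f \<Longrightarrow> y \<in> f \<Longrightarrow> x \<noteq> y \<Longrightarrow> {x, y} \<in> \<Delta>"
  shows "f \<in> \<Delta>"
  using assms(4,3,5)
proof (induction f rule: finite_psubset_induct)
  case (psubset f)
  have sub: "g \<in> \<Delta>" if g: "g \<subset> f" for g
  proof (rule psubset.IH[OF g])
    show "g \<subseteq> \<Union>\<Delta>" using psubset.prems(1) g by blast
    show "{x, y} \<in> \<Delta>" if "x \<in> g" "y \<in> g" "x \<noteq> y" for x y
      using psubset.prems(2)[of x y] that g by blast
  qed
  show ?case
  proof (rule ccontr)
    assume nf: "f \<notin> \<Delta>"
    then have "card f = 2"
      using assms(2) psubset.prems(1) sub unfolding flag_complex_def by blast
    then obtain x y where "f = {x, y}" "x \<noteq> y" by (auto simp: card_2_iff)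
    then show False using psubset.prems(2)[of x y] nf by simp
  qed
qed

lemma flag_eq_cliques:
  assumes "simplicial_complex \<Delta>" "flag_complex \<Delta>"
  shows "ugraph.cliques (edge \<Delta>) (\<Union>\<Delta>) = \<Delta>"
proof -
  interpret ugraph "edge \<Delta>" by (rule ugraph_edge)
  show ?thesis
  proof
    show "cliques (\<Union>\<Delta>) \<subseteq> \<Delta>"
      using flag_face[OF assms] by (auto simp: cliques_def edge_def)
    show "\<Delta> \<subseteq> cliques (\<Union>\<Delta>)"
    proof
      fix f assume f: "f \<in> \<Delta>"
      have "{x, y} \<in> \<Delta>" if "x \<in> f" "y \<in> f" for x y
        using f that assms(1) unfolding simplicial_complex_def by (metis empty_subsetI insert_subset)
      then show "f \<in> cliques (\<Union>\<Delta>)"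
        using f simplicial_complexD(5)[OF assms(1)] by (auto simp: cliques_def edge_def)
    qed
  qed
qed

lemma pure_card_le:
  assumes "simplicial_complex \<Delta>" "pure_complex d \<Delta>" "f \<in> \<Delta>"
  shows "\<exists>g\<in>\<Delta>. f \<subseteq> g \<and> card g = d"
proof -
  have "\<exists>g\<in>\<Delta>. f \<subseteq> g \<and> (\<forall>h\<in>\<Delta>. g \<subseteq> h \<longrightarrow> g = h)"
    using finite_has_maximal2[OF simplicial_complexD(4)[OF assms(1)] assms(3)] by blast
  then show ?thesis using assms(2) unfolding pure_complex_def by metis
qed

text \<open>Induction on n = d - \<open>card f\<close>, for all faces at once. By purity the link is
  empty exactly for n = 0. Its homology gives the Euler value, and for n \<ge> 2 also connectedness,
  since degree 0 is then below the top degree n - 1.\<close>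

lemma homology_sphere_sph:
  assumes "homology_sphere TYPE('k::field) d \<Delta>" "flag_complex \<Delta>"
  shows "ugraph.sph (edge \<Delta>) d (\<Union>\<Delta>)"
proof -
  interpret ugraph "edge \<Delta>" by (rule ugraph_edge)
  let ?V = "\<Union>\<Delta>"
  have sc: "simplicial_complex \<Delta>" and pure: "pure_complex d \<Delta>"
    and zero: "\<And>f i. f \<in> \<Delta> \<Longrightarrow> i < int d - 1 - int (card f) \<Longrightarrow> homology_zero TYPE('k) (link \<Delta> f) i"
    and top: "\<And>f. f \<in> \<Delta> \<Longrightarrow> homology_iso_field TYPE('k) (link \<Delta> f) (int d - 1 - int (card f))"
    using assms(1) unfolding homology_sphere_def by blast+
  have cl: "cliques ?V = \<Delta>" by (rule flag_eq_cliques[OF sc assms(2)])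
  have fin: "finite ?V" using sc by (simp add: simplicial_complex_def)
  have link: "link \<Delta> f = cliques (lk ?V f)" if f: "f \<in> \<Delta>" for f
  proof -
    have f': "f \<in> cliques ?V" using f cl by simp
    show ?thesis
    proof
      show "link \<Delta> f \<subseteq> cliques (lk ?V f)"
      proof
        fix g assume "g \<in> link \<Delta> f"
        then have gf: "g \<union> f \<in> cliques ?V" "g \<inter> f = {}" by (simp_all add: link_def cl)
        then have *: "g \<in> cliques ?V" by (auto intro: clique_subset)
        have "edge \<Delta> y x" if "y \<in> f" "x \<in> g" for x y
        proof -
          have "y \<noteq> x" using that gf(2) by blast
          then show ?thesis using gf(1) that by (simp add: cliques_def)
        qed
        then show "g \<in> cliques (lk ?V f)" using * by (auto simp: cliques_def lk_def)
      qed
      show "cliques (lk ?V f) \<subseteq> link \<Delta> f"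
      proof
        fix g assume g: "g \<in> cliques (lk ?V f)"
        have "g \<inter> f = {}" using g irrefl by (auto simp: cliques_def lk_def)
        moreover have "g \<union> f \<in> cliques ?V" using g f' sym by (auto simp: cliques_def lk_def)
        moreover have "g \<in> cliques ?V" using g by (auto simp: cliques_def lk_def)
        ultimately show "g \<in> link \<Delta> f" unfolding cl by (simp add: link_def)
      qed
    qed
  qed
  have "sph n (lk ?V f)" if "f \<in> \<Delta>" "card f + n = d" for n f
    using that
  proof (induction n arbitrary: f)
    case 0
    obtain g where "g \<in> \<Delta>" "f \<subseteq> g" "card g = d" using pure_card_le[OF sc pure 0(1)] by blast
    have "lk ?V f = {}"
    proof (rule ccontr)
      assume "lk ?V f \<noteq> {}"
      then obtain x where x: "x \<in> lk ?V f" by blast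
      then have "{x} \<in> link \<Delta> f" unfolding link[OF 0(1)] by (auto simp: cliques_def)
      then have xf: "insert x f \<in> \<Delta>" "x \<notin> f" by (auto simp: link_def)
      obtain h where h: "h \<in> \<Delta>" "insert x f \<subseteq> h" "card h = d" using pure_card_le[OF sc pure xf(1)] by blast
      then have "card (insert x f) \<le> d" using simplicial_complexD(5)[OF sc h(1)] card_mono by metis
      then show False using xf(2) 0 simplicial_complexD(5)[OF sc 0(1)] by simp
    qed
    then show ?case by simp
  next
    case (Suc n)
    let ?L = "lk ?V f"
    have scl: "simplicial_complex (link \<Delta> f)" by (rule simplicial_complex_link[OF sc Suc.prems(1)])
    have finf: "finite f" using simplicial_complexD(5)[OF sc Suc.prems(1)] .
    have "?L \<subseteq> ?V" by (auto simp: lk_def)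
    then have "finite ?L" using fin finite_subset by blast
    moreover have "?L \<noteq> {}"
    proof
      assume e: "?L = {}"
      obtain g where g: "g \<in> \<Delta>" "f \<subseteq> g" "card g = d" using pure_card_le[OF sc pure Suc.prems(1)] by blast
      have "g - f \<in> \<Delta>" "(g - f) \<union> f = g" using g sc by (auto simp: simplicial_complex_def)
      then have "g - f \<in> link \<Delta> f" using g by (auto simp: link_def)
      then have "g - f = {}" unfolding link[OF Suc.prems(1)] e by (auto simp: cliques_def)
      then have "g = f" using g by blast
      then show False using g Suc.prems(2) by simp
    qed
    moreover have "sph n (nb ?L v)" if v: "v \<in> ?L" for v
    proof -
      have "{v} \<in> link \<Delta> f" using v unfolding link[OF Suc.prems(1)] by (auto simp: cliques_def)
      then have vf: "insert v f \<in> \<Delta>" "v \<notin> f" by (auto simp: link_def)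
      have "nb ?L v = lk ?V (insert v f)" by (auto simp: nb_def lk_def)
      moreover have "card (insert v f) + n = d" using vf finf Suc.prems(2) by simp
      ultimately show ?thesis using Suc.IH[OF vf(1)] by simp
    qed
    moreover have "poly (fpoly ?L) (-1) = (-1) ^ Suc n"
    proof -
      have d: "int d - 1 - int (card f) = int (Suc n) - 1" using Suc.prems(2) by simp
      have "card g \<le> Suc n" if g: "g \<in> link \<Delta> f" for g
      proof -
        have gf: "g \<inter> f = {}" "g \<union> f \<in> \<Delta>" "finite g"
          using g simplicial_complexD(5)[OF scl g] by (auto simp: link_def)
        obtain h where h: "h \<in> \<Delta>" "g \<union> f \<subseteq> h" "card h = d" using pure_card_le[OF sc pure gf(2)] by blast
        then have "card (g \<union> f) \<le> d" using simplicial_complexD(5)[OF sc h(1)] card_mono by metis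
        then show ?thesis using gf finf Suc.prems(2) by (simp add: card_Un_disjoint)
      qed
      then have "poly (face_poly (link \<Delta> f)) (-1) = (-1) ^ Suc n"
        using zero[OF Suc.prems(1), unfolded d] top[OF Suc.prems(1), unfolded d]
        by (intro euler_characteristic[OF scl])
      then show ?thesis by (simp add: face_poly_def fpoly_def link[OF Suc.prems(1)])
    qed
    moreover have "connected_on ?L" if "n \<ge> 1"
      unfolding connected_on_def
    proof (intro allI impI)
      fix A assume A: "A \<subseteq> ?L" "A \<noteq> {}" "\<forall>a\<in>A. nb ?L a \<subseteq> A"
      have UL: "\<Union>(link \<Delta> f) = ?L" unfolding link[OF Suc.prems(1)] by (rule Union_cliques)
      have "homology_zero TYPE('k) (link \<Delta> f) 0"
        using zero[OF Suc.prems(1), of 0] Suc.prems(2) that by simp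
      then have "A = \<Union>(link \<Delta> f)"
      proof (rule connected_if_homology_zero[OF scl _ _ A(2)])
        show "A \<subseteq> \<Union>(link \<Delta> f)" using A(1) UL by simp
        fix a b assume ab: "a \<in> A" "{a, b} \<in> link \<Delta> f"
        then show "b \<in> A" using A(3) unfolding link[OF Suc.prems(1)]
          by (cases "a = b") (auto simp: cliques_def nb_def)
      qed
      then show "A = ?L" using UL by simp
    qed
    ultimately show ?case by simp
  qed
  from this[of "{}" d] show ?thesis using sc by (simp add: lk_empty simplicial_complex_def)
qed

section \<open>Face polynomials of the two types\<close>

text \<open>Multiplication by the first polynomial is suspension; the second one is \<open>t (1 + t)\<close>, the image of
  \<open>z\<close> in the \<open>\<gamma>\<close>-expansion.\<close>

abbreviation P\<alpha> :: "int poly" where "P\<alpha> \<equiv> [:1,2:]"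
abbreviation P\<beta> :: "int poly" where "P\<beta> \<equiv> [:0,1,1:]"
abbreviation C5 :: "nat set set" where "C5 \<equiv> cycle_complex 5"
abbreviation C6 :: "nat set set" where "C6 \<equiv> cycle_complex 6"

lemma Union_join_power:
  assumes "{} \<in> X"
  shows "{} \<in> join_power j X \<and> \<Union>(join_power j X) = {..<j} \<times> \<Union>X"
proof (induction j)
  case (Suc j)
  have r: "{} \<in> relabel (Pair j) X" using assms by (auto simp: relabel_def)
  have "{} \<union> {} \<in> join (join_power j X) (relabel (Pair j) X)"
    using Suc r unfolding join_def by blast
  moreover have "\<Union>(join_power (Suc j) X) = {..<j} \<times> \<Union>X \<union> Pair j ` \<Union>X"
    using Suc r by (simp add: Union_join Union_relabel)
  ultimately show ?case by auto
qed simp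

lemma join_power_disjoint:
  "{} \<in> X \<Longrightarrow> \<Union>(join_power j X) \<inter> \<Union>(relabel (Pair j) X) = {}"
  using Union_join_power[of X j] by (auto simp: Union_relabel)

lemma simplicial_complex_join_power:
  assumes "simplicial_complex X"
  shows "simplicial_complex (join_power j X)"
proof (induction j)
  case 0
  then show ?case by (simp add: simplicial_complex_def)
next
  case (Suc j)
  then show ?case
    using simplicial_complex_join[OF Suc simplicial_complex_relabel[OF assms]]
      join_power_disjoint[OF simplicial_complexD(2)[OF assms]] by simp
qed

lemma Union_suspension_power:
  assumes "{} \<in> X"
  shows "{} \<in> suspension_power m X \<and> \<Union>(suspension_power m X) = suspension_vertices m \<union> Inr ` \<Union>X"
proof (induction m)
  case 0
  then show ?case using assms by (auto simp: relabel_def suspension_vertices_def)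
next
  case (Suc m)
  let ?S = "{{}, {Inl (m, False)}, {Inl (m, True)}}"
  have "{} \<union> {} \<in> join ?S (suspension_power m X)"
    using Suc unfolding join_def by blast
  moreover have "\<Union>(suspension_power (Suc m) X) = {Inl (m, False), Inl (m, True)} \<union> (suspension_vertices m \<union> Inr ` \<Union>X)"
    using Suc by (auto simp: Union_join)
  moreover have "suspension_vertices (Suc m) = {Inl (m, False), Inl (m, True)} \<union> suspension_vertices m"
    by (auto simp: suspension_vertices_def less_Suc_eq)
  ultimately show ?case by auto
qed

lemma suspension_power_disjoint:
  assumes "{} \<in> X"
  shows "\<Union>{{}, {Inl (m, False)}, {Inl (m, True)}} \<inter> \<Union>(suspension_power m X) = {}"
  using Union_suspension_power[OF assms, of m] by (auto simp: suspension_vertices_def)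

lemma simplicial_complex_suspension_power:
  assumes "simplicial_complex X"
  shows "simplicial_complex (suspension_power m X)"
proof (induction m)
  case 0
  then show ?case using simplicial_complex_relabel[OF assms] by simp
next
  case (Suc m)
  show ?case
    unfolding suspension_power.simps
    by (rule simplicial_complex_join[OF simplicial_complex_two_points Suc
          suspension_power_disjoint[OF simplicial_complexD(2)[OF assms]]])
qed

lemma face_poly_join_power:
  assumes "simplicial_complex X"
  shows "face_poly (join_power j X) = face_poly X ^ j"
proof (induction j)
  case 0
  then show ?case by (simp add: face_poly_def one_poly_eq_simps)
next
  case (Suc j)
  have "face_poly (join_power (Suc j) X) = face_poly (join_power j X) * face_poly (relabel (Pair j) X)"
    unfolding join_power.simps
    by (rule face_poly_join[OF simplicial_complex_join_power[OF assms] simplicial_complex_relabel[OF assms]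
          join_power_disjoint[OF simplicial_complexD(2)[OF assms]]])
  also have "face_poly (relabel (Pair j) X) = face_poly X"
    by (rule face_poly_relabel) (auto simp: inj_on_def)
  finally show ?case using Suc by simp
qed

lemma face_poly_suspension_step:
  fixes X :: "'a set set"
  assumes "simplicial_complex X"
  shows "face_poly (suspension_power (Suc m) X) = P\<alpha> * face_poly (suspension_power m X)"
proof -
  have "face_poly (suspension_power (Suc m) X) =
      face_poly {{}, {Inl (m, False)}, {Inl (m, True) :: nat \<times> bool + 'a}} * face_poly (suspension_power m X)"
    unfolding suspension_power.simps
    by (rule face_poly_join[OF simplicial_complex_two_points simplicial_complex_suspension_power[OF assms]
          suspension_power_disjoint[OF simplicial_complexD(2)[OF assms]]])
  then show ?thesis by (simp add: face_poly_two_points)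
qed

lemma face_poly_suspension_power:
  assumes "simplicial_complex X"
  shows "face_poly (suspension_power m X) = P\<alpha> ^ m * face_poly X"
proof (induction m)
  case 0
  then show ?case by (simp add: face_poly_relabel inj_on_def)
next
  case (Suc m)
  then show ?case unfolding face_poly_suspension_step[OF assms] Suc by (simp only: power_Suc mult.assoc)
qed

lemma link_join_left:
  assumes "simplicial_complex A" "simplicial_complex B" "\<Union>A \<inter> \<Union>B = {}" "f \<in> A"
  shows "link (join A B) f = join (link A f) B"
  using link_join[OF assms simplicial_complexD(2)[OF assms(2)]] by (simp add: link_empty)

lemma link_join_right:
  assumes "simplicial_complex A" "simplicial_complex B" "\<Union>A \<inter> \<Union>B = {}" "g \<in> B"
  shows "link (join A B) g = join A (link B g)"
  using link_join[OF assms(1-3) simplicial_complexD(2)[OF assms(1)] assms(4)] by (simp add: link_empty)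

lemma Union_link_subset: "\<Union>(link X f) \<subseteq> \<Union>X"
  by (auto simp: link_def)

lemma face_poly_link_left:
  assumes "simplicial_complex A" "simplicial_complex B" "\<Union>A \<inter> \<Union>B = {}" "f \<in> A"
  shows "face_poly (link (join A B) f) = face_poly (link A f) * face_poly B"
  unfolding link_join_left[OF assms]
  using Union_link_subset[of A f] assms(3)
  by (intro face_poly_join simplicial_complex_link assms(1,2,4)) blast

lemma face_poly_link_right:
  assumes "simplicial_complex A" "simplicial_complex B" "\<Union>A \<inter> \<Union>B = {}" "g \<in> B"
  shows "face_poly (link (join A B) g) = face_poly A * face_poly (link B g)"
  unfolding link_join_right[OF assms]
  using Union_link_subset[of B g] assms(3)
  by (intro face_poly_join simplicial_complex_link assms(1,2,4)) blast

lemma vertex_face: "simplicial_complex X \<Longrightarrow> x \<in> \<Union>X \<Longrightarrow> {x} \<in> X"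
  by (auto simp: simplicial_complex_def)

text \<open>One pentagon is replaced by the two neighbours of \<open>x\<close> in it, that is, by a
  suspension. The pentagon factor on the left avoids the exponent j - 1 and is cancelled
  later.\<close>

lemma face_poly_link_join_power_C5:
  assumes "x \<in> \<Union>(join_power j C5)"
  shows "(P\<alpha>^2 + P\<beta>) * face_poly (link (join_power j C5) {x}) = P\<alpha> * (P\<alpha>^2 + P\<beta>) ^ j"
  using assms
proof (induction j)
  case (Suc j)
  let ?A = "join_power j C5" and ?B = "relabel (Pair j) C5"
  note sc = simplicial_complex_join_power[OF simplicial_complex_cycle, of j 5]
    simplicial_complex_relabel[OF simplicial_complex_cycle, of "Pair j" 5]
    join_power_disjoint[OF simplicial_complexD(2)[OF simplicial_complex_cycle], of j 5]
  have FB: "face_poly ?B = P\<alpha>^2 + P\<beta>"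
    using face_poly_relabel[of "Pair j" C5] by (simp add: inj_on_def face_poly_C5)
  have "x \<in> \<Union>?A \<or> x \<in> \<Union>?B"
    using Suc.prems simplicial_complexD(2)[OF sc(1)] simplicial_complexD(2)[OF sc(2)]
    by (simp add: Union_join)
  then show ?case
  proof
    assume x: "x \<in> \<Union>?A"
    have "face_poly (link (join_power (Suc j) C5) {x}) = face_poly (link ?A {x}) * (P\<alpha>^2 + P\<beta>)"
      unfolding join_power.simps FB[symmetric]
      by (rule face_poly_link_left[OF sc vertex_face[OF sc(1) x]])
    then show ?thesis using Suc.IH[OF x] by (simp only: mult.assoc[symmetric] power_Suc2)
  next
    assume x: "x \<in> \<Union>?B"
    then obtain i where i: "i < 5" "x = (j, i)" by (auto simp: Union_relabel Union_cycle_complex)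
    have "face_poly (link (join_power (Suc j) C5) {x}) = face_poly ?A * face_poly (link ?B {x})"
      unfolding join_power.simps by (rule face_poly_link_right[OF sc vertex_face[OF sc(2) x]])
    moreover have "link ?B (Pair j ` {i}) = relabel (Pair j) (link C5 {i})"
      using i(1) vertex_face[OF simplicial_complex_cycle, of i 5]
      by (intro link_relabel) (auto simp: inj_on_def Union_cycle_complex)
    then have "face_poly (link ?B {x}) = P\<alpha>"
      using face_poly_relabel[of "Pair j" "link C5 {i}"] face_poly_link_C5[OF i(1)] i(2)
      by (simp add: inj_on_def)
    moreover have "face_poly ?A = (P\<alpha>^2 + P\<beta>) ^ j"
      by (simp only: face_poly_join_power[OF simplicial_complex_cycle] face_poly_C5)
    ultimately show ?thesis by (simp only: power_Suc mult.assoc mult.commute mult.left_commute)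
  qed
qed simp

context
  fixes X :: "'a set set"
  assumes X: "simplicial_complex X"
begin

lemma face_poly_link_base:
  assumes "x \<in> \<Union>X"
  shows "face_poly (link (suspension_power m X) {Inr x}) = P\<alpha> ^ m * face_poly (link X {x})"
proof (induction m)
  case 0
  have "link (relabel (Inr :: 'a \<Rightarrow> nat \<times> bool + 'a) X) (Inr ` {x}) = relabel Inr (link X {x})"
    by (rule link_relabel) (auto simp: inj_on_def vertex_face[OF X assms])
  then show ?case by (simp add: face_poly_relabel inj_on_def)
next
  case (Suc m)
  have "{Inr x} \<in> suspension_power m X"
    using Union_suspension_power[OF simplicial_complexD(2)[OF X], of m] assms
    by (intro vertex_face simplicial_complex_suspension_power X) auto
  then have "face_poly (link (suspension_power (Suc m) X) {Inr x}) =
      face_poly {{}, {Inl (m, False)}, {Inl (m, True) :: nat \<times> bool + 'a}} * face_poly (link (suspension_power m X) {Inr x})"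
    unfolding suspension_power.simps
    by (intro face_poly_link_right simplicial_complex_two_points simplicial_complex_suspension_power X
        suspension_power_disjoint[OF simplicial_complexD(2)[OF X]])
  moreover have "Inl (m, False) \<noteq> (Inl (m, True) :: nat \<times> bool + 'a)" by simp
  ultimately show ?case unfolding Suc by (simp only: face_poly_two_points simp_thms power_Suc mult.assoc)
qed

lemma link_two_points: "x \<noteq> y \<Longrightarrow> link {{}, {x}, {y}} {x} = {{}}"
  by (auto simp: link_def)

lemma face_poly_link_top:
  assumes "u = Inl (m, b)" "f \<in> suspension_power m X"
  shows "face_poly (link (suspension_power (Suc m) X) ({u} \<union> f)) = face_poly (link (suspension_power m X) f)"
proof -
  let ?S = "{{}, {Inl (m, False)}, {Inl (m, True) :: nat \<times> bool + 'a}}"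
  have lS: "link ?S {u} = {{}}"
  proof (cases b)
    case True
    have "?S = {{}, {Inl (m, True)}, {Inl (m, False)}}" by auto
    then show ?thesis using True assms(1) link_two_points[of "Inl (m, True)" "Inl (m, False)"] by simp
  next
    case False
    then show ?thesis using assms(1) link_two_points[of "Inl (m, False)" "Inl (m, True)"] by simp
  qed
  have "{u} \<in> ?S" using assms(1) by (cases b) auto
  then have "link (suspension_power (Suc m) X) ({u} \<union> f) = join (link ?S {u}) (link (suspension_power m X) f)"
    unfolding suspension_power.simps
    by (intro link_join simplicial_complex_two_points simplicial_complex_suspension_power X
        suspension_power_disjoint[OF simplicial_complexD(2)[OF X]] assms(2))
  also have "\<dots> = link (suspension_power m X) f" unfolding lS by (simp add: join_def)
  finally show ?thesis by simp
qed

lemma face_poly_link_lower: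
  assumes "f \<in> suspension_power m X"
  shows "face_poly (link (suspension_power (Suc m) X) f) = P\<alpha> * face_poly (link (suspension_power m X) f)"
proof -
  have "face_poly (link (suspension_power (Suc m) X) f) =
      face_poly {{}, {Inl (m, False)}, {Inl (m, True) :: nat \<times> bool + 'a}} * face_poly (link (suspension_power m X) f)"
    unfolding suspension_power.simps
    by (intro face_poly_link_right simplicial_complex_two_points simplicial_complex_suspension_power X
        suspension_power_disjoint[OF simplicial_complexD(2)[OF X]] assms)
  then show ?thesis by (simp add: face_poly_two_points)
qed

lemma suspension_vertex_face:
  "u \<in> suspension_vertices m \<Longrightarrow> {u} \<in> suspension_power m X"
  using Union_suspension_power[OF simplicial_complexD(2)[OF X], of m]
  by (intro vertex_face simplicial_complex_suspension_power X) auto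

lemma suspension_vertices_Suc:
  "u \<in> suspension_vertices (Suc m) \<longleftrightarrow> u \<in> suspension_vertices m \<or> (\<exists>b. u = Inl (m, b))"
  by (auto simp: suspension_vertices_def less_Suc_eq)

text \<open>Taking the link of \<open>u\<close> drops one suspension; the factor on the left
  restores it and avoids the exponent m - 1.\<close>

lemma face_poly_link_suspension_vertex:
  assumes "u \<in> suspension_vertices m"
  shows "P\<alpha> * face_poly (link (suspension_power m X) {u}) = face_poly (suspension_power m X)"
  using assms
proof (induction m)
  case 0
  then show ?case by (simp add: suspension_vertices_def)
next
  case (Suc m)
  from Suc.prems consider "u \<in> suspension_vertices m" | b where "u = Inl (m, b)"
    using suspension_vertices_Suc by blast
  then show ?case
  proof cases
    case 1
    show ?thesis
      unfolding face_poly_link_lower[OF suspension_vertex_face[OF 1]] Suc.IH[OF 1]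
        face_poly_suspension_step[OF X] ..
  next
    case (2 b)
    then show ?thesis
      using face_poly_link_top[OF 2 simplicial_complexD(2)[OF simplicial_complex_suspension_power[OF X]]]
      by (simp only: face_poly_suspension_step[OF X] link_empty Un_empty_right)
  qed
qed

text \<open>In the link of \<open>v\<close> the vertex \<open>u\<close> is still a suspension
  vertex, because no edge joins the two apices of one suspension. The induction peels off the
  outermost suspension, which may contain \<open>u\<close>, \<open>v\<close> or neither.\<close>

lemma face_poly_link_suspension_edge:
  assumes "u \<in> suspension_vertices m" "{u, v} \<in> suspension_power m X" "u \<noteq> v"
  shows "P\<alpha> * face_poly (link (suspension_power m X) {u, v}) = face_poly (link (suspension_power m X) {v})"
  using assms
proof (induction m)
  case 0
  then show ?case by (simp add: suspension_vertices_def)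
next
  case (Suc m)
  let ?S = "{{}, {Inl (m, False)}, {Inl (m, True) :: nat \<times> bool + 'a}}"
  note dis = suspension_power_disjoint[OF simplicial_complexD(2)[OF X], of m]
  note scm = simplicial_complex_suspension_power[OF X, of m]
  have e: "{u, v} \<subseteq> \<Union>?S \<union> \<Union>(suspension_power m X)" "{u, v} \<inter> \<Union>?S \<in> ?S"
    "{u, v} \<inter> \<Union>(suspension_power m X) \<in> suspension_power m X"
    using Suc.prems(2) unfolding suspension_power.simps in_join_iff[OF dis] by blast+
  have top: "w \<in> \<Union>?S \<longleftrightarrow> (\<exists>b. w = Inl (m, b))" for w :: "nat \<times> bool + 'a"
    by auto
  show ?case
  proof (cases "u \<in> \<Union>?S")
    case True
    then obtain b where b: "u = Inl (m, b)" using top by blast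
    have "v \<notin> \<Union>?S"
    proof
      assume "v \<in> \<Union>?S"
      then have "{u, v} \<inter> \<Union>?S = {u, v}" using True by blast
      then have "{u, v} \<in> ?S" using e(2) by simp
      then show False using Suc.prems(3) by (auto simp: doubleton_eq_iff)
    qed
    then have "v \<in> \<Union>(suspension_power m X)" using e(1) by blast
    then have v: "{v} \<in> suspension_power m X" by (rule vertex_face[OF scm])
    have "face_poly (link (suspension_power (Suc m) X) ({u} \<union> {v})) = face_poly (link (suspension_power m X) {v})"
      by (rule face_poly_link_top[OF b v])
    then show ?thesis unfolding face_poly_link_lower[OF v] by (simp only: insert_is_Un[symmetric])
  next
    case False
    then have u: "u \<in> suspension_vertices m" using Suc.prems(1) suspension_vertices_Suc top by blast
    show ?thesis
    proof (cases "v \<in> \<Union>?S")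
      case True
      then obtain b where b: "v = Inl (m, b)" using top by blast
      have 1: "face_poly (link (suspension_power (Suc m) X) ({v} \<union> {u})) = face_poly (link (suspension_power m X) {u})"
        by (rule face_poly_link_top[OF b suspension_vertex_face[OF u]])
      have 2: "face_poly (link (suspension_power (Suc m) X) ({v} \<union> {})) = face_poly (link (suspension_power m X) {})"
        by (rule face_poly_link_top[OF b simplicial_complexD(2)[OF scm]])
      have 3: "{v} \<union> {u} = {u, v}" by blast
      show ?thesis using 1 2 face_poly_link_suspension_vertex[OF u]
        unfolding 3 Un_empty_right link_empty by simp
    next
      case False
      then have "{u, v} \<inter> \<Union>(suspension_power m X) = {u, v}"
        using e(1) \<open>u \<notin> \<Union>?S\<close> by blast
      then have uv: "{u, v} \<in> suspension_power m X" using e(3) by simp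
      then have "{v} \<in> suspension_power m X" using simplicial_complexD(3)[OF scm uv, of "{v}"] by blast
      then show ?thesis unfolding face_poly_link_lower[OF uv] using Suc.IH[OF u uv Suc.prems(3)]
        by (simp only: face_poly_link_lower mult.assoc)
    qed
  qed
qed

end

lemma has_gamma_C5_power:
  "has_gamma (m + 2 * k) (P\<alpha> ^ m * (P\<alpha>^2 + P\<beta>) ^ k) (\<lambda>j. int (k choose j))"
proof (induction m)
  case 0
  show ?case
  proof (induction k)
    case 0
    then show ?case using has_gamma_1 by (auto elim!: has_gamma_ext)
  next
    case (Suc k)
    have "has_gamma (Suc (Suc (2 * k))) (P\<alpha> * (P\<alpha> * (P\<alpha>^2 + P\<beta>) ^ k) + P\<beta> * (P\<alpha>^2 + P\<beta>) ^ k)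
        (\<lambda>j. int (k choose j) + case_nat 0 (\<lambda>j. int (k choose j)) j)"
      using Suc by (intro has_gamma_add has_gamma_susp has_gamma_shift) simp_all
    moreover have "P\<alpha> * (P\<alpha> * (P\<alpha>^2 + P\<beta>) ^ k) + P\<beta> * (P\<alpha>^2 + P\<beta>) ^ k = P\<alpha> ^ 0 * (P\<alpha>^2 + P\<beta>) ^ Suc k"
      by (simp only: power_Suc power_0 power2_eq_square distrib_right mult.assoc mult_1_left)
    moreover have "(\<lambda>j. int (k choose j) + case_nat 0 (\<lambda>j. int (k choose j)) j) = (\<lambda>j. int (Suc k choose j))"
      by (auto simp: fun_eq_iff split: nat.splits)
    ultimately show ?case by simp
  qed
next
  case (Suc m)
  then show ?case using has_gamma_susp by (simp only: power_Suc mult.assoc add_Suc)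
qed

text \<open>The \<gamma>-polynomial is (1 + t)^k (1 + 2t), with leading coefficient 2 at t^(k + 1).
  Both types lead to it with k = l - 2, the second one if the edge has an end in a pentagon.\<close>

lemma has_gamma_types:
  "has_gamma (m + 2 * k + 2) (P\<alpha> ^ m * (P\<alpha>^2 + P\<beta>) ^ k * (P\<alpha>^2 + P\<beta> + P\<beta>))
    (\<lambda>j. int (Suc k choose j) + case_nat 0 (\<lambda>j. int (k choose j)) j)"
proof -
  have "has_gamma (Suc (Suc (m + 2 * k))) (P\<alpha> ^ m * (P\<alpha>^2 + P\<beta>) ^ Suc k + P\<beta> * (P\<alpha> ^ m * (P\<alpha>^2 + P\<beta>) ^ k))
    (\<lambda>j. int (Suc k choose j) + case_nat 0 (\<lambda>j. int (k choose j)) j)"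
    using has_gamma_C5_power[of m "Suc k"] has_gamma_C5_power[of m k]
    by (intro has_gamma_add has_gamma_shift) simp_all
  moreover have "P\<alpha> ^ m * (P\<alpha>^2 + P\<beta>) ^ Suc k + P\<beta> * (P\<alpha> ^ m * (P\<alpha>^2 + P\<beta>) ^ k) =
      P\<alpha> ^ m * (P\<alpha>^2 + P\<beta>) ^ k * (P\<alpha>^2 + P\<beta> + P\<beta>)"
    by (simp only: power_Suc algebra_simps)
  ultimately show ?thesis by simp
qed

section \<open>Recognising the two types\<close>

lemma complex_iso_iff: "complex_iso \<Delta> \<Gamma> \<longleftrightarrow> (\<exists>\<phi>. inj_on \<phi> (\<Union>\<Delta>) \<and> \<Gamma> = relabel \<phi> \<Delta>)"
proof
  assume "complex_iso \<Delta> \<Gamma>"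
  then show "\<exists>\<phi>. inj_on \<phi> (\<Union>\<Delta>) \<and> \<Gamma> = relabel \<phi> \<Delta>"
    unfolding complex_iso_def relabel_def bij_betw_def by blast
next
  assume "\<exists>\<phi>. inj_on \<phi> (\<Union>\<Delta>) \<and> \<Gamma> = relabel \<phi> \<Delta>"
  then obtain \<phi> where \<phi>: "inj_on \<phi> (\<Union>\<Delta>)" "\<Gamma> = relabel \<phi> \<Delta>" by blast
  then have "bij_betw \<phi> (\<Union>\<Delta>) (\<Union>\<Gamma>)" by (simp add: bij_betw_def Union_relabel)
  then show "complex_iso \<Delta> \<Gamma>" using \<phi>(2) unfolding complex_iso_def relabel_def by blast
qed

lemma relabel_relabel: "relabel \<psi> (relabel \<phi> X) = relabel (\<lambda>x. \<psi> (\<phi> x)) X"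
  by (simp add: relabel_def image_image)

lemma relabel_cong:
  assumes "\<And>x. x \<in> \<Union>X \<Longrightarrow> \<phi> x = \<psi> x"
  shows "relabel \<phi> X = relabel \<psi> X"
  unfolding relabel_def using assms by (intro image_cong refl) auto

lemma relabel_id: "relabel (\<lambda>x. x) X = X"
  by (simp add: relabel_def)

lemma complex_iso_relabel: "inj_on \<phi> (\<Union>X) \<Longrightarrow> complex_iso X (relabel \<phi> X)"
  unfolding complex_iso_iff by blast

lemma complex_iso_trans:
  assumes "complex_iso A B" "complex_iso B C"
  shows "complex_iso A C"
proof -
  obtain \<phi> where \<phi>: "inj_on \<phi> (\<Union>A)" "B = relabel \<phi> A" using assms(1) complex_iso_iff by blast
  obtain \<psi> where \<psi>: "inj_on \<psi> (\<Union>B)" "C = relabel \<psi> B" using assms(2) complex_iso_iff by blast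
  have "inj_on (\<lambda>x. \<psi> (\<phi> x)) (\<Union>A)"
    using comp_inj_on[OF \<phi>(1)] \<psi>(1) unfolding \<phi>(2) Union_relabel comp_def by blast
  then show ?thesis unfolding complex_iso_iff using \<phi>(2) \<psi>(2) relabel_relabel by blast
qed

lemma complex_iso_sym:
  assumes "complex_iso A B"
  shows "complex_iso B A"
proof -
  obtain \<phi> where \<phi>: "inj_on \<phi> (\<Union>A)" "B = relabel \<phi> A" using assms complex_iso_iff by blast
  let ?\<psi> = "inv_into (\<Union>A) \<phi>"
  have "inj_on ?\<psi> (\<Union>B)" unfolding \<phi>(2) Union_relabel by (rule inj_on_inv_into) simp
  moreover have "relabel ?\<psi> B = relabel (\<lambda>x. x) A"
    unfolding \<phi>(2) relabel_relabel by (rule relabel_cong) (simp add: inv_into_f_f[OF \<phi>(1)])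
  ultimately show ?thesis unfolding complex_iso_iff relabel_id by metis
qed

lemma complex_iso_face_poly:
  assumes "complex_iso A B"
  shows "face_poly A = face_poly B" "card (\<Union>A) = card (\<Union>B)"
proof -
  obtain \<phi> where \<phi>: "inj_on \<phi> (\<Union>A)" "B = relabel \<phi> A" using assms complex_iso_iff by blast
  show "face_poly A = face_poly B" unfolding \<phi>(2) face_poly_relabel[OF \<phi>(1)] ..
  show "card (\<Union>A) = card (\<Union>B)" unfolding \<phi>(2) Union_relabel card_image[OF \<phi>(1)] ..
qed

section \<open>Isomorphisms of joins, suspensions and subdivisions\<close>

lemma Union_join_subset: "\<Union>(join A B) \<subseteq> \<Union>A \<union> \<Union>B"
  by (auto simp: join_def)

lemma relabel_join: "relabel \<phi> (join A B) = join (relabel \<phi> A) (relabel \<phi> B)"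
proof
  show "relabel \<phi> (join A B) \<subseteq> join (relabel \<phi> A) (relabel \<phi> B)"
  proof
    fix x assume "x \<in> relabel \<phi> (join A B)"
    then obtain f g where "x = \<phi> ` (f \<union> g)" "f \<in> A" "g \<in> B" by (auto simp: relabel_def join_def)
    then show "x \<in> join (relabel \<phi> A) (relabel \<phi> B)"
      unfolding relabel_def join_def image_Un by blast
  qed
  show "join (relabel \<phi> A) (relabel \<phi> B) \<subseteq> relabel \<phi> (join A B)"
  proof
    fix x assume "x \<in> join (relabel \<phi> A) (relabel \<phi> B)"
    then obtain f g where "x = \<phi> ` f \<union> \<phi> ` g" "f \<in> A" "g \<in> B" by (auto simp: relabel_def join_def)
    then have "x = \<phi> ` (f \<union> g)" "f \<union> g \<in> join A B" by (auto simp: join_def)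
    then show "x \<in> relabel \<phi> (join A B)" unfolding relabel_def by blast
  qed
qed

lemma relabel_join_pieces:
  assumes "\<Union>A \<inter> \<Union>B = {}"
    and "inj_on \<phi> (\<Union>A)" "inj_on \<psi> (\<Union>B)" "\<phi> ` \<Union>A \<inter> \<psi> ` \<Union>B = {}"
  defines "\<chi> \<equiv> \<lambda>x. if x \<in> \<Union>A then \<phi> x else \<psi> x"
  shows "inj_on \<chi> (\<Union>(join A B))" "relabel \<chi> (join A B) = join (relabel \<phi> A) (relabel \<psi> B)"
proof -
  have B: "\<chi> x = \<psi> x" if "x \<in> \<Union>B" for x using that assms(1) unfolding \<chi>_def by auto
  have A: "\<chi> x = \<phi> x" if "x \<in> \<Union>A" for x using that unfolding \<chi>_def by simp
  have "inj_on \<chi> (\<Union>A \<union> \<Union>B)"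
  proof (rule inj_onI)
    fix x y assume xy: "x \<in> \<Union>A \<union> \<Union>B" "y \<in> \<Union>A \<union> \<Union>B" "\<chi> x = \<chi> y"
    have no: False if "a \<in> \<Union>A" "b \<in> \<Union>B" "\<chi> a = \<chi> b" for a b
    proof -
      have "\<phi> a = \<psi> b" using that A B by simp
      then show False using that(1,2) assms(4) by (metis IntI empty_iff imageI)
    qed
    from xy(1,2) consider "x \<in> \<Union>A" "y \<in> \<Union>A" | "x \<in> \<Union>B" "y \<in> \<Union>B" | "x \<in> \<Union>A" "y \<in> \<Union>B" | "y \<in> \<Union>A" "x \<in> \<Union>B" by blast
    then show "x = y"
    proof cases
      case 1 then show ?thesis using xy(3) A assms(2) by (auto dest: inj_onD)
    next
      case 2 then show ?thesis using xy(3) B assms(3) by (auto dest: inj_onD)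
    next
      case 3 then show ?thesis using no xy(3) by blast
    next
      case 4 then show ?thesis using no[OF 4 xy(3)[symmetric]] by blast
    qed
  qed
  then show "inj_on \<chi> (\<Union>(join A B))" by (rule inj_on_subset[OF _ Union_join_subset])
  have "relabel \<chi> A = relabel \<phi> A" by (rule relabel_cong[OF A])
  moreover have "relabel \<chi> B = relabel \<psi> B" by (rule relabel_cong[OF B])
  ultimately show "relabel \<chi> (join A B) = join (relabel \<phi> A) (relabel \<psi> B)"
    unfolding relabel_join by simp
qed

lemma complex_iso_join:
  assumes "complex_iso A A'" "complex_iso B B'" "\<Union>A \<inter> \<Union>B = {}" "\<Union>A' \<inter> \<Union>B' = {}"
  shows "complex_iso (join A B) (join A' B')"
proof -
  obtain \<phi> where \<phi>: "inj_on \<phi> (\<Union>A)" "A' = relabel \<phi> A" using assms(1) complex_iso_iff by blast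
  obtain \<psi> where \<psi>: "inj_on \<psi> (\<Union>B)" "B' = relabel \<psi> B" using assms(2) complex_iso_iff by blast
  have "\<phi> ` \<Union>A \<inter> \<psi> ` \<Union>B = {}" using assms(4) unfolding \<phi>(2) \<psi>(2) Union_relabel .
  note r = relabel_join_pieces[OF assms(3) \<phi>(1) \<psi>(1) this]
  show ?thesis unfolding complex_iso_iff \<phi>(2) \<psi>(2) using r by metis
qed

lemma join_commute: "join A B = join B A"
  unfolding join_def by blast

lemma complex_iso_two_points:
  assumes "x \<noteq> y" "x' \<noteq> y'"
  shows "complex_iso {{}, {x}, {y}} {{}, {x'}, {y'}}"
proof -
  let ?\<phi> = "\<lambda>z. if z = x then x' else y'"
  have "inj_on ?\<phi> (\<Union>{{}, {x}, {y}})" using assms by (auto simp: inj_on_def)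
  moreover have "relabel ?\<phi> {{}, {x}, {y}} = {{}, {x'}, {y'}}" using assms by (auto simp: relabel_def)
  ultimately show ?thesis unfolding complex_iso_iff by metis
qed

lemma complex_iso_suspension:
  assumes "complex_iso \<Gamma> (suspension_power m X)" "{} \<in> X" "v \<noteq> w" "v \<notin> \<Union>\<Gamma>" "w \<notin> \<Union>\<Gamma>"
  shows "complex_iso (join {{}, {v}, {w}} \<Gamma>) (suspension_power (Suc m) X)"
  unfolding suspension_power.simps
  using assms(3-5)
  by (intro complex_iso_join complex_iso_two_points assms(1) suspension_power_disjoint[OF assms(2)]) auto

lemma first_type_suspension:
  assumes "first_type l \<Gamma>" "v \<noteq> w" "v \<notin> \<Union>\<Gamma>" "w \<notin> \<Union>\<Gamma>"
  shows "first_type l (join {{}, {v}, {w}} \<Gamma>)"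
proof -
  let ?F = "join (relabel Inl (join_power (l - 2) C5)) (relabel Inr C6)"
  have "{} \<in> relabel Inl (join_power (l - 2) C5)" "{} \<in> relabel Inr C6"
    using Union_join_power[OF simplicial_complexD(2)[OF simplicial_complex_cycle], of "l - 2" 5]
      simplicial_complexD(2)[OF simplicial_complex_cycle, of 6] by (auto simp: relabel_def)
  then have "{} \<union> {} \<in> ?F" unfolding join_def by blast
  then have e: "{} \<in> ?F" by simp
  obtain m where "complex_iso \<Gamma> (suspension_power m ?F)" using assms(1) unfolding first_type_def by blast
  then have "complex_iso (join {{}, {v}, {w}} \<Gamma>) (suspension_power (Suc m) ?F)"
    using complex_iso_suspension[OF _ e assms(2-4)] by blast
  then show ?thesis unfolding first_type_def by blast
qed

text \<open>The map is extended by sending \<open>w\<close> to \<open>w'\<close>. With the identity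
  as \<open>\<phi>\<close>, this shows that the choice of the new vertex does not matter.\<close>

lemma stellar_iso:
  assumes "simplicial_complex X" "inj_on \<phi> (\<Union>X)" "e \<in> X" "w \<notin> \<Union>X" "w' \<notin> \<phi> ` \<Union>X"
  shows "complex_iso (stellar_subdivision e w X) (stellar_subdivision (\<phi> ` e) w' (relabel \<phi> X))"
proof -
  let ?\<psi> = "\<phi>(w := w')"
  have on: "?\<psi> ` g = \<phi> ` g" if "g \<in> X" for g using that assms(4) by (intro image_cong) auto
  have sub: "g \<subseteq> \<Union>X" if "g \<in> X" for g using that by blast
  have hX: "h \<in> X" if "h \<subseteq> e" for h using simplicial_complexD(3)[OF assms(1,3) that] .
  have "\<Union>(stellar_subdivision e w X) \<subseteq> insert w (\<Union>X)"
  proof -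
    have "h \<subseteq> \<Union>X" if "h \<subset> e" for h using that assms(3) by blast
    then show ?thesis unfolding stellar_subdivision_def link_def by fast
  qed
  moreover have "inj_on ?\<psi> (insert w (\<Union>X))"
    using assms(2,4,5) by (auto simp: inj_on_def)
  ultimately have inj: "inj_on ?\<psi> (\<Union>(stellar_subdivision e w X))" by (rule inj_on_subset[rotated])
  have L: "link (relabel \<phi> X) (\<phi> ` e) = relabel \<phi> (link X e)" by (rule link_relabel[OF assms(2,3)])
  have P1: "(\<lambda>f. ?\<psi> ` f) ` {g \<in> X. \<not> e \<subseteq> g} = {g \<in> relabel \<phi> X. \<not> \<phi> ` e \<subseteq> g}"
  proof -
    have "\<phi> ` e \<subseteq> \<phi> ` g \<longleftrightarrow> e \<subseteq> g" if "g \<in> X" for g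
    proof
      assume *: "\<phi> ` e \<subseteq> \<phi> ` g"
      show "e \<subseteq> g"
      proof
        fix x assume x: "x \<in> e"
        then have "\<phi> x \<in> \<phi> ` g" "x \<in> \<Union>X" using * sub[OF assms(3)] by blast+
        then show "x \<in> g" using inj_on_image_mem_iff[OF assms(2) _ sub[OF that]] by blast
      qed
    qed (rule image_mono)
    then have "{g \<in> X. \<not> e \<subseteq> g} = {g \<in> X. \<not> \<phi> ` e \<subseteq> \<phi> ` g}" by blast
    moreover have "{g \<in> relabel \<phi> X. \<not> \<phi> ` e \<subseteq> g} = (\<lambda>f. \<phi> ` f) ` {g \<in> X. \<not> \<phi> ` e \<subseteq> \<phi> ` g}"
      by (auto simp: relabel_def)
    ultimately have "{g \<in> relabel \<phi> X. \<not> \<phi> ` e \<subseteq> g} = (\<lambda>f. \<phi> ` f) ` {g \<in> X. \<not> e \<subseteq> g}"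
      by simp
    also have "\<dots> = (\<lambda>f. ?\<psi> ` f) ` {g \<in> X. \<not> e \<subseteq> g}"
      by (intro image_cong refl on[symmetric]) blast
    finally show ?thesis by simp
  qed
  have im: "?\<psi> ` ({w} \<union> h \<union> g) = {w'} \<union> \<phi> ` h \<union> \<phi> ` g" if "h \<subset> e" "g \<in> link X e" for h g
  proof -
    have "g \<in> X" using that(2) by (simp add: link_def)
    moreover have "h \<in> X" using hX that(1) by blast
    moreover have "?\<psi> ` {w} = {w'}" by simp
    ultimately show ?thesis using on unfolding image_Un by simp
  qed
  have P2: "(\<lambda>f. ?\<psi> ` f) ` {{w} \<union> h \<union> g | h g. h \<subset> e \<and> g \<in> link X e} =
      {{w'} \<union> h \<union> g | h g. h \<subset> \<phi> ` e \<and> g \<in> relabel \<phi> (link X e)}"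
  proof (intro set_eqI iffI)
    fix x assume "x \<in> (\<lambda>f. ?\<psi> ` f) ` {{w} \<union> h \<union> g | h g. h \<subset> e \<and> g \<in> link X e}"
    then obtain h g where hg: "h \<subset> e" "g \<in> link X e" "x = ?\<psi> ` ({w} \<union> h \<union> g)" by blast
    have "\<phi> ` h \<subset> \<phi> ` e"
      using hg(1) inj_on_image_eq_iff[OF assms(2), of h e] sub[OF assms(3)] by auto
    then show "x \<in> {{w'} \<union> h \<union> g | h g. h \<subset> \<phi> ` e \<and> g \<in> relabel \<phi> (link X e)}"
      using im[OF hg(1,2)] hg unfolding relabel_def by blast
  next
    fix x assume "x \<in> {{w'} \<union> h \<union> g | h g. h \<subset> \<phi> ` e \<and> g \<in> relabel \<phi> (link X e)}"
    then obtain h' g where hg: "h' \<subset> \<phi> ` e" "g \<in> link X e" "x = {w'} \<union> h' \<union> \<phi> ` g"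
      unfolding relabel_def by blast
    then obtain h where h: "h \<subseteq> e" "h' = \<phi> ` h" by (meson psubset_imp_subset subset_image_iff)
    then have "h \<subset> e" using hg(1) by blast
    then show "x \<in> (\<lambda>f. ?\<psi> ` f) ` {{w} \<union> h \<union> g | h g. h \<subset> e \<and> g \<in> link X e}"
      using im[OF _ hg(2)] hg(2,3) h(2) by (intro image_eqI[of _ _ "{w} \<union> h \<union> g"]) blast+
  qed
  have "relabel ?\<psi> (stellar_subdivision e w X) = stellar_subdivision (\<phi> ` e) w' (relabel \<phi> X)"
    unfolding stellar_subdivision_def L relabel_def[of ?\<psi>] image_Un P1 P2 ..
  then show ?thesis using inj unfolding complex_iso_iff by metis
qed

text \<open>As \<open>e\<close> lies in \<open>Y\<close>, a face of the join contains it exactly if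
  the part in \<open>Y\<close> does. This lets further suspensions be added around a subdivided
  complex.\<close>

lemma stellar_join:
  assumes "simplicial_complex S" "simplicial_complex Y" "\<Union>S \<inter> \<Union>Y = {}" "e \<in> Y"
  shows "stellar_subdivision e w (join S Y) = join S (stellar_subdivision e w Y)"
proof -
  have L: "link (join S Y) e = join S (link Y e)" by (rule link_join_right[OF assms])
  have "{g \<in> join S Y. \<not> e \<subseteq> g} = join S {g \<in> Y. \<not> e \<subseteq> g}"
  proof -
    have "e \<subseteq> s \<union> y \<longleftrightarrow> e \<subseteq> y" if "s \<in> S" for s y
    proof -
      have "e \<inter> s = {}" using that assms(3,4) by blast
      then show ?thesis by blast
    qed
    then show ?thesis unfolding join_def by blast
  qed
  moreover have "{{w} \<union> h \<union> g | h g. h \<subset> e \<and> g \<in> join S (link Y e)} =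
      join S {{w} \<union> h \<union> g | h g. h \<subset> e \<and> g \<in> link Y e}"
  proof (intro set_eqI iffI)
    fix x assume "x \<in> {{w} \<union> h \<union> g | h g. h \<subset> e \<and> g \<in> join S (link Y e)}"
    then obtain h s g where "x = {w} \<union> h \<union> (s \<union> g)" "h \<subset> e" "s \<in> S" "g \<in> link Y e"
      unfolding join_def by blast
    moreover from this have "x = s \<union> ({w} \<union> h \<union> g)" by blast
    ultimately show "x \<in> join S {{w} \<union> h \<union> g | h g. h \<subset> e \<and> g \<in> link Y e}" unfolding join_def by blast
  next
    fix x assume "x \<in> join S {{w} \<union> h \<union> g | h g. h \<subset> e \<and> g \<in> link Y e}"
    then obtain h s g where "x = s \<union> ({w} \<union> h \<union> g)" "h \<subset> e" "s \<in> S" "g \<in> link Y e"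
      unfolding join_def by blast
    moreover from this have "x = {w} \<union> h \<union> (s \<union> g)" by blast
    ultimately show "x \<in> {{w} \<union> h \<union> g | h g. h \<subset> e \<and> g \<in> join S (link Y e)}" unfolding join_def by blast
  qed
  moreover have "join S (P \<union> Q) = join S P \<union> join S Q" for P Q unfolding join_def by blast
  ultimately show ?thesis unfolding stellar_subdivision_def L by simp
qed

lemma Union_stellar:
  assumes "simplicial_complex X" "{u, v} \<in> X" "u \<noteq> v"
  shows "\<Union>(stellar_subdivision {u, v} w X) = insert w (\<Union>X)"
proof
  have "h \<subseteq> \<Union>X" if "h \<subset> {u, v}" for h using that assms(2) by blast
  then show "\<Union>(stellar_subdivision {u, v} w X) \<subseteq> insert w (\<Union>X)"
    unfolding stellar_subdivision_def link_def by fast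
  have "{w} \<union> {} \<union> {} \<in> stellar_subdivision {u, v} w X"
  proof -
    have "{} \<in> link X {u, v}" using assms(2) simplicial_complexD(2)[OF assms(1)] by (simp add: link_def)
    moreover have "{} \<subset> {u, v}" by blast
    ultimately show ?thesis unfolding stellar_subdivision_def by blast
  qed
  moreover have "{x} \<in> stellar_subdivision {u, v} w X" if "x \<in> \<Union>X" for x
  proof -
    have "\<not> {u, v} \<subseteq> {x}" using assms(3) by auto
    then show ?thesis using vertex_face[OF assms(1) that] unfolding stellar_subdivision_def by simp
  qed
  ultimately show "insert w (\<Union>X) \<subseteq> \<Union>(stellar_subdivision {u, v} w X)" by blast
qed

abbreviation C5s :: "nat \<Rightarrow> nat \<Rightarrow> (nat \<times> bool + nat \<times> nat) set set" where
  "C5s m k \<equiv> suspension_power m (join_power k C5)"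

lemma C5s_complex: "simplicial_complex (join_power k C5)" "simplicial_complex (C5s m k)"
  by (intro simplicial_complex_suspension_power simplicial_complex_join_power simplicial_complex_cycle)+

lemma Union_C5s: "\<Union>(C5s m k) = suspension_vertices m \<union> Inr ` ({..<k} \<times> {..<5})"
  using Union_suspension_power[OF simplicial_complexD(2)[OF C5s_complex(1)]]
    Union_join_power[OF simplicial_complexD(2)[OF simplicial_complex_cycle]]
  by (simp add: Union_cycle_complex)

lemma second_typeI:
  assumes "{u, v} \<in> C5s m (l - 1)" "u \<noteq> v" "u \<in> suspension_vertices m" "w \<notin> \<Union>(C5s m (l - 1))"
    "complex_iso \<Delta> (stellar_subdivision {u, v} w (C5s m (l - 1)))"
  shows "second_type l \<Delta>"
  unfolding second_type_def Let_def using assms by blast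

lemma second_typeE:
  assumes "second_type l \<Delta>"
  obtains m u v w where
    "{u, v} \<in> C5s m (l - 1)" "u \<noteq> v" "u \<in> suspension_vertices m" "w \<notin> \<Union>(C5s m (l - 1))"
    "complex_iso \<Delta> (stellar_subdivision {u, v} w (C5s m (l - 1)))"
  using assms unfolding second_type_def Let_def by blast

lemma second_type_suspension:
  assumes "second_type l \<Gamma>" "x \<noteq> y" "x \<notin> \<Union>\<Gamma>" "y \<notin> \<Union>\<Gamma>"
  shows "second_type l (join {{}, {x}, {y}} \<Gamma>)"
proof -
  obtain m u v w where *: "{u, v} \<in> C5s m (l - 1)" "u \<noteq> v" "u \<in> suspension_vertices m"
    "w \<notin> \<Union>(C5s m (l - 1))" "complex_iso \<Gamma> (stellar_subdivision {u, v} w (C5s m (l - 1)))"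
    using assms(1) by (rule second_typeE)
  let ?X = "C5s m (l - 1)" and ?X' = "C5s (Suc m) (l - 1)"
  let ?S = "{{}, {Inl (m, False)}, {Inl (m, True) :: nat \<times> bool + nat \<times> nat}}"
  \<comment> \<open>The old \<open>w\<close> may be one of the two vertices of the additional
    suspension, so the subdivision is first moved to a vertex that is new for the larger
    complex.\<close>
  have "infinite (UNIV :: (nat \<times> bool + nat \<times> nat) set)"
    using finite_imageD[of Inl UNIV] infinite_UNIV_nat by (simp add: finite_prod)
  then obtain w' where w': "w' \<notin> \<Union>?X'"
    using ex_new_if_finite simplicial_complexD(1)[OF C5s_complex(2)] by blast
  note dis = suspension_power_disjoint[OF simplicial_complexD(2)[OF C5s_complex(1)], of m "l - 1"]
  have UX': "\<Union>?X' = \<Union>?S \<union> \<Union>?X"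
    unfolding suspension_power.simps
    by (rule Union_join) (use simplicial_complexD(2)[OF C5s_complex(2)] in auto)
  have st: "stellar_subdivision {u, v} w' ?X' = join ?S (stellar_subdivision {u, v} w' ?X)"
    unfolding suspension_power.simps
    by (rule stellar_join[OF simplicial_complex_two_points C5s_complex(2) dis *(1)])
  have "w' \<notin> \<Union>?X" using w' UX' by blast
  then have "complex_iso (stellar_subdivision {u, v} w ?X) (stellar_subdivision {u, v} w' ?X)"
    using stellar_iso[OF C5s_complex(2), of "\<lambda>x. x" m "l - 1" "{u, v}" w w'] *(1,4)
    by (simp add: relabel_id)
  then have iso: "complex_iso \<Gamma> (stellar_subdivision {u, v} w' ?X)" using *(5) complex_iso_trans by blast
  have US: "\<Union>(stellar_subdivision {u, v} w' ?X) = insert w' (\<Union>?X)"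
    by (rule Union_stellar[OF C5s_complex(2) *(1,2)])
  have "complex_iso (join {{}, {x}, {y}} \<Gamma>) (stellar_subdivision {u, v} w' ?X')"
    unfolding st
  proof (rule complex_iso_join[OF complex_iso_two_points iso])
    show "\<Union>{{}, {x}, {y}} \<inter> \<Union>\<Gamma> = {}" using assms(3,4) by auto
    show "\<Union>?S \<inter> \<Union>(stellar_subdivision {u, v} w' ?X) = {}"
      unfolding US using dis w' UX' by blast
  qed (use assms(2) in auto)
  moreover have "{u, v} \<in> ?X'"
    using *(1) unfolding suspension_power.simps join_def by blast
  moreover have "u \<in> suspension_vertices (Suc m)" using *(3) by (auto simp: suspension_vertices_def)
  ultimately show ?thesis using second_typeI[OF _ *(2) _ w'] by blast
qed

section \<open>Realising the configurations as complexes of the two types\<close>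

context ugraph
begin

lemma cliques_joined:
  assumes "joined A Z"
  shows "cliques (A \<union> Z) = join (cliques A) (cliques Z)"
proof
  show "cliques (A \<union> Z) \<subseteq> join (cliques A) (cliques Z)"
  proof
    fix f assume f: "f \<in> cliques (A \<union> Z)"
    then have "f = f \<inter> A \<union> f \<inter> Z" "f \<inter> A \<in> cliques A" "f \<inter> Z \<in> cliques Z"
      by (auto simp: cliques_def)
    then show "f \<in> join (cliques A) (cliques Z)" unfolding join_def by blast
  qed
  show "join (cliques A) (cliques Z) \<subseteq> cliques (A \<union> Z)"
  proof
    fix x assume "x \<in> join (cliques A) (cliques Z)"
    then obtain f g where fg: "x = f \<union> g" "f \<in> cliques A" "g \<in> cliques Z" unfolding join_def by blast
    have "E a z" "E z a" if "a \<in> f" "z \<in> g" for a z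
    proof -
      have "a \<in> A" "z \<in> Z" using that fg by (auto simp: cliques_def)
      then show "E a z" "E z a" using assms sym by (auto simp: joined_def)
    qed
    then show "x \<in> cliques (A \<union> Z)" using fg by (auto simp: cliques_def)
  qed
qed

lemma cycle_triangle_free:
  fixes i j k n :: nat
  assumes "n \<ge> 4" "i < n" "j < n" "k < n"
    and "j = (i + 1) mod n \<or> i = (j + 1) mod n" "k = (j + 1) mod n \<or> j = (k + 1) mod n"
    "i = (k + 1) mod n \<or> k = (i + 1) mod n"
  shows False
proof -
  have m: "(x + 1) mod n = (if x + 1 = n then 0 else x + 1)" if "x < n" for x
    using that by auto
  show ?thesis using assms(1,5-7) unfolding m[OF assms(2)] m[OF assms(3)] m[OF assms(4)]
    by (auto split: if_splits)
qed

text \<open>For n \<ge> 4 the ring contains no triangle, so its cliques have at most two elements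
  and are the faces of the cycle.\<close>

lemma ring_iso:
  assumes "ring n A" "n \<ge> 4"
  shows "complex_iso (cliques A) (cycle_complex n)"
proof -
  obtain f where f: "bij_betw f {..<n} A"
    and E: "\<And>i j. i < n \<Longrightarrow> j < n \<Longrightarrow> E (f i) (f j) \<longleftrightarrow> j = (i + 1) mod n \<or> i = (j + 1) mod n"
    using assms(1) by (auto simp: ring_def)
  have inj: "inj_on f {..<n}" and im: "f ` {..<n} = A" using f by (auto simp: bij_betw_def)
  have "relabel f (cycle_complex n) = cliques A"
  proof
    show "relabel f (cycle_complex n) \<subseteq> cliques A"
    proof
      fix g assume "g \<in> relabel f (cycle_complex n)"
      then obtain h where h: "h \<in> cycle_complex n" "g = f ` h" by (auto simp: relabel_def)
      have hn: "h \<subseteq> {..<n}" using h(1) Union_cycle_complex by blast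
      have "E (f i) (f j)" if "i \<in> h" "j \<in> h" "f i \<noteq> f j" for i j
      proof -
        have "{i, j} \<in> cycle_complex n"
          using simplicial_complexD(3)[OF simplicial_complex_cycle h(1), of "{i, j}"] that by blast
        moreover have "i \<noteq> j" using that(3) by blast
        ultimately show ?thesis using E cycle_edge_iff by blast
      qed
      then show "g \<in> cliques A"
        using h hn im finite_subset[OF hn] by (auto simp: cliques_def)
    qed
    show "cliques A \<subseteq> relabel f (cycle_complex n)"
    proof
      fix g assume g: "g \<in> cliques A"
      define h where "h = {i. i < n \<and> f i \<in> g}"
      have gh: "g = f ` h" using g im by (auto simp: h_def cliques_def)
      have hn: "h \<subseteq> {..<n}" "finite h" by (auto simp: h_def)
      have adj: "j = (i + 1) mod n \<or> i = (j + 1) mod n" if "i \<in> h" "j \<in> h" "i \<noteq> j" for i j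
      proof -
        have "f i \<noteq> f j" using that hn inj by (auto dest: inj_onD)
        then have "E (f i) (f j)" using g that by (auto simp: cliques_def h_def)
        then show ?thesis using E that by (auto simp: h_def)
      qed
      have "card h \<le> 2"
      proof (rule ccontr)
        assume "\<not> card h \<le> 2"
        then obtain T where "T \<subseteq> h" "card T = 3" using obtain_subset_with_card_n[of 3 h] by auto
        then obtain i j k where ijk: "i \<in> h" "j \<in> h" "k \<in> h" "i \<noteq> j" "j \<noteq> k" "i \<noteq> k"
          by (auto simp: card_3_iff)
        have lt: "i < n" "j < n" "k < n" using ijk by (auto simp: h_def)
        show False
          by (rule cycle_triangle_free[OF assms(2) lt adj[OF ijk(1,2,4)] adj[OF ijk(2,3,5)]
                adj[OF ijk(3,1) ijk(6)[symmetric]]])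
      qed
      then consider "h = {}" | i where "h = {i}" | i j where "h = {i, j}" "i \<noteq> j"
        using hn(2) by (metis (no_types, lifting) One_nat_def Suc_1 card_0_eq card_1_singletonE card_2_iff le_Suc_eq le_zero_eq)
      then have "h \<in> cycle_complex n"
      proof cases
        case 1 then show ?thesis by (simp add: cycle_complex_def)
      next
        case (2 i) then show ?thesis using hn by (auto simp: cycle_complex_def)
      next
        case (3 i j)
        then have "i < n" "j < n" using hn by auto
        then show ?thesis using cycle_edge_iff[OF 3(2), of n] adj[of i j] 3 by simp
      qed
      then show "g \<in> relabel f (cycle_complex n)" unfolding gh relabel_def by blast
    qed
  qed
  then have "complex_iso (cycle_complex n) (cliques A)"
    using complex_iso_relabel[of f "cycle_complex n"] inj by (simp add: Union_cycle_complex)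
  then show ?thesis by (rule complex_iso_sym)
qed

lemma C5_join_iso: "C5_join l U \<Longrightarrow> complex_iso (cliques U) (join_power l C5)"
proof (induction l arbitrary: U)
  case 0
  then have "cliques U = {{}}" by (auto simp: cliques_def)
  then show ?case unfolding complex_iso_iff by (auto simp: relabel_def)
next
  case (Suc l)
  then obtain A Z where AZ: "U = A \<union> Z" "ring 5 A" "joined A Z" "C5_join l Z" by auto
  have "complex_iso C5 (relabel (Pair l) C5)" by (rule complex_iso_relabel) (auto simp: inj_on_def)
  then have 1: "complex_iso (cliques A) (relabel (Pair l) C5)"
    using complex_iso_trans[OF ring_iso[OF AZ(2), simplified]] by blast
  have "complex_iso (join (cliques Z) (cliques A)) (join (join_power l C5) (relabel (Pair l) C5))"
    using joined_disjoint[OF AZ(3)]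
    by (intro complex_iso_join Suc.IH[OF AZ(4)] 1
        join_power_disjoint[OF simplicial_complexD(2)[OF simplicial_complex_cycle]])
      (auto simp: Union_cliques)
  then show ?case unfolding AZ(1) cliques_joined[OF AZ(3)] join_commute[of "cliques A"] by simp
qed

lemma first_config_type:
  assumes "first_config l U"
  shows "first_type l (cliques U)"
proof -
  obtain A Z where AZ: "U = A \<union> Z" "ring 6 A" "joined A Z" "C5_join (l - 2) Z"
    using assms by (auto simp: first_config_def)
  let ?F = "join (relabel Inl (join_power (l - 2) C5) :: (nat \<times> nat + nat) set set) (relabel Inr C6)"
  have 1: "complex_iso (cliques Z) (relabel (Inl :: _ \<Rightarrow> nat \<times> nat + nat) (join_power (l - 2) C5))"
    by (rule complex_iso_trans[OF C5_join_iso[OF AZ(4)] complex_iso_relabel]) (simp add: inj_on_def)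
  have 2: "complex_iso (cliques A) (relabel (Inr :: _ \<Rightarrow> nat \<times> nat + nat) C6)"
    by (rule complex_iso_trans[OF ring_iso[OF AZ(2), simplified] complex_iso_relabel]) (simp add: inj_on_def)
  have "complex_iso (join (cliques Z) (cliques A)) ?F"
    using joined_disjoint[OF AZ(3)]
    by (intro complex_iso_join 1 2) (auto simp: Union_cliques Union_relabel)
  then have "complex_iso (cliques U) ?F"
    unfolding AZ(1) cliques_joined[OF AZ(3)] join_commute[of "cliques A"] .
  moreover have "complex_iso ?F (suspension_power 0 ?F)"
    unfolding suspension_power.simps by (rule complex_iso_relabel) (simp add: inj_on_def)
  ultimately show ?thesis unfolding first_type_def using complex_iso_trans by blast
qed

lemma ring5_nbs:
  assumes "ring 5 A" "c \<in> A" "p \<in> A" "q \<in> A" "p \<noteq> q" "E c p" "E c q" "x \<in> A" "E c x"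
  shows "x = p \<or> x = q"
proof -
  obtain b c' d e where A: "A = {c, b, c', d, e}" "distinct [c, b, c', d, e]"
    "E c b" "E b c'" "E c' d" "E d e" "E e c"
    "\<not> E c c'" "\<not> E c d" "\<not> E b d" "\<not> E b e" "\<not> E c' e"
    using ring5E[OF assms(1,2)] by metis
  then have "y \<in> {b, e}" if "y \<in> A" "E c y" for y using that irrefl by auto
  then show ?thesis using assms by blast
qed

lemma simplicial_complex_cliques:
  assumes "finite U"
  shows "simplicial_complex (cliques U)"
  unfolding simplicial_complex_def Union_cliques using assms empty_clique clique_subset by blast

lemma insert_clique:
  "f \<in> cliques U \<Longrightarrow> x \<in> U \<Longrightarrow> (\<And>y. y \<in> f \<Longrightarrow> E x y) \<Longrightarrow> insert x f \<in> cliques U"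
  using sym by (auto simp: cliques_def)

text \<open>On \<open>A \<union> Z\<close>, the vertex \<open>a\<close> is adjacent to
  \<open>c\<close> and the neighbours of \<open>c\<close>, and \<open>b\<close> to everything but
  \<open>c\<close>. So cliques without \<open>a\<close> are the faces of the suspension, with apices
  \<open>v\<close> and \<open>b\<close>, that do not contain \<open>{b, c}\<close>, and cliques with
  \<open>a\<close> are the faces created by the subdivision.\<close>

lemma second_config_stellar:
  assumes fin: "finite U" and U: "U = {v, a, b} \<union> A \<union> Z" and A: "ring 5 A" and J: "joined ({v, a, b} \<union> A) Z"
    and out: "v \<notin> A" "a \<notin> A" "b \<notin> A" and va: "v \<noteq> a" "v \<noteq> b" "\<not> E v a" "\<not> E v b" "E a b" and vA: "joined {v} A"
    and pcq: "{p, c, q} \<subseteq> A" "p \<noteq> q" "E c p" "E c q"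
    and aA: "\<forall>x\<in>A. E a x \<longleftrightarrow> x \<in> {p, c, q}" and bA: "\<forall>x\<in>A. E b x \<longleftrightarrow> x \<noteq> c"
  shows "cliques U = stellar_subdivision {b, c} a (join {{}, {v}, {b}} (cliques (A \<union> Z)))"
    "{b, c} \<in> join {{}, {v}, {b}} (cliques (A \<union> Z))" "a \<notin> \<Union>(join {{}, {v}, {b}} (cliques (A \<union> Z)))"
proof -
  let ?S = "{{}, {v}, {b}}" and ?X = "A \<union> Z"
  let ?D = "join ?S (cliques ?X)"
  have nZ: "v \<notin> Z" "a \<notin> Z" "b \<notin> Z" "c \<notin> Z"
    using joined_disjoint[OF J] pcq(1) by blast+
  have ab: "a \<noteq> b" using va(5) irrefl by blast
  have cb: "c \<noteq> b" "c \<noteq> a" "c \<noteq> v" using pcq(1) out by auto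
  have nX: "v \<notin> ?X" "a \<notin> ?X" "b \<notin> ?X" using out nZ by auto
  have dis: "\<Union>?S \<inter> \<Union>(cliques ?X) = {}" using nX by (auto simp: Union_cliques)
  have D: "g \<in> ?D \<longleftrightarrow> g \<subseteq> {v, b} \<union> ?X \<and> \<not> {v, b} \<subseteq> g \<and> g \<inter> ?X \<in> cliques ?X" for g
  proof -
    have "\<Union>?S = {v, b}" by auto
    moreover have "g \<inter> {v, b} \<in> ?S \<longleftrightarrow> \<not> {v, b} \<subseteq> g" using va(2) by auto
    ultimately show ?thesis unfolding in_join_iff[OF dis] Union_cliques by blast
  qed
  have vX: "E v x" if "x \<in> ?X" for x using that vA J by (auto simp: joined_def)
  have bX: "E b x \<longleftrightarrow> x \<noteq> c" if "x \<in> ?X" for x using that bA J nZ(4) by (auto simp: joined_def)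
  \<comment> \<open>In the pentagon the neighbours of \<open>c\<close> are just \<open>p\<close> and
    \<open>q\<close>, so adjacency to \<open>a\<close> becomes a condition on \<open>c\<close> that
    also holds on \<open>Z\<close>.\<close>
  have aX: "E a x \<longleftrightarrow> x = c \<or> E c x" if "x \<in> ?X" for x
  proof (cases "x \<in> A")
    case True
    then show ?thesis using aA ring5_nbs[OF A _ _ _ pcq(2-4) True] pcq by auto
  next
    case False
    then have "x \<in> Z" using that by blast
    then show ?thesis using J pcq(1) by (auto simp: joined_def)
  qed
  have clq: "g \<in> cliques W \<longleftrightarrow> g \<subseteq> W \<and> finite g \<and> (\<forall>x\<in>g. \<forall>y\<in>g. x \<noteq> y \<longrightarrow> E x y)" for g W
    by (simp add: cliques_def)
  have cX: "{c} \<in> cliques ?X" using pcq(1) by (auto simp: cliques_def)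
  have "{b} \<union> {c} \<in> ?D" using cX unfolding join_def by blast
  then show e: "{b, c} \<in> ?D" by (simp add: insert_commute)
  show "a \<notin> \<Union>?D" using Union_join_subset[of ?S "cliques ?X"] nX va(1) ab by (auto simp: Union_cliques)
  have no_a: "g \<in> cliques U \<longleftrightarrow> g \<in> ?D \<and> \<not> {b, c} \<subseteq> g" if "a \<notin> g" for g
  proof
    assume g: "g \<in> cliques U"
    then have gc: "g \<subseteq> U" "finite g" "\<And>x y. x \<in> g \<Longrightarrow> y \<in> g \<Longrightarrow> x \<noteq> y \<Longrightarrow> E x y"
      by (auto simp: cliques_def)
    have "g \<subseteq> {v, b} \<union> ?X" using gc(1) that U by blast
    moreover have "\<not> {v, b} \<subseteq> g" using gc(3)[of v b] va by blast
    moreover have "g \<inter> ?X \<in> cliques ?X" using gc by (auto simp: cliques_def)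
    moreover have "\<not> {b, c} \<subseteq> g" using gc(3)[of b c] cb bA pcq(1) by blast
    ultimately show "g \<in> ?D \<and> \<not> {b, c} \<subseteq> g" using D by blast
  next
    assume "g \<in> ?D \<and> \<not> {b, c} \<subseteq> g"
    then have g: "g \<subseteq> {v, b} \<union> ?X" "\<not> {v, b} \<subseteq> g" "g \<inter> ?X \<in> cliques ?X" "\<not> {b, c} \<subseteq> g"
      using D by auto
    have gX: "E x y" if "x \<in> g" "y \<in> g" "x \<in> ?X" "y \<in> ?X" "x \<noteq> y" for x y
      using g(3) that unfolding clq by blast
    have one: "E x y" if "x \<in> g" "y \<in> g" "x = v \<or> x = b" "x \<noteq> y" for x y
    proof (cases "y \<in> ?X")
      case True
      then show ?thesis using that vX bX g(4) by blast
    next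
      case False
      then have "y = v \<or> y = b" using that(2) g(1) by blast
      then show ?thesis using that g(2) by blast
    qed
    have "E x y" if xy: "x \<in> g" "y \<in> g" "x \<noteq> y" for x y
    proof -
      consider "x = v \<or> x = b" | "y = v \<or> y = b" | "x \<in> ?X" "y \<in> ?X" using xy g(1) by blast
      then show ?thesis
      proof cases
        case 1 then show ?thesis using one xy by blast
      next
        case 2 then show ?thesis using one[OF xy(2,1)] xy(3) sym by blast
      next
        case 3 then show ?thesis using gX xy by blast
      qed
    qed
    moreover have "finite g"
    proof -
      have "g \<subseteq> {v, b} \<union> (g \<inter> ?X)" "finite (g \<inter> ?X)" using g(1,3) unfolding clq by blast+
      then show ?thesis using finite_subset by blast
    qed
    moreover have "g \<subseteq> U" using g(1) U by blast
    ultimately show "g \<in> cliques U" unfolding clq by blast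
  qed
  \<comment> \<open>The link of \<open>b\<close> in the two points is \<open>{{}}\<close>, so only
    the link of \<open>c\<close> in the cliques of \<open>A \<union> Z\<close> remains.\<close>
  have link: "k \<in> link ?D {b, c} \<longleftrightarrow> k \<subseteq> ?X - {c} \<and> insert c k \<in> cliques ?X" for k
  proof -
    have "link ?D ({b} \<union> {c}) = join (link ?S {b}) (link (cliques ?X) {c})"
    proof (rule link_join[OF simplicial_complex_two_points _ dis _ cX])
      have "finite ?X" using fin finite_subset[of ?X U] U by blast
      then show "simplicial_complex (cliques ?X)" by (rule simplicial_complex_cliques)
    qed simp
    moreover have "link ?S {b} = {{}}" using va(2) by (auto simp: link_def)
    ultimately have "link ?D {b, c} = link (cliques ?X) {c}" by (simp add: join_def insert_commute)
    then have "k \<in> link ?D {b, c} \<longleftrightarrow> k \<in> cliques ?X \<and> c \<notin> k \<and> insert c k \<in> cliques ?X"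
      by (simp add: link_def)
    moreover have "k \<in> cliques ?X" if "insert c k \<in> cliques ?X"
      by (rule clique_subset[OF that]) blast
    moreover have "k \<subseteq> ?X" if "k \<in> cliques ?X" using that by (simp add: cliques_def)
    ultimately show ?thesis by blast
  qed
  have cU: "cliques ?X \<subseteq> cliques U" using U by (intro cliques_mono) blast
  have inU: "a \<in> U" "b \<in> U" "c \<in> U" using U pcq(1) by auto
  have with_a: "g \<in> cliques U \<longleftrightarrow> (\<exists>h k. g = {a} \<union> h \<union> k \<and> h \<subset> {b, c} \<and> k \<in> link ?D {b, c})"
    if "a \<in> g" for g
  proof
    assume g: "g \<in> cliques U"
    then have gc: "g \<subseteq> U" "finite g" "\<And>x y. x \<in> g \<Longrightarrow> y \<in> g \<Longrightarrow> x \<noteq> y \<Longrightarrow> E x y"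
      by (auto simp: cliques_def)
    have "\<not> (b \<in> g \<and> c \<in> g)" using gc(3)[of b c] cb bA pcq(1) by blast
    then have h: "g \<inter> {b, c} \<subset> {b, c}" by blast
    let ?k = "g - {a, b, c}"
    have "v \<notin> g" using gc(3)[of v a] va(1,3) that by blast
    then have kX: "?k \<subseteq> ?X - {c}" using gc(1) U by blast
    have ck: "E c x" if "x \<in> ?k" for x
    proof -
      have "E a x" using gc(3)[of a x] that \<open>a \<in> g\<close> by blast
      moreover have "x \<in> ?X" "x \<noteq> c" using kX that by blast+
      ultimately show ?thesis using aX by blast
    qed
    have "?k \<in> cliques ?X" using kX gc(2,3) unfolding clq by blast
    then have "insert c ?k \<in> cliques ?X" using ck pcq(1) by (intro insert_clique) auto
    then have "?k \<in> link ?D {b, c}" using link kX by blast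
    moreover have "g = {a} \<union> (g \<inter> {b, c}) \<union> ?k" using that by blast
    ultimately show "\<exists>h k. g = {a} \<union> h \<union> k \<and> h \<subset> {b, c} \<and> k \<in> link ?D {b, c}" using h by blast
  next
    assume "\<exists>h k. g = {a} \<union> h \<union> k \<and> h \<subset> {b, c} \<and> k \<in> link ?D {b, c}"
    then obtain h k where g: "g = {a} \<union> h \<union> k" "h \<subset> {b, c}" "k \<subseteq> ?X - {c}" "insert c k \<in> cliques ?X"
      using link by blast
    have k: "k \<in> cliques U" "insert c k \<in> cliques U"
      using cU g(4) clique_subset[OF g(4), of k] by blast+
    have kc: "x \<noteq> c" "x \<in> ?X" if "x \<in> k" for x using g(3) that by blast+
    have ck: "E c x" if "x \<in> k" for x
      using g(4) that kc(1)[OF that] by (simp add: cliques_def)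
    have ak: "E a x" "E b x" if "x \<in> k" for x
      using ck[OF that] aX[OF kc(2)[OF that]] bX[OF kc(2)[OF that]] kc(1)[OF that] by simp_all
    have ac: "E a c" using aX pcq(1) by blast
    from g(2) consider "h = {}" | "h = {b}" | "h = {c}" by blast
    then show "g \<in> cliques U"
    proof cases
      case 1
      then show ?thesis unfolding g(1) using insert_clique[OF k(1) inU(1) ak(1)] by simp
    next
      case 2
      have "insert b k \<in> cliques U" using insert_clique[OF k(1) inU(2) ak(2)] .
      then have "insert a (insert b k) \<in> cliques U"
        by (rule insert_clique) (use inU(1) ak(1) va(5) in auto)
      then show ?thesis unfolding g(1) 2 by (simp add: insert_commute)
    next
      case 3
      have "insert a (insert c k) \<in> cliques U"
        by (rule insert_clique[OF k(2) inU(1)]) (use ak(1) ac in auto)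
      then show ?thesis unfolding g(1) 3 by (simp add: insert_commute)
    qed
  qed
  have aD: "a \<notin> g" if "g \<in> ?D" for g
    using \<open>a \<notin> \<Union>?D\<close> that by blast
  show "cliques U = stellar_subdivision {b, c} a ?D"
  proof (rule set_eqI)
    fix g
    have st: "g \<in> stellar_subdivision {b, c} a ?D \<longleftrightarrow> g \<in> ?D \<and> \<not> {b, c} \<subseteq> g \<or>
        (\<exists>h k. g = {a} \<union> h \<union> k \<and> h \<subset> {b, c} \<and> k \<in> link ?D {b, c})"
      unfolding stellar_subdivision_def by simp
    show "g \<in> cliques U \<longleftrightarrow> g \<in> stellar_subdivision {b, c} a ?D"
    proof (cases "a \<in> g")
      case True
      then have "g \<notin> ?D" using aD by blast
      then show ?thesis unfolding st with_a[OF True] by simp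
    next
      case False
      then have "\<not> (\<exists>h k. g = {a} \<union> h \<union> k \<and> h \<subset> {b, c} \<and> k \<in> link ?D {b, c})" by auto
      then show ?thesis unfolding st no_a[OF False] by (simp only: simp_thms)
    qed
  qed
qed

lemma C5_join_finite: "C5_join k U \<Longrightarrow> finite U"
  by (induction k arbitrary: U) (auto dest: ring_finite_card)

lemma second_config_type:
  assumes "second_config l U" "l \<ge> 2"
  shows "second_type l (cliques U)"
proof -
  obtain v a b A Z p c q where S: "U = {v, a, b} \<union> A \<union> Z" "ring 5 A" "C5_join (l - 2) Z"
    "joined ({v, a, b} \<union> A) Z" "v \<notin> A" "a \<notin> A" "b \<notin> A" "v \<noteq> a" "v \<noteq> b" "\<not> E v a" "\<not> E v b" "E a b"
    "joined {v} A" "{p, c, q} \<subseteq> A" "p \<noteq> q" "E c p" "E c q"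
    "\<forall>x\<in>A. E a x \<longleftrightarrow> x \<in> {p, c, q}" "\<forall>x\<in>A. E b x \<longleftrightarrow> x \<noteq> c"
    using assms(1) unfolding second_config_def by (elim exE conjE) (rule that; assumption)
  let ?X = "A \<union> Z" and ?S = "{{}, {v}, {b}}"
  let ?D = "join ?S (cliques ?X)"
  have fin: "finite U" "finite ?X"
    using S(1) ring_finite_card[OF S(2)] C5_join_finite[OF S(3)] by auto
  note st = second_config_stellar[OF fin(1) S(1,2,4-19)]
  have "joined A Z" using S(4) by (auto simp: joined_def)
  moreover have l: "l - 1 = Suc (l - 2)" using assms(2) by simp
  ultimately have "C5_join (l - 1) ?X" using S(2,3) unfolding l C5_join.simps by blast
  then obtain \<phi> where \<phi>: "inj_on \<phi> ?X" "join_power (l - 1) C5 = relabel \<phi> (cliques ?X)"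
    using C5_join_iso complex_iso_iff Union_cliques by metis
  \<comment> \<open>The apices \<open>v\<close> and \<open>b\<close> become the two vertices of a
    single suspension, so m = 1 and the edge \<open>{b, c}\<close> contains a suspension
    vertex.\<close>
  let ?\<sigma> = "\<lambda>x. if x = v then Inl (0, False) else (Inl (0, True) :: nat \<times> bool + nat \<times> nat)"
  let ?\<tau> = "\<lambda>x. (Inr (\<phi> x) :: nat \<times> bool + nat \<times> nat)"
  define \<chi> where "\<chi> x = (if x \<in> \<Union>?S then ?\<sigma> x else ?\<tau> x)" for x
  have nX: "v \<notin> ?X" "a \<notin> ?X" "b \<notin> ?X" using S(4-7) irrefl by (auto simp: joined_def)
  have dis: "\<Union>?S \<inter> \<Union>(cliques ?X) = {}" using nX by (auto simp: Union_cliques)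
  have 1: "inj_on ?\<sigma> (\<Union>?S)" using S(9) by (auto simp: inj_on_def)
  have 2: "inj_on ?\<tau> (\<Union>(cliques ?X))" using \<phi>(1) by (auto simp: inj_on_def Union_cliques)
  have 3: "?\<sigma> ` \<Union>?S \<inter> ?\<tau> ` \<Union>(cliques ?X) = {}" by auto
  have inj: "inj_on \<chi> (\<Union>?D)" and rel: "relabel \<chi> ?D = join (relabel ?\<sigma> ?S) (relabel ?\<tau> (cliques ?X))"
    using relabel_join_pieces[OF dis 1 2 3] unfolding \<chi>_def by blast+
  have "relabel ?\<sigma> ?S = {{}, {Inl (0, False)}, {Inl (0, True)}}" using S(9) by (auto simp: relabel_def)
  moreover have "relabel ?\<tau> (cliques ?X) = suspension_power 0 (join_power (l - 1) C5)"
    unfolding \<phi>(2) suspension_power.simps relabel_relabel ..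
  ultimately have X: "relabel \<chi> ?D = C5s 1 (l - 1)" unfolding rel by simp
  have scD: "simplicial_complex ?D"
    by (rule simplicial_complex_join[OF simplicial_complex_two_points simplicial_complex_cliques[OF fin(2)] dis])
  \<comment> \<open>The copies of the pentagon are numbered below l - 1, so the number l is
    free.\<close>
  let ?w = "Inr (l, 0) :: nat \<times> bool + nat \<times> nat"
  have w: "?w \<notin> \<Union>(C5s 1 (l - 1))" unfolding Union_C5s by (auto simp: suspension_vertices_def)
  then have w': "?w \<notin> \<chi> ` \<Union>?D" unfolding X[symmetric] Union_relabel .
  have bc: "\<chi> b = Inl (0, True)" "\<chi> c \<noteq> \<chi> b"
  proof -
    show b: "\<chi> b = Inl (0, True)" using S(9) by (simp add: \<chi>_def)
    have "c \<noteq> v" "c \<noteq> b" using S(5,7,14) by auto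
    then show "\<chi> c \<noteq> \<chi> b" unfolding b by (simp add: \<chi>_def)
  qed
  have "complex_iso (cliques U) (stellar_subdivision (\<chi> ` {b, c}) ?w (relabel \<chi> ?D))"
    unfolding st(1) by (rule stellar_iso[OF scD inj st(2,3) w'])
  then have iso: "complex_iso (cliques U) (stellar_subdivision {\<chi> b, \<chi> c} ?w (C5s 1 (l - 1)))"
    unfolding X by simp
  have "\<chi> ` {b, c} \<in> relabel \<chi> ?D" using st(2) unfolding relabel_def by blast
  then have "{\<chi> b, \<chi> c} \<in> C5s 1 (l - 1)" unfolding X by simp
  moreover have "\<chi> b \<in> suspension_vertices 1" unfolding bc(1) suspension_vertices_def
    by (intro CollectI exI[of _ 0] exI[of _ True]) simp
  ultimately show ?thesis using second_typeI[OF _ _ _ w iso] bc(2) by metis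
qed

lemma suspended_cliques:
  assumes "sph d U" "v \<in> U" "nn U v = {w}"
  shows "cliques U = join {{}, {v}, {w}} (cliques (nb U v))" "v \<noteq> w" "v \<notin> nb U v" "w \<notin> nb U v"
proof -
  have w: "w \<in> U" "w \<noteq> v" "\<not> E v w" using assms(3) by (auto simp: nn_def)
  show "v \<noteq> w" "v \<notin> nb U v" "w \<notin> nb U v" using w irrefl by (auto simp: nb_def)
  have "U = {v, w} \<union> nb U v" using nb_partition[OF assms(2)] assms(3) by auto
  moreover have "nb U w = nb U v" by (rule nb_eq_if_nn_single[OF assms])
  then have "joined {v, w} (nb U v)" unfolding joined_def by (auto simp: nb_def set_eq_iff)
  ultimately have "cliques U = join (cliques {v, w}) (cliques (nb U v))" using cliques_joined by metis
  moreover have "cliques {v, w} = {{}, {v}, {w}}"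
  proof
    show "cliques {v, w} \<subseteq> {{}, {v}, {w}}"
    proof
      fix f assume f: "f \<in> cliques {v, w}"
      then have "\<not> (v \<in> f \<and> w \<in> f)" using w by (auto simp: cliques_def)
      moreover have "f \<subseteq> {v, w}" using f by (simp add: cliques_def)
      ultimately show "f \<in> {{}, {v}, {w}}" by blast
    qed
    show "{{}, {v}, {w}} \<subseteq> cliques {v, w}" by (auto simp: cliques_def)
  qed
  ultimately show "cliques U = join {{}, {v}, {w}} (cliques (nb U v))" by simp
qed

lemma sph_gamma:
  assumes "l \<ge> 2" "sph d U" "card U = 2 * d + l" "has_gamma d (fpoly U) g"
  shows "g l = 1 \<and> g (l - 1) = int l \<or>
    g l = 0 \<and> g (l - 1) \<in> {0, 1, 2} \<and> (g (l - 1) = 2 \<longrightarrow> first_type l (cliques U) \<or> second_type l (cliques U))"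
  using assms(2-4)
proof (induction d arbitrary: U rule: less_induct)
  case (less d)
  from less.prems(1) show ?case
  proof (rule unsuspended_cases)
    assume un: "unsuspended U"
    show ?thesis
      using unsuspended_gamma[OF assms(1) less.prems(1) un less.prems(2,3)]
        first_config_type second_config_type[OF _ assms(1)] by blast
  next
    fix v w assume vw: "v \<in> U" "nn U v = {w}"
    obtain d' where d': "d = Suc d'" "sph d' (nb U v)" "card (nb U v) = 2 * d' + l"
      "has_gamma d' (fpoly (nb U v)) g"
      using suspended_step[OF less.prems(1) vw less.prems(2,3)] by blast
    note sc = suspended_cliques[OF less.prems(1) vw]
    have "first_type l (cliques (nb U v)) \<Longrightarrow> first_type l (cliques U)"
      unfolding sc(1) by (rule first_type_suspension) (use sc(2-4) in \<open>auto simp: Union_cliques\<close>)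
    moreover have "second_type l (cliques (nb U v)) \<Longrightarrow> second_type l (cliques U)"
      unfolding sc(1) by (rule second_type_suspension) (use sc(2-4) in \<open>auto simp: Union_cliques\<close>)
    ultimately show ?thesis using less.IH[of d' "nb U v"] d' by blast
  qed
qed

end

section \<open>The \<gamma>-vectors of the two types\<close>

lemma card_suspension_vertices: "finite (suspension_vertices m)" "card (suspension_vertices m) = 2 * m"
proof -
  have eq: "suspension_vertices m = Inl ` ({..<m} \<times> UNIV)" by (auto simp: suspension_vertices_def)
  show "finite (suspension_vertices m)" "card (suspension_vertices m) = 2 * m"
    unfolding eq by (auto simp: card_image inj_on_def card_cartesian_product)
qed

lemma card_suspension_power:
  fixes X :: "'a set set"
  assumes "simplicial_complex X"
  shows "card (\<Union>(suspension_power m X)) = 2 * m + card (\<Union>X)"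
proof -
  let ?V = "suspension_vertices m :: (nat \<times> bool + 'a) set"
  have "?V \<inter> Inr ` \<Union>X = {}" by (auto simp: suspension_vertices_def)
  then have "card (?V \<union> Inr ` \<Union>X) = card ?V + card ((Inr :: _ \<Rightarrow> nat \<times> bool + 'a) ` \<Union>X)"
    using simplicial_complexD(1)[OF assms] card_suspension_vertices(1)[of m]
    by (intro card_Un_disjoint) auto
  then show ?thesis
    using Union_suspension_power[OF simplicial_complexD(2)[OF assms], of m]
    by (simp add: card_suspension_vertices card_image)
qed

lemma Union_join_power_C5: "\<Union>(join_power k C5) = {..<k} \<times> {..<5}"
  using Union_join_power[OF simplicial_complexD(2)[OF simplicial_complex_cycle]]
  by (simp add: Union_cycle_complex)

lemma first_type_gamma:
  assumes "first_type l \<Delta>" "card (\<Union>\<Delta>) = 2 * d + l" "l \<ge> 2" "has_gamma d (face_poly \<Delta>) g"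
  shows "g (l - 1) = 2"
proof -
  let ?A = "relabel Inl (join_power (l - 2) C5) :: (nat \<times> nat + nat) set set"
  let ?B = "relabel Inr C6 :: (nat \<times> nat + nat) set set"
  obtain m where iso: "complex_iso \<Delta> (suspension_power m (join ?A ?B))"
    using assms(1) unfolding first_type_def by blast
  have scA: "simplicial_complex ?A" and scB: "simplicial_complex ?B"
    by (intro simplicial_complex_relabel C5s_complex simplicial_complex_cycle)+
  have dis: "\<Union>?A \<inter> \<Union>?B = {}" by (auto simp: Union_relabel)
  note sc = simplicial_complex_join[OF scA scB dis]
  have "\<Union>(join ?A ?B) = Inl ` ({..<l - 2} \<times> {..<5}) \<union> Inr ` {..<6}"
    using Union_join[OF simplicial_complexD(2)[OF scA] simplicial_complexD(2)[OF scB]]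
    by (simp add: Union_relabel Union_join_power_C5 Union_cycle_complex)
  moreover have "card (Inl ` ({..<l - 2} \<times> {..<5::nat}) \<union> (Inr :: nat \<Rightarrow> nat \<times> nat + nat) ` {..<6}) = (l - 2) * 5 + 6"
    by (subst card_Un_disjoint) (auto simp: card_image card_cartesian_product)
  ultimately have "card (\<Union>\<Delta>) = 2 * m + ((l - 2) * 5 + 6)"
    unfolding complex_iso_face_poly(2)[OF iso] card_suspension_power[OF sc] by simp
  \<comment> \<open>From the vertex count 2m + 5(l - 2) + 6 = 2d + l.\<close>
  then have d: "d = m + 2 * (l - 2) + 2" using assms(2,3) by simp
  have "face_poly ?A = (P\<alpha>^2 + P\<beta>) ^ (l - 2)"
    by (simp only: face_poly_relabel[of Inl] inj_Inl face_poly_join_power[OF simplicial_complex_cycle] face_poly_C5)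
  moreover have "face_poly ?B = P\<alpha>^2 + P\<beta> + P\<beta>"
    by (simp only: face_poly_relabel[of Inr] inj_Inr face_poly_C6)
  ultimately have "face_poly \<Delta> = P\<alpha> ^ m * (P\<alpha>^2 + P\<beta>) ^ (l - 2) * (P\<alpha>^2 + P\<beta> + P\<beta>)"
    unfolding complex_iso_face_poly(1)[OF iso] face_poly_suspension_power[OF sc] face_poly_join[OF scA scB dis]
    by (simp only: mult.assoc)
  then have g: "g = (\<lambda>j. int (Suc (l - 2) choose j) + case_nat 0 (\<lambda>j. int ((l - 2) choose j)) j)"
    using has_gamma_types[of m "l - 2"] has_gamma_unique[OF assms(4)] d by simp
  have "l - 1 = Suc (l - 2)" using assms(3) by simp
  then show ?thesis unfolding g by simp
qed

text \<open>If both ends are suspension vertices, the subdivision turns the square of their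
  suspensions into a pentagon, so the \<gamma>-polynomial is (1 + t)^l and \<open>g l = 1\<close>.
  If one end lies in a pentagon, the face polynomial is that of the first type.\<close>

lemma second_type_gamma:
  assumes "second_type l \<Delta>" "card (\<Union>\<Delta>) = 2 * d + l" "l \<ge> 2" "has_gamma d (face_poly \<Delta>) g"
  shows "g l = 1 \<or> g (l - 1) = 2"
proof -
  obtain m u v w where *: "{u, v} \<in> C5s m (l - 1)" "u \<noteq> v" "u \<in> suspension_vertices m"
    "w \<notin> \<Union>(C5s m (l - 1))" and iso: "complex_iso \<Delta> (stellar_subdivision {u, v} w (C5s m (l - 1)))"
    using assms(1) by (rule second_typeE)
  let ?Y = "join_power (l - 1) C5" and ?X = "C5s m (l - 1)"
  let ?c = "P\<alpha>^2 + P\<beta>"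
  have finX: "finite (\<Union>?X)" using simplicial_complexD(1)[OF C5s_complex(2)] .
  have "card (\<Union>?X) = 2 * m + (l - 1) * 5"
    using card_suspension_power[OF C5s_complex(1), of m "l - 1"]
    by (simp add: Union_join_power_C5 card_cartesian_product)
  then have "card (\<Union>\<Delta>) = Suc (2 * m + (l - 1) * 5)"
    unfolding complex_iso_face_poly(2)[OF iso] Union_stellar[OF C5s_complex(2) *(1,2)]
    using finX *(4) by simp
  then have d: "d = m + 2 * (l - 2) + 2" using assms(2,3) by simp
  have FY: "face_poly ?Y = ?c ^ (l - 1)"
    by (simp only: face_poly_join_power[OF simplicial_complex_cycle] face_poly_C5)
  have FX: "face_poly ?X = P\<alpha> ^ m * ?c ^ (l - 1)"
    by (simp only: face_poly_suspension_power[OF C5s_complex(1)] FY)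
  define \<Lambda> where "\<Lambda> = face_poly (link ?X {u, v})"
  have F: "face_poly \<Delta> = P\<alpha> ^ m * ?c ^ (l - 1) + P\<beta> * \<Lambda>"
    unfolding complex_iso_face_poly(1)[OF iso] face_poly_stellar[OF C5s_complex(2) *(1,2,4)] FX \<Lambda>_def ..
  have edge: "P\<alpha> * \<Lambda> = face_poly (link ?X {v})"
    unfolding \<Lambda>_def by (rule face_poly_link_suspension_edge[OF C5s_complex(1) *(3,1,2)])
  have l1: "l - 1 = Suc (l - 2)" using assms(3) by simp
  have "v \<in> suspension_vertices m \<union> Inr ` \<Union>?Y"
    using *(1) Union_suspension_power[OF simplicial_complexD(2)[OF C5s_complex(1)], of m "l - 1"] by blast
  then consider "v \<in> suspension_vertices m" | x where "v = Inr x" "x \<in> \<Union>?Y" by blast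
  then show ?thesis
  proof cases
    case 1
    \<comment> \<open>Two additional suspension factors avoid the exponent m - 2; by
      \<open>has_gamma_susp\<close> they do not affect \<open>g\<close>.\<close>
    have "P\<alpha> * (P\<alpha> * \<Lambda>) = P\<alpha> ^ m * ?c ^ (l - 1)"
      unfolding edge face_poly_link_suspension_vertex[OF C5s_complex(1) 1] FX ..
    then have "P\<alpha> * (P\<alpha> * face_poly \<Delta>) = P\<alpha> ^ m * ?c ^ l"
    proof -
      assume e: "P\<alpha> * (P\<alpha> * \<Lambda>) = P\<alpha> ^ m * ?c ^ (l - 1)"
      have "P\<alpha> * (P\<alpha> * face_poly \<Delta>) = P\<alpha>^2 * (P\<alpha> ^ m * ?c ^ (l - 1)) + P\<beta> * (P\<alpha> * (P\<alpha> * \<Lambda>))"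
        unfolding F by (simp only: power2_eq_square distrib_left mult_ac)
      also have "\<dots> = P\<alpha> ^ m * (?c ^ (l - 1) * ?c)"
        unfolding e by (simp only: distrib_left distrib_right mult_ac)
      also have "?c ^ (l - 1) * ?c = ?c ^ Suc (l - 1)" by (simp only: power_Suc2)
      also have "Suc (l - 1) = l" using assms(3) by simp
      finally show ?thesis .
    qed
    moreover have "has_gamma (Suc (Suc d)) (P\<alpha> * (P\<alpha> * face_poly \<Delta>)) g"
      by (intro has_gamma_susp assms(4))
    moreover have "Suc (Suc d) = m + 2 * l" using d assms(3) by simp
    ultimately have "has_gamma (m + 2 * l) (P\<alpha> ^ m * ?c ^ l) g" by simp
    then have "g = (\<lambda>j. int (l choose j))" using has_gamma_C5_power has_gamma_unique by blast
    then show ?thesis by simp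
  next
    case (2 x)
    have "P\<alpha> * \<Lambda> = P\<alpha> ^ m * face_poly (link ?Y {x})"
      unfolding edge 2(1) by (rule face_poly_link_base[OF C5s_complex(1) 2(2)])
    then have "?c * (P\<alpha> * \<Lambda>) = P\<alpha> ^ m * (?c * face_poly (link ?Y {x}))" by (simp only: mult_ac)
    also have "\<dots> = P\<alpha> ^ m * (P\<alpha> * ?c ^ (l - 1))" unfolding face_poly_link_join_power_C5[OF 2(2)] ..
    also have "\<dots> = ?c * (P\<alpha> * (P\<alpha> ^ m * ?c ^ (l - 2)))" unfolding l1 by (simp only: power_Suc mult_ac)
    finally have "?c * (P\<alpha> * \<Lambda>) = ?c * (P\<alpha> * (P\<alpha> ^ m * ?c ^ (l - 2)))" .
    moreover have "?c \<noteq> 0" "P\<alpha> \<noteq> 0" by (simp_all add: power2_eq_square)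
    ultimately have \<Lambda>: "\<Lambda> = P\<alpha> ^ m * ?c ^ (l - 2)" by (metis mult_left_cancel)
    have "face_poly \<Delta> = P\<alpha> ^ m * ?c ^ (l - 2) * (?c + P\<beta>)"
      unfolding F \<Lambda> l1 by (simp only: power_Suc distrib_left mult_ac)
    then have g: "g = (\<lambda>j. int (Suc (l - 2) choose j) + case_nat 0 (\<lambda>j. int ((l - 2) choose j)) j)"
      using has_gamma_types[of m "l - 2"] has_gamma_unique[OF assms(4)] d by simp
    show ?thesis unfolding g l1 by simp
  qed
qed

theorem theorem5p2:
  fixes \<Delta> :: "'a set set" and d l :: nat
  assumes "l \<ge> 2"
    and "homology_sphere TYPE('k::field) d \<Delta>"
    and "flag_complex \<Delta>"
    and "card (\<Union>\<Delta>) = 2 * d + l"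
  shows "gamma_vec d \<Delta> (l - 1) \<in> {0, 1, 2, int l} \<and>
    (gamma_vec d \<Delta> l = 0 \<longrightarrow>
       0 \<le> gamma_vec d \<Delta> (l - 1) \<and> gamma_vec d \<Delta> (l - 1) \<le> 2 \<and>
       (gamma_vec d \<Delta> (l - 1) = 2 \<longleftrightarrow> first_type l \<Delta> \<or> second_type l \<Delta>))"
proof -
  interpret ugraph "edge \<Delta>" by (rule ugraph_edge)
  have sc: "simplicial_complex \<Delta>" using assms(2) by (simp add: homology_sphere_def)
  have s: "sph d (\<Union>\<Delta>)" by (rule homology_sphere_sph[OF assms(2,3)])
  have cl: "cliques (\<Union>\<Delta>) = \<Delta>" by (rule flag_eq_cliques[OF sc assms(3)])
  have fp: "fpoly (\<Union>\<Delta>) = face_poly \<Delta>" unfolding fpoly_def cl face_poly_def ..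
  obtain g where g: "has_gamma d (face_poly \<Delta>) g" using sph_has_gamma[OF s] unfolding fp by blast
  have gv: "gamma_vec d \<Delta> = g" by (rule gamma_vec_eqI[OF simplicial_complexD(4)[OF sc] g])
  have "g l = 1 \<and> g (l - 1) = int l \<or>
      g l = 0 \<and> g (l - 1) \<in> {0, 1, 2} \<and> (g (l - 1) = 2 \<longrightarrow> first_type l \<Delta> \<or> second_type l \<Delta>)"
    using sph_gamma[OF assms(1) s assms(4)] g unfolding fp cl by blast
  moreover have "first_type l \<Delta> \<Longrightarrow> g (l - 1) = 2" by (rule first_type_gamma[OF _ assms(4,1) g])
  \<comment> \<open>The alternative \<open>g l = 1\<close> comes from subdividing an edge between
    two suspension vertices; the assumption \<open>gamma_vec d \<Delta> l = 0\<close> excludes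
    it.\<close>
  moreover have "second_type l \<Delta> \<Longrightarrow> g l = 1 \<or> g (l - 1) = 2"
    by (rule second_type_gamma[OF _ assms(4,1) g])
  ultimately show ?thesis unfolding gv by auto
qed

end
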